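(* For Lebesgue-almost every $(\ell_1,\ell_2,\ell_3)\in\mathbb{R}_+^3$, the 3-interval exchange transformation $T$ with lengths $\ell_1,\ell_2,\ell_3$ and permutation $\begin{pmatrix}1&2&3\\3&2&1\end{pmatrix}$ has the property that $T^n$ is disjoint from $T^m$ for all integers $0<n<m$.
   Context: The interval exchange transformation with lengths $\ell_1,\dots,\ell_d$ and permutation $\pi$ acts on $[0,\sum_i\ell_i)$, divided into consecutive half-open intervals $I_1,\dots,I_d$ of lengths $\ell_1,\dots,\ell_d$, by $T(x)=x-\sum_{k<j}\ell_k+\sum_{\pi(k)<\pi(j)}\ell_k$ for $x\in I_j$. It preserves normalized Lebesgue measure. Two measure preserving maps of probability spaces are disjoint if their only joining (invariant measure of the product map projecting to the given measure in each factor) is the product measure. *)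

theory Defs imports "HOL-Probability.Probability"
begin

text \<open>Lengths and permutations are indexed by \<open>1, \<dots>, d\<close>; values elsewhere are never used.\<close>

definition iet_interval :: "(nat \<Rightarrow> real) \<Rightarrow> nat \<Rightarrow> real set" where
  "iet_interval l j = {(\<Sum>k\<in>{1..<j}. l k) ..< (\<Sum>k\<in>{1..j}. l k)}"

text \<open>For positive lengths the index \<open>j\<close> is unique for every \<open>x\<close> in
  \<open>[0, \<Sum>k=1..d. l k)\<close>. Values at other \<open>x\<close> are unspecified; they lie outside the
  space of \<open>iet_measure\<close> below.\<close>

definition iet :: "nat \<Rightarrow> (nat \<Rightarrow> real) \<Rightarrow> (nat \<Rightarrow> nat) \<Rightarrow> real \<Rightarrow> real" where
  "iet d l \<pi> x =
     (let j = (THE j. j \<in> {1..d} \<and> x \<in> iet_interval l j)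
      in x - (\<Sum>k\<in>{1..<j}. l k) + (\<Sum>k | k \<in> {1..d} \<and> \<pi> k < \<pi> j. l k))"

definition iet_domain :: "nat \<Rightarrow> (nat \<Rightarrow> real) \<Rightarrow> real set" where
  "iet_domain d l = {0 ..< (\<Sum>k\<in>{1..d}. l k)}"

definition iet_measure :: "nat \<Rightarrow> (nat \<Rightarrow> real) \<Rightarrow> real measure" where
  "iet_measure d l =
     uniform_measure (restrict_space lborel (iet_domain d l)) (iet_domain d l)"

definition joining ::
  "'a measure \<Rightarrow> ('a \<Rightarrow> 'a) \<Rightarrow> 'b measure \<Rightarrow> ('b \<Rightarrow> 'b) \<Rightarrow> ('a \<times> 'b) measure \<Rightarrow> bool" where
  "joining M S N T J \<longleftrightarrow>
     sets J = sets (M \<Otimes>\<^sub>M N) \<and>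
     distr J M fst = M \<and> distr J N snd = N \<and>
     map_prod S T \<in> J \<rightarrow>\<^sub>M J \<and> distr J J (map_prod S T) = J"

text \<open>Stated as an equivalence so that the product measure is itself required to be a joining:
  maps that fail to preserve the measures are not disjoint vacuously.\<close>

definition disjoint_maps ::
  "'a measure \<Rightarrow> ('a \<Rightarrow> 'a) \<Rightarrow> 'b measure \<Rightarrow> ('b \<Rightarrow> 'b) \<Rightarrow> bool" where
  "disjoint_maps M S N T \<longleftrightarrow> (\<forall>J. joining M S N T J \<longleftrightarrow> J = M \<Otimes>\<^sub>M N)"

definition perm321 :: "nat \<Rightarrow> nat" where
  "perm321 = id(1 := 3, 2 := 2, 3 := 1)"

text \<open>In the three-element index type the numeral \<open>3\<close> equals \<open>0\<close>, so its linear order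
  is not that of \<open>1, 2, 3\<close>; hence the passage to natural-number indices.\<close>

definition lengths3 :: "real ^ 3 \<Rightarrow> nat \<Rightarrow> real" where
  "lengths3 v k = v $ of_nat k"

end

theory Submission imports Defs
begin

text \<open>
  The transformation is the first return map, to an arc of length \<open>D = a + b + c\<close>, of the rotation by \<open>C = b + c\<close>
  on a circle of circumference \<open>L = a + 2 b + c\<close>. Put \<open>\<alpha> = C / L\<close> and \<open>\<beta> = b / L\<close>. For almost all lengths and every
  small scale there are infinitely many \<open>q\<close> with \<open>q \<alpha> = p + d / q\<close>, \<open>p\<close> coprime to \<open>q\<close>, \<open>d > 0\<close> of the given
  scale, and \<open>q \<beta> = j + \<theta>\<close> with \<open>\<theta>\<close> away from the integers. During \<open>K q\<close> steps of the rotation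
  the complementary arc is visited \<open>K j + n\<close> times, where \<open>n\<close> depends only on the position of the starting point
  within its cell of length \<open>L / q\<close>. Hence with \<open>N = q - j\<close>
  \<open>\<integral> f \<circ> T ^ (K N) h = (1 - \<theta>) A\<^sub>0 + \<theta> A\<^sub>K + d R\<^sub>K + O (d) + o (1)\<close>, where \<open>A\<^sub>l = \<integral> f \<circ> T ^ l h\<close>,
  \<open>R\<^sub>K = 2 (A\<^sub>0 + \<dots> + A\<^sub>K) - (K + 1) (A\<^sub>0 + A\<^sub>K)\<close>, and the constant in \<open>O (d)\<close> does not depend on \<open>K\<close>.

  A joining of \<open>T ^ n\<close> and \<open>T ^ m\<close> lets one write the same correlation with \<open>K = s n\<close> and with \<open>K = s m\<close>. The main terms agree,
  so the second order terms \<open>R\<^sub>s\<^sub>n\<close> and \<open>R\<^sub>s\<^sub>m\<close> differ by a bounded amount, uniformly in \<open>s\<close>. Since \<open>n \<noteq> m\<close>, letting \<open>s\<close>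
  tend to infinity shows that the conditional density \<open>h\<close> is invariant under \<open>T ^ n\<close>; a second application of the
  expansion makes it invariant under \<open>T\<close>, hence constant.
\<close>

section \<open>Diophantine approximation of almost every pair\<close>

text \<open>The obstacle is that limits alone carry no information: the coupling
  \<open>corr f h (n * j) = corr k g (m * j)\<close> equates them on both sides. Hence
  \<open>d\<close> must not tend to 0 along the chosen times. It stays in a band [1/(2k), 1/k] while
  \<open>q\<close> grows, so the o(1) error still tends to 0 after division by \<open>d\<close>, and
  the coefficient of \<open>d\<close> can be read off. The O(d) error stems from the offsets \<rho>,
  which enter all windows in the same way; the increments that they multiply telescope, and so the
  constant does not grow with K. The sums inside R_K are not known either. Moving the base points
  from n i to n (i+1) and from m i to m (i+1) changes these sums boundedly, so that a difference of
  two comparisons isolates s (m - n) (B_i + B_{i+s}) with B_i = A_{n i} - A_{n (i+1)}. The bounds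
  1/4 \<le> \<theta> \<le> 3/4 and K d \<le> 1/4 make every window an interval inside one
  cell.\<close>

lemma AE_lebesgue_if_negligible:
  "negligible {x. \<not> P x} \<Longrightarrow> AE x in lebesgue. P x"
  unfolding eventually_ae_filter_negligible by (intro exI conjI) (assumption, rule subset_refl)

text \<open>Replaces a density point argument: \<open>E\<close> fills at most the fraction 1 - c of
  every interval, yet a set of positive measure has covers by nonoverlapping intervals whose total
  length exceeds its measure by as little as desired.\<close>

lemma negligible_if_intervals_avoid:
  fixes E :: "real set"
  assumes E: "E \<in> sets lebesgue" and "0 < c"
    and avoid: "\<And>a b. a < b \<Longrightarrow> \<exists>(F :: 'i set) l r. finite F \<and> disjoint_family_on (\<lambda>i. {l i..r i}) F \<and>
       (\<forall>i\<in>F. l i \<le> r i \<and> {l i..r i} \<subseteq> {a..b} - E) \<and> c * (b - a) \<le> (\<Sum>i\<in>F. r i - l i)"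
  shows "negligible E"
proof -
  have sparse: "measure lebesgue (E \<inter> {a..b}) \<le> (1 - c) * (b - a)" if ab: "a < b" for a b
  proof -
    obtain F :: "'i set" and l r where F: "finite F" "disjoint_family_on (\<lambda>i. {l i..r i}) F"
      and lr: "\<And>i. i \<in> F \<Longrightarrow> l i \<le> r i" "\<And>i. i \<in> F \<Longrightarrow> {l i..r i} \<subseteq> {a..b} - E"
      and c: "c * (b - a) \<le> (\<Sum>i\<in>F. r i - l i)"
      using avoid[OF ab] by blast
    have Em: "E \<inter> {a..b} \<in> lmeasurable"
      using fmeasurable_Int_fmeasurable[OF _ E, of "{a..b}"] by (simp add: Int_commute)
    have Um: "(\<Union>i\<in>F. {l i..r i}) \<in> lmeasurable"
      using F(1) by (intro fmeasurable.finite_UN) auto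
    have "measure lebesgue (\<Union>i\<in>F. {l i..r i}) = (\<Sum>i\<in>F. measure lebesgue {l i..r i})"
      using F lr(1) by (intro measure_finite_Union) (auto simp: top_unique)
    also have "\<dots> = (\<Sum>i\<in>F. r i - l i)"
      using lr by (intro sum.cong) auto
    finally have "(\<Sum>i\<in>F. r i - l i) = measure lebesgue (\<Union>i\<in>F. {l i..r i})" by simp
    moreover have "measure lebesgue (E \<inter> {a..b}) + measure lebesgue (\<Union>i\<in>F. {l i..r i})
        = measure lebesgue ((E \<inter> {a..b}) \<union> (\<Union>i\<in>F. {l i..r i}))"
      using fmeasurableD2[OF Em] fmeasurableD2[OF Um] fmeasurableD[OF Em] fmeasurableD[OF Um]
      by (intro measure_Union[symmetric]) (simp, simp, assumption, assumption, use lr(2) in blast)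
    moreover have "\<dots> \<le> measure lebesgue {a..b}"
    proof (rule measure_mono_fmeasurable)
      show "(E \<inter> {a..b}) \<union> (\<Union>i\<in>F. {l i..r i}) \<subseteq> {a..b}" using lr(2) by blast
      show "(E \<inter> {a..b}) \<union> (\<Union>i\<in>F. {l i..r i}) \<in> sets lebesgue" using Em Um by (intro sets.Un fmeasurableD)
    qed simp
    ultimately show ?thesis using c ab by (simp add: algebra_simps)
  qed
  \<comment> \<open>Tested on [0, 1], the bound shows c \<le> 1, so that inequalities may be
    multiplied by 1 - c below.\<close>
  have "measure lebesgue (E \<inter> {0..1}) \<le> 1 - c" using sparse[of 0 1] by simp
  then have c1: "0 \<le> 1 - c" by (meson measure_nonneg order_trans)
  have "negligible (E \<inter> cbox a b)" for a b
  proof -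
    define S where "S = E \<inter> cbox a b"
    have Sm: "S \<in> lmeasurable"
      unfolding S_def using fmeasurable_Int_fmeasurable[OF _ E, of "cbox a b"] by (simp add: Int_commute)
    have "measure lebesgue S = 0"
    proof (rule ccontr)
      define m where "m = measure lebesgue S"
      assume "measure lebesgue S \<noteq> 0"
      then have m: "m > 0" using measure_nonneg[of lebesgue S] unfolding m_def by linarith
      \<comment> \<open>The slack c m / 2 works because (1 - c) (1 + c / 2) < 1, which refutes m
        \<le> (1 - c) (m + c m / 2).\<close>
      have sub: "S \<subseteq> cbox a b" and pos: "0 < c * m / 2" using \<open>0 < c\<close> m by (auto simp: S_def)
      obtain \<D> where D: "countable \<D>" 
        "\<And>K. K \<in> \<D> \<Longrightarrow> K \<subseteq> cbox a b \<and> K \<noteq> {} \<and> (\<exists>c d. K = cbox c d)"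
        "pairwise (\<lambda>A B. interior A \<inter> interior B = {}) \<D>"
        "S \<subseteq> \<Union>\<D>" "\<Union>\<D> \<in> lmeasurable" "measure lebesgue (\<Union>\<D>) \<le> measure lebesgue S + c * m / 2"
        by (rule measurable_outer_intervals_bounded[OF Sm sub pos]) (rule that; assumption)
      have K: "measure lebesgue (S \<inter> K) \<le> (1 - c) * measure lebesgue K" if KD: "K \<in> \<D>" for K
      proof -
        obtain u v where uv: "K = {u..v}" "u \<le> v" using D(2)[OF KD] by (auto simp: box_real)
        show ?thesis
        proof (cases "u = v")
          case True
          have "measure lebesgue (S \<inter> K) \<le> measure lebesgue K"
            using Sm uv by (intro measure_mono_fmeasurable) (auto simp: fmeasurable_def)
          then show ?thesis using True uv by simp
        next
          case False
          have "measure lebesgue (S \<inter> K) \<le> measure lebesgue (E \<inter> {u..v})"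
            using Sm uv E fmeasurable_Int_fmeasurable[OF _ E, of "{u..v}"] unfolding S_def 
            by (intro measure_mono_fmeasurable) (auto simp: Int_commute[of E])
          then show ?thesis using sparse[of u v] False uv by simp
        qed
      qed
      have "measure lebesgue (\<Union>K\<in>\<D>. S \<inter> K) \<le> (1 - c) * measure lebesgue (\<Union>\<D>)"
      proof (rule measure_UN_bound[OF D(1)])
        show "S \<inter> K \<in> lmeasurable" if "K \<in> \<D>" for K
          using Sm D(2)[OF that] by (auto intro!: fmeasurable.Int)
        fix F assume F: "F \<subseteq> \<D>" "finite F"
        have Km: "K \<in> lmeasurable" if "K \<in> \<D>" for K using D(2)[OF that] by auto
        have "measure lebesgue (\<Union>K\<in>F. S \<inter> K) \<le> (\<Sum>K\<in>F. measure lebesgue (S \<inter> K))"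
          using F Sm Km by (intro measure_UNION_le) auto
        also have "\<dots> \<le> (\<Sum>K\<in>F. (1 - c) * measure lebesgue K)"
          using F K by (intro sum_mono) auto
        also have "\<dots> = (1 - c) * (\<Sum>K\<in>F. measure lebesgue K)"
          by (simp add: sum_distrib_left)
        also have "(\<Sum>K\<in>F. measure lebesgue K) = measure lebesgue (\<Union>F)"
        proof (rule measure_negligible_finite_Union[symmetric])
          show "pairwise (\<lambda>S T. negligible (S \<inter> T)) F"
          proof (rule pairwiseI)
            fix A B assume AB: "A \<in> F" "B \<in> F" "A \<noteq> B"
            have "interior (A \<inter> B) = {}"
              using D(3) F AB by (auto simp: pairwise_def)
            moreover have "convex (A \<inter> B)"
              using AB F D(2) by (metis convex_Int convex_box(1) subset_eq)
            ultimately show "negligible (A \<inter> B)"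
              by (simp add: negligible_convex_interior)
          qed
        qed (use F Km in auto)
        also have "measure lebesgue (\<Union>F) \<le> measure lebesgue (\<Union>\<D>)"
          using F Km D(5) by (intro measure_mono_fmeasurable) (auto intro!: sets.finite_Union simp: fmeasurable_def)
        finally show "measure lebesgue (\<Union>K\<in>F. S \<inter> K) \<le> (1 - c) * measure lebesgue (\<Union>\<D>)"
          using c1 by (simp add: mult_left_mono)
      qed
      also have "(\<Union>K\<in>\<D>. S \<inter> K) = S" using D(4) by auto
      finally have "m \<le> (1 - c) * measure lebesgue (\<Union>\<D>)" by (simp add: m_def)
      also have "\<dots> \<le> (1 - c) * (m + c * m / 2)"
        using D(6) c1 unfolding m_def by (intro mult_left_mono) auto
      finally have "c * m \<le> (1 - c) * (c * m) / 2" by (simp add: algebra_simps)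
      moreover have "c * m > 0" using m \<open>0 < c\<close> by simp
      moreover have "(1 - c) * (c * m) \<le> 1 * (c * m)"
        using \<open>0 < c\<close> \<open>c * m > 0\<close> by (intro mult_right_mono) auto
      ultimately show False by linarith
    qed
    then show ?thesis
      using Sm by (simp add: negligible_iff_measure S_def)
  qed
  then show ?thesis by (subst negligible_on_intervals) auto
qed

text \<open>The determinant \<open>p * q' - p' * q\<close> is a nonzero integer, hence at least 1 in
  absolute value; divide by \<open>q * q'\<close>, which is at most N^2.\<close>

lemma fractions_separated:
  fixes p q p' q' :: int and N :: real
  assumes "coprime p q" "coprime p' q'" "0 < q" "0 < q'" "of_int q \<le> N" "of_int q' \<le> N" "(p, q) \<noteq> (p', q')"
  shows "1 / N^2 \<le> \<bar>of_int p / of_int q - of_int p' / of_int q'\<bar>"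
proof -
  have "p * q' \<noteq> p' * q"
  proof
    assume eq: "p * q' = p' * q"
    then have "q dvd q'" "q' dvd q"
      using assms(1,2) by (metis coprime_commute coprime_dvd_mult_right_iff dvd_triv_right)+
    then have "q = q'" using assms by (metis zdvd_antisym_nonneg less_imp_le)
    then show False using eq assms by auto
  qed
  then have "1 \<le> \<bar>p * q' - p' * q\<bar>" by linarith
  then have 1: "1 \<le> \<bar>real_of_int p * of_int q' - of_int p' * of_int q\<bar>"
    by (metis of_int_1_le_iff of_int_abs of_int_diff of_int_mult)
  have "1 / N^2 \<le> 1 / (real_of_int q * of_int q')"
    using assms by (intro divide_left_mono) (auto simp: power2_eq_square intro!: mult_mono)
  also have "\<dots> \<le> \<bar>real_of_int p * of_int q' - of_int p' * of_int q\<bar> / (of_int q * of_int q')"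
    using 1 assms by (intro divide_right_mono) auto
  also have "\<dots> = \<bar>(real_of_int p * of_int q' - of_int p' * of_int q) / (of_int q * of_int q')\<bar>"
    using assms by (subst abs_divide) (simp add: abs_mult)
  also have "\<dots> = \<bar>of_int p / of_int q - of_int p' / of_int q'\<bar>"
    using assms by (simp add: diff_frac_eq)
  finally show ?thesis .
qed

text \<open>One multiplier suffices at each scale: once q (b - a) is large, the preimages of the
  middle halves of the unit cells fill about half of [a, b]. Only the growth of \<open>q\<close>
  enters, so the sequence may be one attached to a fixed \<alpha>.\<close>

lemma AE_multiples_in_middle:
  fixes q :: "nat \<Rightarrow> int"
  assumes "\<And>i. int i \<le> q i"
  shows "AE \<beta>::real in lebesgue. \<forall>i0. \<exists>i\<ge>i0. \<exists>j::int. of_int (q i) * \<beta> - of_int j \<in> {1/4..3/4}"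
proof -
  have "AE \<beta>::real in lebesgue. \<exists>i\<ge>i0. \<exists>j::int. of_int (q i) * \<beta> - of_int j \<in> {1/4..3/4}" for i0
  proof -
    define E where "E = {\<beta>::real. \<not> (\<exists>i\<ge>i0. \<exists>j::int. of_int (q i) * \<beta> - of_int j \<in> {1/4..3/4})}"
    have "E \<in> sets borel" unfolding E_def by measurable
    then have "E \<in> sets lebesgue" by auto
    then have "negligible E"
    proof (rule negligible_if_intervals_avoid[where c="1/4" and 'i=int])
      fix a b :: real assume ab: "a < b"
      define i where "i = max (i0 + 1) (nat \<lceil>4 / (b - a)\<rceil>)"
      have i: "i \<ge> i0" "real i \<ge> 4 / (b - a)" "i > 0"
        unfolding i_def by (auto intro: order_trans[OF real_nat_ceiling_ge])
      define Q where "Q = real_of_int (q i)"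
      have Q: "Q \<ge> 4 / (b - a)" "Q > 0" using i assms[of i] unfolding Q_def by linarith+
      \<comment> \<open>Only cells contained in [a, b] are kept. At most two cells' worth of length
        is lost at the ends, and Q (b - a) \<ge> 4 makes this at most half; half of a half gives the
        proportion 1/4.\<close>
      define F where "F = {\<lceil>a * Q\<rceil>..<\<lfloor>b * Q\<rfloor>}"
      define l r where "l = (\<lambda>j::int. (of_int j + 1/4) / Q)" and "r = (\<lambda>j::int. (of_int j + 3/4) / Q)"
      have x: "\<lfloor>x * Q\<rfloor> = j" "x * Q - of_int j \<in> {1/4..3/4}" if "x \<in> {l j..r j}" for x j
      proof -
        show "x * Q - of_int j \<in> {1/4..3/4}" using that Q unfolding l_def r_def by (auto simp: field_simps)
        then show "\<lfloor>x * Q\<rfloor> = j" by (intro floor_unique) auto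
      qed
      have disj: "disjoint_family_on (\<lambda>j. {l j..r j}) F"
        unfolding disjoint_family_on_def using x(1) by blast
      have sub: "l j \<le> r j \<and> {l j..r j} \<subseteq> {a..b} - E" if "j \<in> F" for j
      proof -
        have "l j \<le> r j" using Q by (simp add: l_def r_def divide_right_mono)
        moreover have "{l j..r j} \<subseteq> {a..b}"
        proof
          fix y assume y: "y \<in> {l j..r j}"
          have "a * Q \<le> y * Q" "y * Q \<le> b * Q" using x(2)[OF y] that unfolding F_def by auto linarith+
          then show "y \<in> {a..b}" using Q by auto
        qed
        moreover have "{l j..r j} \<inter> E = {}"
        proof -
          have "y \<notin> E" if "y \<in> {l j..r j}" for y
            using x(2)[OF that] i unfolding E_def Q_def by (auto simp: mult.commute)
          then show ?thesis by blast
        qed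
        ultimately show ?thesis by blast
      qed
      have "1/4 * (b - a) \<le> (\<Sum>i\<in>F. r i - l i)"
      proof -
        have "(\<Sum>i\<in>F. r i - l i) = (\<Sum>i\<in>F. 1 / (2 * Q))"
          using Q by (intro sum.cong) (auto simp: l_def r_def field_simps)
        also have "\<dots> = real (card F) / (2 * Q)" by simp
        finally have s: "(\<Sum>i\<in>F. r i - l i) = real (card F) / (2 * Q)" .
        have "real (card F) \<ge> b * Q - a * Q - 2" unfolding F_def by simp linarith
        then have "(b * Q - a * Q - 2) / (2 * Q) \<le> real (card F) / (2 * Q)" using Q by (intro divide_right_mono) auto
        moreover have "1/4 * (b - a) \<le> (b * Q - a * Q - 2) / (2 * Q)"
          using Q ab by (simp add: field_simps)
        ultimately show ?thesis using s by linarith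
      qed
      then show "\<exists>F l r. finite F \<and> disjoint_family_on (\<lambda>i. {l i..r i}) F \<and>
         (\<forall>i\<in>F. l i \<le> r i \<and> {l i..r i} \<subseteq> {a..b} - E) \<and> 1/4 * (b - a) \<le> (\<Sum>(i::int)\<in>F. r i - l i)"
        using disj sub by (intro exI[of _ F] exI[of _ l] exI[of _ r] conjI ballI) (simp_all add: F_def)
    qed simp
    then show ?thesis unfolding E_def by (rule AE_lebesgue_if_negligible)
  qed
  then show ?thesis by (simp add: AE_all_countable)
qed

section \<open>Reduced fractions with denominators of comparable size\<close>

text \<open>Each interval lies strictly to the right of its fraction and within 1 / N^2 of it,
  because N \<le> 10 q and k \<ge> 100 = 10^2. A common point would bring two fractions closer than
  \<open>fractions_separated\<close> allows; having all intervals on one side is what makes the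
  radius 1 / N^2 admissible.\<close>

lemma disjoint_right_neighbourhoods:
  fixes F :: "(int \<times> int) set" and k N :: real
  assumes F: "\<And>p q. (p, q) \<in> F \<Longrightarrow> coprime p q \<and> 0 < q \<and> of_int q \<le> N \<and> N \<le> 10 * of_int q"
    and k: "100 \<le> k"
  shows "disjoint_family_on (\<lambda>(p, q). {of_int p / of_int q + 1 / (2 * k * (of_int q)^2)..of_int p / of_int q + 1 / (k * (of_int q)^2)}) F"
proof -
  have near: "of_int p / of_int q < x \<and> x \<le> of_int p / of_int q + 1 / N^2"
    if "(p, q) \<in> F" "x \<in> {of_int p / of_int q + 1 / (2 * k * (of_int q)^2)..of_int p / of_int q + 1 / (k * (of_int q)^2)}"
    for p q and x :: real
  proof -
    have "0 < real_of_int q" "0 < N" "N \<le> 10 * real_of_int q" using F[OF that(1)] by auto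
    then have "N^2 \<le> (10 * real_of_int q)^2" by (intro power_mono) auto
    also have "\<dots> \<le> k * (real_of_int q)^2" using k by (simp add: power_mult_distrib mult_right_mono)
    finally have "1 / (k * (real_of_int q)^2) \<le> 1 / N^2"
      using \<open>0 < N\<close> \<open>0 < real_of_int q\<close> k by (intro divide_left_mono mult_pos_pos) auto
    moreover have "0 < 1 / (2 * k * (real_of_int q)^2)"
      using k \<open>0 < real_of_int q\<close> by (intro divide_pos_pos mult_pos_pos) auto
    ultimately show ?thesis using that(2) unfolding atLeastAtMost_iff by linarith
  qed
  show ?thesis
    unfolding disjoint_family_on_def
  proof (intro ballI impI equals0I, elim IntE)
    fix u v :: "int \<times> int" and x
    assume uv: "u \<in> F" "v \<in> F" "u \<noteq> v"
      "x \<in> (case u of (p, q) \<Rightarrow> {of_int p / of_int q + 1 / (2 * k * (of_int q)\<^sup>2)..of_int p / of_int q + 1 / (k * (of_int q)\<^sup>2)})"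
      "x \<in> (case v of (p, q) \<Rightarrow> {of_int p / of_int q + 1 / (2 * k * (of_int q)\<^sup>2)..of_int p / of_int q + 1 / (k * (of_int q)\<^sup>2)})"
    obtain p q p' q' where pq: "u = (p, q)" "v = (p', q')" by (metis surj_pair)
    have "of_int p / of_int q < x \<and> x \<le> of_int p / of_int q + 1 / N^2"
      "of_int p' / of_int q' < x \<and> x \<le> of_int p' / of_int q' + 1 / N^2"
      using near[of p q x] near[of p' q' x] uv pq by auto
    then have "\<bar>of_int p / of_int q - of_int p' / real_of_int q'\<bar> < 1 / N^2" by linarith
    moreover have "1 / N^2 \<le> \<bar>of_int p / of_int q - of_int p' / real_of_int q'\<bar>"
      using F[of p q] F[of p' q'] uv pq by (intro fractions_separated) auto
    ultimately show False by simp
  qed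
qed

abbreviation numerators :: "real \<Rightarrow> real \<Rightarrow> int \<Rightarrow> int set" where
  "numerators a b q \<equiv> {p. a \<le> of_int p / of_int q \<and> of_int p / of_int q \<le> b}"

lemma card_numerators_le:
  fixes q :: int and a b :: real
  assumes "0 < q" "a < b"
  shows "finite (numerators a b q)"
    and "real (card (numerators a b q)) \<le> of_int q * (b - a) + 1"
proof -
  have eq: "(numerators a b q) = {\<lceil>a * of_int q\<rceil>..\<lfloor>b * of_int q\<rfloor>}"
    using assms by (auto simp: ceiling_le_iff le_floor_iff field_simps)
  show "finite (numerators a b q)" unfolding eq by simp
  have "a * of_int q \<le> b * of_int q" using assms by (intro mult_right_mono) auto
  then have "real_of_int (\<lfloor>b * of_int q\<rfloor> + 1 - \<lceil>a * of_int q\<rceil>) \<le> of_int q * (b - a) + 1"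
    "0 \<le> of_int q * (b - a) + 1"
    by (simp_all add: algebra_simps) linarith+
  then show "real (card (numerators a b q)) \<le> of_int q * (b - a) + 1"
    unfolding eq by simp
qed

text \<open>The summand is l + 1 / q, at most 2 l as soon as q > M0, and each of the first M0
  summands costs at most 1 more. This loss does not grow with M.\<close>

lemma sum_numerators_le:
  fixes l :: real and M M0 :: nat
  assumes "0 < l" "1 \<le> l * real M0"
  shows "(\<Sum>q\<in>{1..int M}. (of_int q * l + 1) / of_int q) \<le> 2 * l * real M + real M0"
proof -
  have "(of_int q * l + 1) / of_int q \<le> 2 * l + of_bool (q \<le> int M0)" if "q \<in> {1..int M}" for q
  proof (cases "q \<le> int M0")
    case True
    have "1 / of_int q \<le> (1::real)" using that by (simp add: divide_le_eq)
    moreover have "(of_int q * l + 1) / of_int q = l + 1 / of_int q" using that by (simp add: field_simps)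
    ultimately show ?thesis using True assms by simp
  next
    case False
    then have "real M0 \<le> of_int q" by linarith
    then have "l * real M0 \<le> l * of_int q" using assms by (intro mult_left_mono) auto
    then have "1 \<le> l * of_int q" using assms(2) by linarith
    then show ?thesis using that assms False by (simp add: field_simps)
  qed
  then have "(\<Sum>q\<in>{1..int M}. (of_int q * l + 1) / of_int q) \<le> (\<Sum>q\<in>{1..int M}. 2 * l + of_bool (q \<le> int M0))"
    by (rule sum_mono)
  also have "\<dots> = 2 * l * real M + real (card ({1..int M} \<inter> {q. q \<le> int M0}))"
    by (simp add: sum.distrib of_bool_def sum.If_cases)
  also have "card ({1..int M} \<inter> {q. q \<le> int M0}) \<le> card {1..int M0}"
    by (intro card_mono) auto
  finally show ?thesis by simp
qed

text \<open>Denominators between N / 10 and N make the separation of the fractions and the length of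
  their neighbourhoods comparable. The margin (b - a) / 12 on the right leaves room for one-sided
  neighbourhoods inside [a, b].\<close>

abbreviation coprime_fractions :: "nat \<Rightarrow> real \<Rightarrow> real \<Rightarrow> (int \<times> int) set" where
  "coprime_fractions N a b \<equiv> {(p, q). coprime p q \<and> 0 < q \<and> q \<le> int N \<and> int N \<le> 10 * q \<and> a \<le> of_int p / of_int q \<and> of_int p / of_int q \<le> b - (b - a) / 12}"

text \<open>By Dirichlet's theorem the intervals of radius 1 / (q N) around reduced fractions with q
  \<le> N cover everything. Those with q < N / 10 cover at most 9/20 of the length, whereas a middle
  part of proportion 3/4 is to be covered. The other 3/10 must come from large denominators, each of
  which covers at most 20 / N^2.\<close>

lemma many_coprime_fractions:
  fixes a b :: real
  assumes ab: "a < b"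
  obtains N0 :: nat where "\<And>N F. N \<ge> N0 \<Longrightarrow>
     F = coprime_fractions N a b
     \<Longrightarrow> finite F \<and> 3 / 200 * (b - a) * (real N)^2 \<le> real (card F)"
proof -
  define l where "l = b - a"
  have l: "0 < l" using ab by (simp add: l_def)
  define M0 where "M0 = nat \<lceil>1 / l\<rceil>"
  have "1 / l \<le> real M0" unfolding M0_def by (rule real_nat_ceiling_ge)
  then have M0: "1 \<le> l * real M0" using l by (simp add: field_simps)
  \<comment> \<open>N \<ge> 12 / l puts the approximating fraction within l / 12 of the point, and l
    N \<ge> 40 M0 makes the loss M0 at most l N / 40.\<close>
  define N0 where "N0 = nat \<lceil>12 / l\<rceil> + nat \<lceil>40 * real M0 / l\<rceil> + 1"
  have "finite F \<and> 3 / 200 * (b - a) * (real N)^2 \<le> real (card F)"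
    if N: "N \<ge> N0" and
     Feq: "F = coprime_fractions N a b"
    for N F
  proof -
    have N1: "12 / l \<le> real N" "40 * real M0 / l \<le> real N" "N > 0"
      using N unfolding N0_def by (linarith | meson real_nat_ceiling_ge order_trans of_nat_mono le_add1 le_add2)+
    then have Nl: "12 \<le> l * real N" "40 * real M0 \<le> l * real N" using l by (simp_all add: field_simps)
    define G where "G = (SIGMA q:{1..int (N div 10)}. (numerators a b q))"
    have finG: "finite G" unfolding G_def using card_numerators_le(1)[OF _ ab] by (intro finite_SigmaI) auto
    have "F \<subseteq> (\<lambda>(q, p). (p, q)) ` (SIGMA q:{1..int N}. (numerators a b q))"
    proof
      fix x assume "x \<in> F"
      then obtain p q where x: "x = (p, q)" "0 < q" "q \<le> int N" "a \<le> of_int p / of_int q" "of_int p / of_int q \<le> b - l / 12"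
        unfolding Feq l_def by auto
      show "x \<in> (\<lambda>(q, p). (p, q)) ` (SIGMA q:{1..int N}. (numerators a b q))"
        by (rule image_eqI[of _ _ "(q, p)"]) (use x l in auto)
    qed
    moreover have "finite (SIGMA q:{1..int N}. (numerators a b q))"
      using card_numerators_le(1)[OF _ ab] by (intro finite_SigmaI) auto
    ultimately have finF: "finite F" by (meson finite_imageI finite_subset)
    define J where "J = (\<lambda>(p::int, q::int). {of_int p / of_int q - 1 / (of_int q * real N)..of_int p / of_int q + 1 / (of_int q * real N)})"
    have Jm: "measure lebesgue (J (p, q)) = 2 / (of_int q * real N)" if "0 < q" for p q
      using that N1 by (simp add: J_def)
    have cover: "{a + l / 12..b - l / 6} \<subseteq> (\<Union>x\<in>F. J x) \<union> (\<Union>(q, p)\<in>G. J (p, q))"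
    proof
      fix x assume x: "x \<in> {a + l / 12..b - l / 6}"
      obtain p q where pq: "coprime p q" "0 < q" "q \<le> int N" "\<bar>of_int q * x - of_int p\<bar> < 1 / real N"
        using Dirichlet_approx_coprime[OF N1(3)] by metis
      have "x - of_int p / of_int q = (of_int q * x - of_int p) / of_int q"
        using pq(2) by (simp add: field_simps)
      then have "\<bar>x - of_int p / of_int q\<bar> = \<bar>of_int q * x - of_int p\<bar> / of_int q"
        using pq(2) by (simp only: abs_divide)
      also have "\<dots> < (1 / real N) / of_int q" using pq by (intro divide_strict_right_mono) auto
      finally have near: "\<bar>x - of_int p / of_int q\<bar> < 1 / (of_int q * real N)" by (simp add: mult.commute)
      have "1 / (of_int q * real N) \<le> 1 / (1 * real N)"
        using pq(2) N1 by (intro divide_left_mono mult_right_mono) auto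
      also have "\<dots> \<le> l / 12" using Nl l N1 by (simp add: field_simps)
      finally have "a \<le> of_int p / of_int q" "of_int p / of_int q \<le> b - l / 12"
        using near x by auto
      moreover have "x \<in> J (p, q)" using near by (auto simp: J_def)
      moreover have "q \<le> int (N div 10)" if "\<not> int N \<le> 10 * q" using that by linarith
      ultimately show "x \<in> (\<Union>x\<in>F. J x) \<union> (\<Union>(q, p)\<in>G. J (p, q))"
        using pq l unfolding Feq G_def l_def[symmetric] by (cases "int N \<le> 10 * q") force+
    qed
    have Jl: "J x \<in> lmeasurable" for x by (cases x) (simp add: J_def)
    have "3 / 4 * l = measure lebesgue {a + l / 12..b - l / 6}" using l by (simp add: l_def field_simps)
    also have "\<dots> \<le> measure lebesgue ((\<Union>x\<in>F. J x) \<union> (\<Union>(q, p)\<in>G. J (p, q)))"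
      using finF finG Jl cover by (intro measure_mono_fmeasurable fmeasurable.Un fmeasurable.finite_UN) auto
    also have "\<dots> \<le> measure lebesgue (\<Union>x\<in>F. J x) + measure lebesgue (\<Union>(q, p)\<in>G. J (p, q))"
      using finF finG Jl by (intro measure_Un_le fmeasurableD fmeasurable.finite_UN) auto
    also have "\<dots> \<le> (\<Sum>x\<in>F. measure lebesgue (J x)) + (\<Sum>(q, p)\<in>G. measure lebesgue (J (p, q)))"
      using finF finG Jl by (intro add_mono measure_UNION_le[THEN order_trans] sum_mono fmeasurableD) (auto simp: case_prod_beta)
    also have "(\<Sum>x\<in>F. measure lebesgue (J x)) \<le> (\<Sum>x\<in>F. 20 / (real N)^2)"
    proof (rule sum_mono)
      fix x assume "x \<in> F"
      then obtain p q where x: "x = (p, q)" "0 < q" "int N \<le> 10 * q" unfolding Feq by auto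
      have "real N \<le> 10 * of_int q" using x(3) by linarith
      then have "2 / (of_int q * real N) \<le> 2 / (real N / 10 * real N)"
        using x(2) N1 by (intro divide_left_mono mult_right_mono mult_pos_pos) auto
      then show "measure lebesgue (J x) \<le> 20 / (real N)^2"
        using Jm[OF x(2), of p] x(1) by (simp add: power2_eq_square)
    qed
    also have "(\<Sum>x\<in>F. 20 / (real N)^2) = 20 * real (card F) / (real N)^2" by simp
    also have "(\<Sum>(q, p)\<in>G. measure lebesgue (J (p, q))) = (\<Sum>q\<in>{1..int (N div 10)}. \<Sum>p\<in>(numerators a b q). measure lebesgue (J (p, q)))"
      unfolding G_def using card_numerators_le(1)[OF _ ab] by (subst sum.Sigma) auto
    also have "\<dots> = (\<Sum>q\<in>{1..int (N div 10)}. real (card (numerators a b q)) * (2 / (of_int q * real N)))"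
      by (intro sum.cong refl) (simp add: Jm)
    also have "\<dots> \<le> (\<Sum>q\<in>{1..int (N div 10)}. 2 / real N * ((of_int q * l + 1) / of_int q))"
    proof (rule sum_mono)
      fix q assume q: "q \<in> {1..int (N div 10)}"
      have "real (card (numerators a b q)) * (2 / (of_int q * real N))
         \<le> (of_int q * l + 1) * (2 / (of_int q * real N))"
        using q card_numerators_le(2)[OF _ ab, of q] by (intro mult_right_mono) (auto simp: l_def)
      then show "real (card (numerators a b q)) * (2 / (of_int q * real N))
         \<le> 2 / real N * ((of_int q * l + 1) / of_int q)" by (simp add: mult_ac)
    qed
    also have "\<dots> \<le> 2 / real N * (2 * l * real (N div 10) + real M0)"
      unfolding sum_distrib_left[symmetric] by (intro mult_left_mono sum_numerators_le l M0) auto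
    also have "\<dots> \<le> 2 / real N * (2 * l * (real N / 10) + l * real N / 40)"
      using Nl l by (intro mult_left_mono add_mono) auto
    also have "\<dots> = 9 / 20 * l" using N1 by (simp add: field_simps)
    finally have "3 / 10 * l \<le> 20 * real (card F) / (real N)^2" by simp
    then have "3 / 10 * l * (real N)^2 \<le> 20 * real (card F)" using N1 by (simp add: field_simps)
    then show ?thesis using finF by (simp add: l_def)
  qed
  then show ?thesis using that by blast
qed

text \<open>At a single scale N the neighbourhoods already fill a fixed proportion of any interval:
  3 (b - a) N^2 / 200 fractions, each with an interval of length at least 1 / (2 k N^2), give the
  proportion 3 / (400 k).\<close>

lemma AE_right_approximable:
  fixes k :: real
  assumes k: "100 \<le> k"
  shows "AE \<alpha> in lebesgue. \<exists>q\<ge>Q. \<exists>p::int. 0 < q \<and> coprime p q \<and>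
           of_int q * (of_int q * \<alpha> - of_int p) \<in> {1 / (2 * k)..1 / k}"
proof -
  define E where "E = {\<alpha>::real. \<not> (\<exists>q\<ge>Q. \<exists>p::int. 0 < q \<and> coprime p q \<and>
           of_int q * (of_int q * \<alpha> - of_int p) \<in> {1 / (2 * k)..1 / k})}"
  have "E \<in> sets borel" unfolding E_def by measurable
  then have "E \<in> sets lebesgue" by auto
  then have "negligible E"
  proof (rule negligible_if_intervals_avoid[where c="3 / (400 * k)" and 'i="int \<times> int"])
    show "0 < 3 / (400 * k)" using k by simp
    fix a b :: real assume ab: "a < b"
    obtain N0 where N0: "\<And>N F. N \<ge> N0 \<Longrightarrow>
     F = coprime_fractions N a b
     \<Longrightarrow> finite F \<and> 3 / 200 * (b - a) * (real N)^2 \<le> real (card F)"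
      by (rule many_coprime_fractions[OF ab]) blast
    \<comment> \<open>The term 10 Q forces q \<ge> Q through N \<le> 10 q; the term 12 / (b - a)
      makes each neighbourhood fit into the margin on the right.\<close>
    define N where "N = max N0 (max (nat (10 * Q)) (nat \<lceil>12 / (b - a)\<rceil>)) + 1"
    have N: "N \<ge> N0" "int N \<ge> 10 * Q" "real N \<ge> 12 / (b - a)" "N > 0"
      unfolding N_def by (auto intro: order_trans[OF real_nat_ceiling_ge])
    define F where "F = coprime_fractions N a b"
    note F = N0[OF N(1) F_def]
    define l where "l = (\<lambda>(p::int, q::int). of_int p / of_int q + 1 / (2 * k * (of_int q)^2))"
    define r where "r = (\<lambda>(p::int, q::int). of_int p / of_int q + 1 / (k * (of_int q)^2))"
    have Ieq: "(\<lambda>x. {l x..r x}) = (\<lambda>(p, q). {of_int p / of_int q + 1 / (2 * k * (of_int q)^2)..of_int p / of_int q + 1 / (k * (of_int q)^2)})"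
      by (auto simp: l_def r_def fun_eq_iff)
    have dis: "disjoint_family_on (\<lambda>x. {l x..r x}) F"
      unfolding Ieq by (rule disjoint_right_neighbourhoods[of F "real N" k]) (use k in \<open>auto simp: F_def\<close>)
    have lr: "l x \<le> r x \<and> {l x..r x} \<subseteq> {a..b} - E \<and> 1 / (2 * k * (real N)^2) \<le> r x - l x" if xF: "x \<in> F" for x
    proof -
      obtain p q where x: "x = (p, q)" and pq: "coprime p q" "0 < q" "q \<le> int N" "int N \<le> 10 * q" 
        "a \<le> of_int p / of_int q" "of_int p / of_int q \<le> b - (b - a) / 12"
        using xF unfolding F_def by auto
      have q1: "1 \<le> real_of_int q" using pq by linarith
      have kq: "0 < k * (of_int q)^2" using k q1 by (intro mult_pos_pos) auto
      have d: "r x - l x = 1 / (2 * k * (of_int q)^2)" using kq by (simp add: l_def r_def x field_simps)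
      have "1 / (2 * k * (real N)^2) \<le> 1 / (2 * k * (of_int q)^2)"
        using pq q1 k N by (intro divide_left_mono mult_left_mono power_mono mult_pos_pos) auto
      moreover have "0 < 1 / (2 * k * (of_int q)^2)" using kq by simp
      moreover have "1 / (k * (of_int q)^2) \<le> (b - a) / 12"
      proof -
        have "real N \<le> 10 * of_int q" using pq(4) by linarith
        then have "12 / (b - a) \<le> 10 * of_int q" using N(3) by linarith
        also have "\<dots> \<le> k * of_int q" using k q1 by (intro mult_right_mono) auto
        also have "\<dots> \<le> k * (of_int q)^2" using k q1 by (intro mult_left_mono) (auto simp: power2_eq_square)
        finally have "12 \<le> k * (of_int q)^2 * (b - a)" using ab by (subst (asm) pos_divide_le_eq) auto
        then show ?thesis by (subst pos_divide_le_eq[OF kq]) (simp add: algebra_simps)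
      qed
      moreover have "y \<notin> E" if "y \<in> {l x..r x}" for y
      proof -
        have "of_int q * (of_int q * y - of_int p) = (of_int q)^2 * (y - of_int p / of_int q)"
          using q1 by (simp add: power2_eq_square field_simps)
        moreover have "1 / (2 * k * (of_int q)^2) \<le> y - of_int p / of_int q" "y - of_int p / of_int q \<le> 1 / (k * (of_int q)^2)"
          using that by (auto simp: l_def r_def x)
        then have "(of_int q)^2 * (1 / (2 * k * (of_int q)^2)) \<le> (of_int q)^2 * (y - of_int p / of_int q)"
           "(of_int q)^2 * (y - of_int p / of_int q) \<le> (of_int q)^2 * (1 / (k * (of_int q)^2))"
          by (intro mult_left_mono; simp)+
        ultimately have "of_int q * (of_int q * y - of_int p) \<in> {1 / (2 * k)..1 / k}" using q1 k by simp
        moreover have "Q \<le> q" using N(2) pq by linarith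
        ultimately show ?thesis using pq unfolding E_def by blast
      qed
      moreover have "{l x..r x} \<subseteq> {a..b}"
      proof -
        have "a \<le> l x" "r x \<le> b"
          using pq(5,6) calculation(2,3) ab unfolding l_def r_def x prod.case by linarith+
        then show ?thesis by auto
      qed
      moreover have "l x \<le> r x" using calculation(2) d by linarith
      ultimately show ?thesis using d by auto
    qed
    have "3 / (400 * k) * (b - a) = 3 / 200 * (b - a) * (real N)^2 * (1 / (2 * k * (real N)^2))"
      using N k by (simp add: field_simps)
    also have "\<dots> \<le> real (card F) * (1 / (2 * k * (real N)^2))"
      using F k by (intro mult_right_mono) auto
    also have "\<dots> \<le> (\<Sum>x\<in>F. r x - l x)" using lr by (intro sum_bounded_below) auto
    finally show "\<exists>F l r. finite F \<and> disjoint_family_on (\<lambda>i. {l i..r i}) F \<and>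
         (\<forall>i\<in>F. l i \<le> r i \<and> {l i..r i} \<subseteq> {a..b} - E) \<and> 3 / (400 * k) * (b - a) \<le> (\<Sum>(i::int\<times>int)\<in>F. r i - l i)"
      using F dis lr by (intro exI[of _ F] exI[of _ l] exI[of _ r]) blast
  qed
  then show ?thesis unfolding E_def by (rule AE_lebesgue_if_negligible)
qed

section \<open>Good pairs and null sets of lengths\<close>

abbreviation right_approximable :: "nat \<Rightarrow> int \<Rightarrow> real \<Rightarrow> bool" where
  "right_approximable k Q \<alpha> \<equiv> \<exists>q\<ge>Q. \<exists>p::int. 0 < q \<and> coprime p q \<and>
           of_int q * (of_int q * \<alpha> - of_int p) \<in> {1 / (2 * real k)..1 / real k}"

abbreviation good_time :: "nat \<Rightarrow> nat \<Rightarrow> real \<Rightarrow> real \<Rightarrow> bool" where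
  "good_time k Q \<alpha> \<beta> \<equiv> \<exists>q\<ge>Q. \<exists>p j::int. 0 < q \<and> coprime p (int q) \<and>
       real q * (real q * \<alpha> - of_int p) \<in> {1 / (2 * real k)..1 / real k} \<and> real q * \<beta> - of_int j \<in> {1/4..3/4}"

text \<open>The scale \<open>k\<close> is fixed before the time \<open>q\<close>: for given K one
  takes k of the order of K and still has infinitely many times whose \<open>d\<close> lies in that
  one band.\<close>

definition good_pair :: "real \<Rightarrow> real \<Rightarrow> bool" where
  "good_pair \<alpha> \<beta> \<longleftrightarrow> (\<forall>k\<ge>100. \<forall>Q. good_time k Q \<alpha> \<beta>)"

lemma measurable_good_pair [measurable]:
  assumes [measurable]: "f \<in> borel_measurable M" "g \<in> borel_measurable M"
  shows "Measurable.pred M (\<lambda>x. good_pair (f x) (g x))"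
  unfolding good_pair_def by measurable

text \<open>For each k the times are chosen from \<alpha> alone; for this fixed sequence almost
  every \<beta> has infinitely many multiples q \<beta> in the middle half modulo 1.\<close>

lemma AE_good_pair: "AE \<alpha> in lborel. AE \<beta> in lborel. good_pair \<alpha> \<beta>"
proof -
  have "AE \<alpha>::real in lebesgue. \<forall>k\<in>{100::nat..}. \<forall>Q. right_approximable k Q \<alpha>"
    using AE_right_approximable by (intro AE_ball_countable[THEN iffD2] ballI AE_all_countable[THEN iffD2] allI) auto
  then have ae: "AE \<alpha>::real in lborel. \<forall>k\<in>{100::nat..}. \<forall>Q. right_approximable k Q \<alpha>"
    by (simp only: AE_completion_iff)
  show ?thesis
  proof (rule AE_mp[OF ae], rule AE_I2, rule impI)
    fix \<alpha> :: real
    assume \<alpha>: "\<forall>k\<in>{100::nat..}. \<forall>Q. right_approximable k Q \<alpha>"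
    have "AE \<beta>::real in lborel. \<forall>k\<in>{100::nat..}. \<forall>Q::nat. good_time k Q \<alpha> \<beta>"
    proof (intro AE_ball_countable[THEN iffD2] ballI)
      fix k :: nat assume "k \<in> {100..}"
      then have "\<forall>i::nat. \<exists>q p::int. q \<ge> int i \<and> 0 < q \<and> coprime p q \<and>
           of_int q * (of_int q * \<alpha> - of_int p) \<in> {1 / (2 * real k)..1 / real k}" using \<alpha> by meson
      then obtain q p :: "nat \<Rightarrow> int" where qp: "\<And>i. q i \<ge> int i" "\<And>i. 0 < q i" "\<And>i. coprime (p i) (q i)"
        "\<And>i. of_int (q i) * (of_int (q i) * \<alpha> - of_int (p i)) \<in> {1 / (2 * real k)..1 / real k}" by metis
      have "AE \<beta>::real in lborel. \<forall>i0. \<exists>i\<ge>i0. \<exists>j::int. of_int (q i) * \<beta> - of_int j \<in> {1/4..3/4}"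
        using AE_multiples_in_middle[of q, OF qp(1)] by (simp only: AE_completion_iff)
      then show "AE \<beta>::real in lborel. \<forall>Q::nat. good_time k Q \<alpha> \<beta>"
      proof (rule AE_mp, intro AE_I2 impI allI)
        fix \<beta> :: real and Q :: nat
        assume "\<forall>i0. \<exists>i\<ge>i0. \<exists>j::int. of_int (q i) * \<beta> - of_int j \<in> {1/4..3/4}"
        then obtain i j where ij: "i \<ge> Q" "of_int (q i) * \<beta> - of_int j \<in> {1/4..3/4}" by blast
        have qn: "int (nat (q i)) = q i" "real (nat (q i)) = of_int (q i)" using qp(2)[of i] by auto
        show "good_time k Q \<alpha> \<beta>"
        proof (rule exI[of _ "nat (q i)"], rule conjI, goal_cases)
          case 2
          show ?case
          proof (rule exI[of _ "p i"], rule exI[of _ j], intro conjI)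
          show "0 < nat (q i)" using qp(2)[of i] by linarith
          show "coprime (p i) (int (nat (q i)))" unfolding qn by (rule qp)
          show "real (nat (q i)) * (real (nat (q i)) * \<alpha> - of_int (p i)) \<in> {1 / (2 * real k)..1 / real k}" unfolding qn by (rule qp)
          show "real (nat (q i)) * \<beta> - of_int j \<in> {1/4..3/4}" unfolding qn by (rule ij)
          qed
        qed (use qp(1)[of i] ij(1) in linarith)
      qed
    qed simp
    then show "AE \<beta> in lborel. good_pair \<alpha> \<beta>" unfolding good_pair_def by (simp add: Ball_def)
  qed
qed

definition rotation_circumference :: "real ^ 3 \<Rightarrow> real" where
  "rotation_circumference v = v $ 1 + 2 * v $ 2 + v $ 3"

text \<open>The lengths are recovered from \<open>(L, \<alpha>, \<beta>)\<close> by \<open>(a, b, c) = (L (1 - \<beta> - \<alpha>), L \<beta>, L (\<alpha> - \<beta>))\<close>,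
  so null sets of parameters give null sets of lengths.\<close>

lemma AE_lengths_good_pair:
  "AE v in lebesgue. (\<forall>i. 0 < v $ i) \<longrightarrow>
     good_pair ((v $ 2 + v $ 3) / rotation_circumference v) (v $ 2 / rotation_circumference v)"
proof -
  define B where "B = {w :: real \<times> real \<times> real. \<not> good_pair (fst (snd w)) (snd (snd w))}"
  have m2: "{w \<in> space (lborel \<Otimes>\<^sub>M lborel). good_pair (fst w) (snd w)} \<in> sets (lborel \<Otimes>\<^sub>M lborel)"
    by measurable
  have m3: "{w \<in> space (lborel \<Otimes>\<^sub>M (lborel \<Otimes>\<^sub>M lborel)). good_pair (fst (snd w)) (snd (snd w))} \<in> sets (lborel \<Otimes>\<^sub>M (lborel \<Otimes>\<^sub>M lborel))"
    by measurable
  have AE2: "AE w in lborel \<Otimes>\<^sub>M lborel. good_pair (fst w) (snd w)"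
    using AE_good_pair by (intro lborel_pair.AE_pair_measure[OF m2]) simp
  then have "AE x in lborel :: real measure. AE w in lborel \<Otimes>\<^sub>M lborel. good_pair (fst (snd (x, w))) (snd (snd (x, w)))"
    by simp
  then have "AE w in (lborel \<Otimes>\<^sub>M (lborel \<Otimes>\<^sub>M lborel)) :: (real \<times> real \<times> real) measure. good_pair (fst (snd w)) (snd (snd w))"
  proof -
    interpret pair_sigma_finite "lborel :: real measure" "lborel \<Otimes>\<^sub>M lborel :: (real \<times> real) measure"
      unfolding lborel_prod by (intro pair_sigma_finite.intro sigma_finite_lborel)
    assume "AE x in lborel :: real measure. AE w in lborel \<Otimes>\<^sub>M lborel. good_pair (fst (snd (x, w))) (snd (snd (x, w)))"
    then show ?thesis by (rule AE_pair_measure[OF m3])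
  qed
  then have "AE w in lborel :: (real \<times> real \<times> real) measure. good_pair (fst (snd w)) (snd (snd w))"
    by (simp only: lborel_prod)
  then have "AE w in lebesgue :: (real \<times> real \<times> real) measure. good_pair (fst (snd w)) (snd (snd w))"
    by (simp only: AE_completion_iff)
  then have neg: "negligible B"
    unfolding B_def by (simp add: eventually_ae_filter_negligible) (meson negligible_subset)
  define \<Phi> where "\<Phi> = (\<lambda>w :: real \<times> real \<times> real. (\<chi> i. fst w * (if i = 1 then 1 - snd (snd w) - fst (snd w) else if i = 2 then snd (snd w) else fst (snd w) - snd (snd w))) :: real ^ 3)"
  have "negligible (\<Phi> ` B)"
  proof (rule negligible_differentiable_image_negligible[OF _ neg])
    show "DIM(real \<times> real \<times> real) \<le> DIM(real ^ 3)" by simp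
    show "\<Phi> differentiable_on B"
      unfolding differentiable_on_def
    proof (intro ballI)
      fix w :: "real \<times> real \<times> real"
      show "\<Phi> differentiable at w within B"
      proof (subst differentiable_componentwise_within, safe)
        fix u :: "real ^ 3" assume "u \<in> Basis"
        then obtain i where u: "u = axis i 1" by (auto simp: Basis_vec_def)
        have [simp]: "fst differentiable at w within B" "(\<lambda>w. fst (snd w)) differentiable at w within B" "(\<lambda>w. snd (snd w)) differentiable at w within B"
          by (intro bounded_linear_imp_differentiable bounded_linear_fst bounded_linear_fst_comp bounded_linear_snd_comp bounded_linear_snd)+
        show "(\<lambda>w. \<Phi> w \<bullet> u) differentiable at w within B"
          unfolding u inner_axis \<Phi>_def by (cases "i = 1"; cases "i = 2") (simp_all add: differentiable_mult differentiable_diff)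
      qed
    qed
  qed
  moreover have "{v. \<not> ((\<forall>i. 0 < v $ i) \<longrightarrow>
     good_pair ((v $ 2 + v $ 3) / rotation_circumference v) (v $ 2 / rotation_circumference v))} \<subseteq> \<Phi> ` B"
  proof
    fix v :: "real ^ 3" assume "v \<in> {v. \<not> ((\<forall>i. 0 < v $ i) \<longrightarrow>
     good_pair ((v $ 2 + v $ 3) / rotation_circumference v) (v $ 2 / rotation_circumference v))}"
    then have pos: "0 < v $ 1" "0 < v $ 2" "0 < v $ 3"
      and bad: "\<not> good_pair ((v $ 2 + v $ 3) / rotation_circumference v) (v $ 2 / rotation_circumference v)" by auto
    define L where "L = rotation_circumference v"
    have L: "0 < L" using pos by (simp add: L_def rotation_circumference_def)
    have Lv: "L - v $ 2 - (v $ 2 + v $ 3) = v $ 1" by (simp add: L_def rotation_circumference_def)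
    have e: "L * (1 - v $ 2 / L - (v $ 2 + v $ 3) / L) = v $ 1" "L * (v $ 2 / L) = v $ 2"
      "L * ((v $ 2 + v $ 3) / L - v $ 2 / L) = v $ 3"
    proof -
      have "L * (1 - x / L - y / L) = L - x - y" "L * (x / L) = x" "L * (x / L - y / L) = x - y" for x y
        using L by (simp_all add: field_simps)
      then show "L * (1 - v $ 2 / L - (v $ 2 + v $ 3) / L) = v $ 1" "L * (v $ 2 / L) = v $ 2"
        "L * ((v $ 2 + v $ 3) / L - v $ 2 / L) = v $ 3" by (simp_all only: Lv add_diff_cancel_left')
    qed
    have "v = \<Phi> (L, (v $ 2 + v $ 3) / L, v $ 2 / L)"
      unfolding vec_eq_iff
    proof
      fix i :: 3
      show "v $ i = \<Phi> (L, (v $ 2 + v $ 3) / L, v $ 2 / L) $ i"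
        using exhaust_3[of i] e by (auto simp: \<Phi>_def)
    qed
    moreover have "(L, (v $ 2 + v $ 3) / L, v $ 2 / L) \<in> B" using bad by (simp add: B_def L_def)
    ultimately show "v \<in> \<Phi> ` B" by (rule image_eqI)
  qed
  ultimately show ?thesis by (intro AE_lebesgue_if_negligible) (rule negligible_subset)
qed

section \<open>Translations and fine cells in \<open>L\<^sup>1\<close>\<close>

text \<open>Density argument: since C is uniform in the index, the functions with seminorms tending
  to 0 form a space closed under dominated limits. It passes from intervals to bounded Borel sets,
  to sets of finite measure and to integrable functions.\<close>

lemma L1_seminorm_tendsto_zero:
  fixes N :: "'i \<Rightarrow> (real \<Rightarrow> real) \<Rightarrow> real" and F :: "'i filter" and C :: real
  assumes nonneg: "\<And>i f. 0 \<le> N i f"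
    and add: "\<And>i f g. integrable lborel f \<Longrightarrow> integrable lborel g \<Longrightarrow> N i (\<lambda>x. f x + g x) \<le> N i f + N i g"
    and scale: "\<And>i f c. integrable lborel f \<Longrightarrow> N i (\<lambda>x. c * f x) = \<bar>c\<bar> * N i f"
    and bound: "\<And>i f. integrable lborel f \<Longrightarrow> N i f \<le> C * (LBINT x. \<bar>f x\<bar>)"
    and interval: "\<And>a b. a \<le> b \<Longrightarrow> ((\<lambda>i. N i (indicator {a..<b})) \<longlongrightarrow> 0) F"
    and f: "integrable lborel f"
  shows "((\<lambda>i. N i f) \<longlongrightarrow> 0) F"
proof -
  define P where "P f \<longleftrightarrow> ((\<lambda>i. N i f) \<longlongrightarrow> 0) F" for f
  have P_add: "P (\<lambda>x. f x + g x)" if "integrable lborel f" "integrable lborel g" "P f" "P g" for f g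
    unfolding P_def
  proof (rule tendsto_sandwich[OF _ _ tendsto_const])
    show "((\<lambda>i. N i f + N i g) \<longlongrightarrow> 0) F" using tendsto_add[of _ 0 F _ 0] that unfolding P_def by auto
  qed (use nonneg add that in auto)
  have P_scale: "P (\<lambda>x. c * f x)" if "integrable lborel f" "P f" for f c
    using tendsto_mult_right_zero[of "\<lambda>i. N i f" F "\<bar>c\<bar>"] that unfolding P_def by (simp add: scale)
  have P_lim: "P f" if s: "\<And>n. integrable lborel (s n)" "\<And>n. P (s n)" and f: "integrable lborel f"
    and w: "integrable lborel w" "\<And>n x. \<bar>s n x\<bar> \<le> w x" and lim: "\<And>x. (\<lambda>n. s n x) \<longlonglongrightarrow> f x" for s f w
    unfolding P_def
  proof (rule tendstoI)
    fix e :: real assume e: "0 < e"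
    have [measurable]: "f \<in> borel_measurable lborel" "\<And>n. s n \<in> borel_measurable lborel" using s f by auto
    have "(\<lambda>n. LBINT x. \<bar>f x + - 1 * s n x\<bar>) \<longlonglongrightarrow> (\<integral>x. 0 \<partial>(lborel :: real measure))"
    proof (rule integral_dominated_convergence[where w="\<lambda>x. \<bar>f x\<bar> + w x"])
      show "AE x in lborel. (\<lambda>n. \<bar>f x + - 1 * s n x\<bar>) \<longlonglongrightarrow> 0"
        using lim by (intro AE_I2 tendsto_rabs_zero) (auto intro!: tendsto_eq_intros)
      show "AE x in lborel. norm \<bar>f x + - 1 * s n x\<bar> \<le> \<bar>f x\<bar> + w x" for n
        using w(2)[of n] by (intro AE_I2) (smt (verit) real_norm_def)
    qed (use f w in auto)
    then have "(\<lambda>n. C * (LBINT x. \<bar>f x + - 1 * s n x\<bar>)) \<longlonglongrightarrow> 0"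
      by (intro tendsto_mult_right_zero) simp
    then have "\<forall>\<^sub>F n in sequentially. C * (LBINT x. \<bar>f x + - 1 * s n x\<bar>) < e / 2"
      using e by (intro order_tendstoD(2)) auto
    then obtain n where n: "C * (LBINT x. \<bar>f x + - 1 * s n x\<bar>) < e / 2"
      using eventually_happens trivial_limit_sequentially by blast
    have "\<forall>\<^sub>F i in F. N i (s n) < e / 2"
      using s(2)[of n] e unfolding P_def by (intro order_tendstoD(2)) auto
    then show "\<forall>\<^sub>F i in F. dist (N i f) 0 < e"
    proof eventually_elim
      case (elim i)
      have d: "integrable lborel (\<lambda>x. f x + - 1 * s n x)" using s f by simp
      have "N i f = N i (\<lambda>x. s n x + (f x + - 1 * s n x))" by simp
      also have "\<dots> \<le> N i (s n) + N i (\<lambda>x. f x + - 1 * s n x)" by (rule add[OF s(1) d])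
      also have "\<dots> < e / 2 + e / 2" using elim n bound[OF d, of i] by linarith
      finally show ?case using nonneg[of i f] by simp
    qed
  qed
  have fin: "integrable lborel (indicator A :: real \<Rightarrow> real)" if "A \<in> sets borel" "A \<subseteq> {- M..<M}" for A and M :: real
  proof -
    have "emeasure lborel A \<le> emeasure lborel {- M..<M}" using that by (intro emeasure_mono) auto
    also have "\<dots> < \<infinity>" by (cases "- M \<le> M") auto
    finally show ?thesis using that by simp
  qed
  \<comment> \<open>The cut to [-M, M) keeps complements integrable, so that the induction over the
    intersection-stable family of half-lines can take complements by subtraction.\<close>
  have P_bounded: "P (indicator (A \<inter> {- M..<M}))" if A: "A \<in> sets borel" for A M
  proof -
    have fin': "integrable lborel (indicator (A \<inter> {- M..<M}) :: real \<Rightarrow> real)" if "A \<in> sets borel" for A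
      by (rule fin[where M=M]) (use that in auto)
    have bor: "B \<in> sets borel" if "B \<in> sigma_sets UNIV (range lessThan)" for B :: "real set"
      using that by (simp add: borel_Iio)
    have "{..<a} \<inter> {..<b} = {..<min a b}" for a b :: real by auto
    then have "Int_stable (range (lessThan :: real \<Rightarrow> real set))" by (auto simp: Int_stable_def)
    moreover have "range (lessThan :: real \<Rightarrow> real set) \<subseteq> Pow UNIV" by simp
    moreover have "A \<in> sigma_sets UNIV (range lessThan)" using A by (simp add: borel_Iio)
    ultimately show ?thesis
    proof (induction rule: sigma_sets_induct_disjoint)
      case (basic B)
      then obtain b where B: "B = {..<b}" by auto
      show ?case
      proof (cases "- M \<le> min b M")
        case True
        have "B \<inter> {- M..<M} = {- M..<min b M}" using B by auto
        then show ?thesis using interval[OF True] unfolding P_def by simp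
      next
        case False
        then have "B \<inter> {- M..<M} = {0..<0}" using B by auto
        then show ?thesis using interval[of 0 0] unfolding P_def by simp
      qed
    next
      case empty
      then show ?case using interval[of 0 0] unfolding P_def by simp
    next
      case (compl B)
      have "P (indicator {- M..<M})"
        using interval[of "- M" M] interval[of 0 0] unfolding P_def by (cases "- M \<le> M") auto
      then have "P (\<lambda>x. indicator {- M..<M} x + - 1 * indicator (B \<inter> {- M..<M}) x)"
        using compl bor fin'[of B] fin[of "{- M..<M}" M] by (intro P_add P_scale) auto
      moreover have "(\<lambda>x. indicator {- M..<M} x + - 1 * indicator (B \<inter> {- M..<M}) x) = (indicator ((UNIV - B) \<inter> {- M..<M}) :: real \<Rightarrow> real)"
        by (auto simp: fun_eq_iff indicator_def)
      ultimately show ?case by simp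
    next
      case (union B)
      have Bb: "B i \<in> sets borel" for i using \<open>range B \<subseteq> _\<close> by (intro bor) auto
      have step: "P (indicator ((\<Union>i<n. B i) \<inter> {- M..<M}))" for n
      proof (induction n)
        case 0
        then show ?case using interval[of 0 0] unfolding P_def by simp
      next
        case (Suc n)
        have "B n \<inter> B i = {}" if "i < n" for i
          using \<open>disjoint_family B\<close> that by (auto simp: disjoint_family_on_def)
        then have "B n \<inter> (\<Union>i<n. B i) = {}" by blast
        then have "indicator ((\<Union>i<Suc n. B i) \<inter> {- M..<M}) = (\<lambda>x. indicator ((\<Union>i<n. B i) \<inter> {- M..<M}) x + indicator (B n \<inter> {- M..<M}) x :: real)"
          by (auto simp: fun_eq_iff indicator_def lessThan_Suc)
        then show ?case using Suc union.IH[of n] fin' Bb by (auto intro!: P_add)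
      qed
      show ?case
      proof (rule P_lim[OF _ step, where w="indicator {- M..<M}"])
        show "(\<lambda>n. indicator ((\<Union>i<n. B i) \<inter> {- M..<M}) x :: real) \<longlonglongrightarrow> indicator (\<Union> (range B) \<inter> {- M..<M}) x" for x
        proof (cases "x \<in> \<Union> (range B)")
          case True
          then obtain j where "x \<in> B j" by auto
          then have "\<forall>\<^sub>F n in sequentially. indicator ((\<Union>i<n. B i) \<inter> {- M..<M}) x = (indicator (\<Union> (range B) \<inter> {- M..<M}) x :: real)"
            unfolding eventually_sequentially by (intro exI[of _ "Suc j"]) (auto simp: indicator_def)
          then show ?thesis by (rule tendsto_eventually)
        next
          case False
          then have "\<And>n. indicator ((\<Union>i<n. B i) \<inter> {- M..<M}) x = (indicator (\<Union> (range B) \<inter> {- M..<M}) x :: real)"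
            by (auto simp: indicator_def)
          then show ?thesis by simp
        qed
        show "integrable lborel (indicator (\<Union> (range B) \<inter> {- M..<M}) :: real \<Rightarrow> real)"
          using Bb by (intro fin') auto
      qed (use fin' fin[of "{- M..<M}" M] Bb in \<open>auto split: split_indicator\<close>)
    qed
  qed
  have P_finite: "P (indicator A)" if A: "A \<in> sets borel" "emeasure lborel A < \<infinity>" for A
  proof (rule P_lim[where s="\<lambda>n. indicator (A \<inter> {- real n..<real n})" and w="indicator A"])
    show "(\<lambda>n. indicator (A \<inter> {- real n..<real n}) x :: real) \<longlonglongrightarrow> indicator A x" for x
    proof (rule tendsto_eventually)
      obtain n0 :: nat where "\<bar>x\<bar> < real n0" using reals_Archimedean2 by blast
      then show "\<forall>\<^sub>F n in sequentially. indicator (A \<inter> {- real n..<real n}) x = (indicator A x :: real)"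
        unfolding eventually_sequentially by (intro exI[of _ n0]) (auto simp: indicator_def)
    qed
    show "integrable lborel (indicator (A \<inter> {- real n..<real n}) :: real \<Rightarrow> real)" for n
      by (rule fin) (use A in auto)
  qed (use A P_bounded in \<open>auto simp: indicator_def\<close>)
  have "P f"
    using f
  proof (induction rule: integrable_induct)
    case (base A c)
    then have "P (\<lambda>x. c * indicator A x)" by (intro P_scale P_finite) auto
    then show ?case by (simp add: mult.commute)
  next
    case (add f g)
    then show ?case by (rule P_add)
  next
    case (lim f s)
    show ?case by (rule P_lim[where s=s and w="\<lambda>x. 2 * norm (f x)"]) (use lim in auto)
  qed
  then show ?thesis by (simp add: P_def)
qed

lemma L1_translation_tendsto_zero:
  fixes f :: "real \<Rightarrow> real"
  assumes f: "integrable lborel f" and t: "(t \<longlongrightarrow> 0) F"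
  shows "((\<lambda>i. LBINT x. \<bar>f (x + t i) - f x\<bar>) \<longlongrightarrow> 0) F"
proof (rule L1_seminorm_tendsto_zero[where C=2 and N="\<lambda>i f. LBINT x. \<bar>f (x + t i) - f x\<bar>", OF _ _ _ _ _ f])
  have shift: "integrable lborel (\<lambda>x. f (x + s))" "(LBINT x. f (x + s)) = (LBINT x. f x)" if "integrable lborel f" for f :: "real \<Rightarrow> real" and s
    using that lborel_integrable_real_affine[of f 1 s] lborel_integral_real_affine[of 1 f s] by (simp_all add: add.commute)
  show "0 \<le> (LBINT x. \<bar>f (x + t i) - f x\<bar>)" for i and f :: "real \<Rightarrow> real" by simp
  show "(LBINT x. \<bar>(f (x + t i) + g (x + t i)) - (f x + g x)\<bar>) \<le> (LBINT x. \<bar>f (x + t i) - f x\<bar>) + (LBINT x. \<bar>g (x + t i) - g x\<bar>)"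
    if "integrable lborel f" "integrable lborel g" for i and f g :: "real \<Rightarrow> real"
    using that shift(1)[of f "t i"] shift(1)[of g "t i"]
    by (intro integral_mono[THEN order_trans[OF _ eq_refl[OF Bochner_Integration.integral_add]]]) auto
  show "(LBINT x. \<bar>c * f (x + t i) - c * f x\<bar>) = \<bar>c\<bar> * (LBINT x. \<bar>f (x + t i) - f x\<bar>)" for i and f :: "real \<Rightarrow> real" and c
    by (simp add: abs_mult flip: right_diff_distrib)
  show "(LBINT x. \<bar>f (x + t i) - f x\<bar>) \<le> 2 * (LBINT x. \<bar>f x\<bar>)" if f: "integrable lborel f" for i and f :: "real \<Rightarrow> real"
  proof -
    have "(LBINT x. \<bar>f (x + t i) - f x\<bar>) \<le> (LBINT x. \<bar>f (x + t i)\<bar> + \<bar>f x\<bar>)"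
      using f by (intro integral_mono) (auto intro!: shift)
    also have "\<dots> = 2 * (LBINT x. \<bar>f x\<bar>)"
      using f shift[of "\<lambda>x. \<bar>f x\<bar>" "t i"] by simp
    finally show ?thesis .
  qed
  fix a b :: real assume ab: "a \<le> b"
  show "((\<lambda>i. LBINT x. \<bar>indicat_real {a..<b} (x + t i) - indicat_real {a..<b} x\<bar>) \<longlongrightarrow> (0::real)) F"
  proof (rule tendsto_sandwich[OF _ _ tendsto_const])
    show "((\<lambda>i. 4 * \<bar>t i\<bar>) \<longlongrightarrow> 0) F" by (intro tendsto_mult_right_zero tendsto_rabs_zero t)
    \<comment> \<open>The indicators differ only within |s| of an endpoint, and each of the two
      endpoints contributes a length 2 |s|.\<close>
    have "(LBINT x. \<bar>indicat_real {a..<b} (x + s) - indicat_real {a..<b} x\<bar>) \<le> 4 * \<bar>s\<bar>" for s :: real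
    proof -
      have "(LBINT x. \<bar>indicat_real {a..<b} (x + s) - indicat_real {a..<b} x\<bar>) \<le> (LBINT x. indicat_real {a - \<bar>s\<bar>..a + \<bar>s\<bar>} x + indicator {b - \<bar>s\<bar>..b + \<bar>s\<bar>} x)"
        using shift(1)[of "indicator {a..<b}" s] ab by (intro integral_mono) (auto split: split_indicator)
      also have "\<dots> = 4 * \<bar>s\<bar>" by (subst Bochner_Integration.integral_add) auto
      finally show ?thesis .
    qed
    then show "\<forall>\<^sub>F i in F. (LBINT x. \<bar>indicat_real {a..<b} (x + t i) - indicat_real {a..<b} x\<bar>) \<le> 4 * \<bar>t i\<bar>" by simp
  qed simp
qed

text \<open>Complete cells integrate to 0, so only the two pieces between an endpoint and the cell
  boundary below it contribute, each at most \<open>w\<close>.\<close>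

lemma integral_interval_mean_zero_cells:
  fixes \<psi> :: "real \<Rightarrow> real"
  assumes w: "0 < w" and m[measurable]: "\<psi> \<in> borel_measurable borel" and b: "\<And>x. \<bar>\<psi> x\<bar> \<le> 1"
    and cell: "\<And>Y::int. (LBINT x:{of_int Y * w..<of_int (Y + 1) * w}. \<psi> x) = 0"
    and uv: "u \<le> v"
  shows "\<bar>LBINT x. indicator {u..<v} x * \<psi> x\<bar> \<le> 2 * w"
proof -
  have int: "set_integrable lborel {a..<c} \<psi>" for a c
    unfolding set_integrable_def
  proof (rule Bochner_Integration.integrable_bound[where f="indicator {a..<c} :: real \<Rightarrow> real"])
    show "integrable lborel (indicator {a..<c} :: real \<Rightarrow> real)" by (cases "a \<le> c") auto
  qed (use b in \<open>auto simp: indicator_def\<close>)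
  have split: "(LBINT x:{a..<c}. \<psi> x) = (LBINT x:{a..<m}. \<psi> x) + (LBINT x:{m..<c}. \<psi> x)" if "a \<le> m" "m \<le> c" for a m c
    using that int by (subst set_integral_Un[symmetric]) (auto simp: ivl_disj_un)
  have small: "\<bar>LINT x:{a..<c}|lborel. \<psi> x\<bar> \<le> c - a" if "a \<le> c" for a c
  proof -
    have "\<bar>LINT x:{a..<c}|lborel. \<psi> x\<bar> \<le> (LBINT x. \<bar>indicator {a..<c} x *\<^sub>R \<psi> x\<bar>)"
      unfolding set_lebesgue_integral_def by (rule integral_abs_bound)
    also have "\<dots> \<le> (LBINT x. indicator {a..<c} x)"
      using int[of a c] b that unfolding set_integrable_def by (intro integral_mono) (auto split: split_indicator)
    finally show ?thesis using that by simp
  qed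
  have cells: "(LBINT x:{of_int A * w..<of_int (A + int n) * w}. \<psi> x) = 0" for A n
  proof (induction n)
    case 0
    then show ?case by (simp add: set_lebesgue_integral_def)
  next
    case (Suc n)
    have e: "A + int (Suc n) = (A + int n) + 1" by simp
    have "(LBINT x:{of_int A * w..<of_int (A + int n + 1) * w}. \<psi> x) = 
      (LBINT x:{of_int A * w..<of_int (A + int n) * w}. \<psi> x) + (LBINT x:{of_int (A + int n) * w..<of_int (A + int n + 1) * w}. \<psi> x)"
      using w by (intro split mult_right_mono) auto
    then show ?case unfolding e using Suc cell[of "A + int n"] by linarith
  qed
  define A B where "A = \<lfloor>u / w\<rfloor>" and "B = \<lfloor>v / w\<rfloor>"
  have AB: "A \<le> B" using uv w unfolding A_def B_def by (intro floor_mono divide_right_mono) auto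
  have A: "of_int A * w \<le> u" "u - of_int A * w \<le> w" "of_int B * w \<le> v" "v - of_int B * w \<le> w"
    using floor_divide_lower[OF w, of u] floor_divide_upper[OF w, of u] floor_divide_lower[OF w, of v] floor_divide_upper[OF w, of v]
    unfolding A_def B_def by (auto simp: algebra_simps)
  have "(LBINT x:{of_int A * w..<of_int B * w}. \<psi> x) = 0"
    using cells[of A "nat (B - A)"] AB by simp
  moreover have "(LBINT x:{of_int A * w..<v}. \<psi> x) = (LBINT x:{of_int A * w..<of_int B * w}. \<psi> x) + (LBINT x:{of_int B * w..<v}. \<psi> x)"
    using A AB w by (intro split mult_right_mono) auto
  moreover have "(LBINT x:{of_int A * w..<v}. \<psi> x) = (LBINT x:{of_int A * w..<u}. \<psi> x) + (LBINT x:{u..<v}. \<psi> x)"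
    using A uv by (intro split) auto
  ultimately have "\<bar>LINT x:{u..<v}|lborel. \<psi> x\<bar> \<le> 2 * w"
    using small[of "of_int A * w" u] small[of "of_int B * w" v] A by linarith
  then show ?thesis by (simp add: set_lebesgue_integral_def)
qed

text \<open>Weak convergence to 0 of functions that oscillate on ever finer cells. It allows window
  indicators to be replaced by their averages over a cell.\<close>

lemma integral_mean_zero_cells_tendsto_zero:
  fixes \<psi> :: "'i \<Rightarrow> real \<Rightarrow> real"
  assumes f: "integrable lborel f" and w: "\<And>i. 0 < w i" "(w \<longlongrightarrow> 0) F"
    and m[measurable]: "\<And>i. \<psi> i \<in> borel_measurable borel" and b: "\<And>i x. \<bar>\<psi> i x\<bar> \<le> 1"
    and cell: "\<And>i (Y::int). (LBINT x:{of_int Y * w i..<of_int (Y + 1) * w i}. \<psi> i x) = 0"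
  shows "((\<lambda>i. LBINT x. f x * \<psi> i x) \<longlongrightarrow> 0) F"
proof -
  have int: "integrable lborel (\<lambda>x. f x * \<psi> i x)" if "integrable lborel f" for f i
    by (rule Bochner_Integration.integrable_bound[OF that]) 
      (use that b in \<open>auto simp: abs_mult intro!: AE_I2 mult_left_le\<close>)
  have "((\<lambda>i. \<bar>LBINT x. f x * \<psi> i x\<bar>) \<longlongrightarrow> 0) F"
  proof (rule L1_seminorm_tendsto_zero[where C=1 and N="\<lambda>i f. \<bar>LBINT x. f x * \<psi> i x\<bar>", OF _ _ _ _ _ f])
    show "\<bar>LBINT x. (f x + g x) * \<psi> i x\<bar> \<le> \<bar>LBINT x. f x * \<psi> i x\<bar> + \<bar>LBINT x. g x * \<psi> i x\<bar>"
      if "integrable lborel f" "integrable lborel g" for i f g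
      using int that by (simp add: distrib_right)
    show "\<bar>LBINT x. c * f x * \<psi> i x\<bar> = \<bar>c\<bar> * \<bar>LBINT x. f x * \<psi> i x\<bar>" for i f c
      by (simp add: mult.assoc abs_mult)
    show "\<bar>LBINT x. f x * \<psi> i x\<bar> \<le> 1 * (LBINT x. \<bar>f x\<bar>)" if "integrable lborel f" for i f
    proof -
      have "\<bar>LBINT x. f x * \<psi> i x\<bar> \<le> (LBINT x. \<bar>f x * \<psi> i x\<bar>)" by (rule integral_abs_bound)
      also have "\<dots> \<le> (LBINT x. \<bar>f x\<bar>)"
        using int[OF that] that b by (intro integral_mono integrable_abs) (auto simp: abs_mult intro!: mult_left_le)
      finally show ?thesis by simp
    qed
    fix u v :: real assume uv: "u \<le> v"
    show "((\<lambda>i. \<bar>LBINT x. indicator {u..<v} x * \<psi> i x\<bar>) \<longlongrightarrow> 0) F"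
    proof (rule tendsto_sandwich[OF _ _ tendsto_const])
      show "((\<lambda>i. 2 * w i) \<longlongrightarrow> 0) F" by (intro tendsto_mult_right_zero w)
      show "\<forall>\<^sub>F i in F. \<bar>LBINT x. indicator {u..<v} x * \<psi> i x\<bar> \<le> 2 * w i"
        using integral_interval_mean_zero_cells[OF w(1) m b cell uv] by simp
    qed simp
  qed simp
  then show ?thesis by (rule tendsto_rabs_zero_cancel)
qed

section \<open>Visits of a rotation to an arc\<close>

lemma ex1_multiple_congruent:
  fixes p m :: int and q :: nat
  assumes "coprime p (int q)" "0 < q"
  shows "\<exists>!i. i < q \<and> int q dvd m + int i * p"
proof -
  obtain x v where "x * p + v * int q = gcd p (int q)" using bezout_int by blast
  then have "p * x - 1 = int q * (- v)" using assms(1) by (simp add: algebra_simps)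
  then have x: "int q dvd p * x - 1" by (metis dvd_triv_left)
  define i where "i = nat ((- m * x) mod int q)"
  have i: "int i = (- m * x) mod int q" using assms(2) by (simp add: i_def)
  have "int q dvd m + (- m * x) * p"
    using dvd_mult[OF x, of "- m"] by (simp add: algebra_simps)
  moreover have "int q dvd ((- m * x) - int i) * p" unfolding i by (intro dvd_mult2) (simp add: minus_mod_eq_mult_div)
  ultimately have "int q dvd m + (- m * x) * p - ((- m * x) - int i) * p" by (rule dvd_diff)
  then have "int q dvd m + int i * p" by (simp add: algebra_simps)
  moreover have "i < q" using assms(2) i by (metis of_nat_0_less_iff of_nat_less_iff pos_mod_bound)
  moreover have "i' = i''" if "i' < q" "int q dvd m + int i' * p" "i'' < q" "int q dvd m + int i'' * p" for i' i''
  proof -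
    have "int q dvd (int i' - int i'') * p" using dvd_diff[OF that(2,4)] by (simp add: algebra_simps)
    then have "int q dvd int i' - int i''" using assms(1) by (simp add: coprime_commute coprime_dvd_mult_left_iff)
    moreover have "\<bar>int i' - int i''\<bar> < int q" using that by linarith
    ultimately have "int i' - int i'' = 0" by (metis abs_of_nat dvd_imp_le_int not_le)
    then show ?thesis by simp
  qed
  ultimately show ?thesis by blast
qed

text \<open>For d = 0 this is Hermite's identity for the points i p / q. The drift adds i d / q to
  the i-th numerator, which can carry over only if \<lfloor>q u\<rfloor> + i p is one short of a
  multiple of q. A single index has this property, and \<rho> is that index divided by q; it depends
  on the cell of u, not on the position inside the cell.\<close>

lemma sum_floor_rotation:
  fixes p :: int and q :: nat and \<alpha> d :: real
  assumes pq: "coprime p (int q)" "0 < q" and d: "d = real q * (real q * \<alpha> - of_int p)" "0 \<le> d" "d \<le> 1"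
  shows "\<exists>(c::int) \<rho>. (\<forall>U. 0 \<le> \<rho> U \<and> \<rho> U < 1) \<and>
    (\<forall>u. (\<Sum>i<q. \<lfloor>u + real i * \<alpha>\<rfloor>) = c + \<lfloor>real q * u + \<rho> \<lfloor>real q * u\<rfloor> * d\<rfloor>)"
proof -
  define idx where "idx U = (THE i. i < q \<and> int q dvd (U + 1) + int i * p)" for U
  have idx: "idx U < q" "int q dvd (U + 1) + int (idx U) * p" for U
    using theI'[OF ex1_multiple_congruent[OF pq, of "U + 1"]] unfolding idx_def by auto
  have idx_eq: "int q dvd (U + 1) + int i * p \<longleftrightarrow> i = idx U" if "i < q" for U i
    using ex1_multiple_congruent[OF pq, of "U + 1"] idx that by blast
  have div_Suc: "(m + 1) div int q = m div int q + of_bool (int q dvd m + 1)" for m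
  proof -
    define r where "r = m mod int q"
    have m: "m = int q * (m div int q) + r" "0 \<le> r" "r < int q" using pq(2) by (simp_all add: r_def)
    have "int q dvd m + 1 \<longleftrightarrow> int q dvd r + 1"
      by (subst m(1), subst add.assoc) (rule dvd_add_right_iff, rule dvd_triv_left)
    also have "\<dots> \<longleftrightarrow> r + 1 = int q"
    proof
      assume "int q dvd r + 1"
      from zdvd_imp_le[OF this] show "r + 1 = int q" using m(2,3) by linarith
    qed simp
    finally have dvd: "int q dvd m + 1 \<longleftrightarrow> r + 1 = int q" .
    show ?thesis
    proof (cases "r + 1 = int q")
      case True
      then have "m + 1 = int q * (m div int q + 1) + 0" using m(1) by (simp only: distrib_left mult_1_right)
      then have "(m + 1) div int q = m div int q + 1" using pq(2) by (intro int_div_pos_eq) auto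
      then show ?thesis using True dvd by simp
    next
      case False
      have "m + 1 = int q * (m div int q) + (r + 1)" using m(1) by linarith
      from int_div_pos_eq[OF this] have "(m + 1) div int q = m div int q" using m(2,3) False by linarith
      then show ?thesis using False dvd by simp
    qed
  qed
  define G where "G U = (\<Sum>i<q. (U + int i * p) div int q)" for U
  have single: "(\<Sum>i<q. of_bool (int q dvd (U + 1) + int i * p \<and> P i)) = (of_bool (P (idx U)) :: int)" for U P
  proof -
    have "(\<Sum>i<q. of_bool (int q dvd (U + 1) + int i * p \<and> P i)) = (\<Sum>i<q. if i = idx U then of_bool (P (idx U)) else 0 :: int)"
      using idx_eq[of _ U] by (intro sum.cong) auto
    then show ?thesis using idx(1)[of U] by simp
  qed
  have Gstep: "G (U + 1) = G U + 1" for U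
  proof -
    have "G (U + 1) = (\<Sum>i<q. (U + int i * p) div int q + of_bool (int q dvd (U + 1) + int i * p))"
      unfolding G_def
    proof (intro sum.cong refl)
      fix i show "(U + 1 + int i * p) div int q = (U + int i * p) div int q + of_bool (int q dvd (U + 1) + int i * p)"
        using div_Suc[of "U + int i * p"] by (simp add: ac_simps)
    qed
    then show ?thesis using single[of U "\<lambda>_. True"] by (simp add: sum.distrib G_def)
  qed
  have G: "G U = G 0 + U" for U
  proof (induction U rule: int_induct[of _ 0])
    case (step1 U)
    then show ?case using Gstep[of U] by simp
  next
    case (step2 U)
    then show ?case using Gstep[of "U - 1"] by simp
  qed simp
  define \<rho> where "\<rho> U = real (idx U) / real q" for U
  have \<rho>: "0 \<le> \<rho> U \<and> \<rho> U < 1" for U using idx(1)[of U] by (simp add: \<rho>_def)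
  have "(\<Sum>i<q. \<lfloor>u + real i * \<alpha>\<rfloor>) = G 0 + \<lfloor>real q * u + \<rho> \<lfloor>real q * u\<rfloor> * d\<rfloor>" for u
  proof -
    define U y where "U = \<lfloor>real q * u\<rfloor>" and "y = real q * u - of_int U"
    have y: "0 \<le> y" "y < 1" unfolding y_def U_def by linarith+
    have floor_term: "\<lfloor>u + real i * \<alpha>\<rfloor> = (U + int i * p) div int q + of_bool (int q dvd (U + 1) + int i * p \<and> 1 \<le> y + real i / real q * d)"
      if i: "i < q" for i
    proof -
      define s where "s = y + real i / real q * d"
      have s: "0 \<le> s" "s < 2"
      proof -
        have "real i / real q \<le> 1" "0 \<le> real i / real q" using i by auto
        then have "real i / real q * d \<le> 1 * 1" "0 \<le> real i / real q * d"
          using d(2,3) by (intro mult_mono mult_nonneg_nonneg; simp)+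
        then show "0 \<le> s" "s < 2" using y by (simp_all add: s_def)
      qed
      have \<alpha>: "\<alpha> = (of_int p + d / real q) / real q" using pq(2) by (simp add: d(1) field_simps)
      have u: "u = (of_int U + y) / real q" using pq(2) by (simp add: y_def)
      have "u + real i * \<alpha> = (of_int U + y) / real q + real i * ((of_int p + d / real q) / real q)"
        using \<alpha> u by simp
      also have "\<dots> = (of_int (U + int i * p) + s) / of_int (int q)"
        by (simp add: s_def add_divide_distrib distrib_left)
      finally have "u + real i * \<alpha> = (of_int (U + int i * p) + s) / of_int (int q)" .
      then have "\<lfloor>u + real i * \<alpha>\<rfloor> = \<lfloor>of_int (U + int i * p) + s\<rfloor> div int q"
        by (simp only: floor_divide_real_eq_div)
      also have "\<lfloor>of_int (U + int i * p) + s\<rfloor> = U + int i * p + of_bool (1 \<le> s)"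
        using s by (intro floor_unique) auto
      also have "\<dots> div int q = (U + int i * p) div int q + of_bool (int q dvd (U + 1) + int i * p \<and> 1 \<le> s)"
        using div_Suc[of "U + int i * p"] by (simp add: ac_simps)
      finally show ?thesis by (simp add: s_def)
    qed
    have "(\<Sum>i<q. \<lfloor>u + real i * \<alpha>\<rfloor>) = G U + of_bool (1 \<le> y + real (idx U) / real q * d)"
      using floor_term by (simp add: sum.distrib G_def single)
    moreover have "\<lfloor>real q * u + \<rho> U * d\<rfloor> = U + of_bool (1 \<le> y + \<rho> U * d)"
    proof -
      have "\<rho> U * d \<le> 1 * 1" "0 \<le> \<rho> U * d" using \<rho>[of U] d(2,3) by (intro mult_mono mult_nonneg_nonneg; simp)+
      then show ?thesis using y by (intro floor_unique) (auto simp: y_def)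
    qed
    ultimately show ?thesis using G[of U] by (simp add: U_def \<rho>_def)
  qed
  then show ?thesis using \<rho> by blast
qed

text \<open>The nested windows \<open>E\<^sub>k\<close> below record where the number of visits to an arc of length \<open>\<beta>\<close> during \<open>K q\<close> steps
  exceeds its minimum \<open>K j\<close> by more than \<open>k\<close>. Their lengths are \<open>\<theta> + (K - 1 - 2 k) d\<close> up to a term \<open>(\<rho> (U + j) - \<rho> U) d\<close>
  that does not depend on \<open>k\<close>.\<close>

definition visit_window :: "nat \<Rightarrow> real \<Rightarrow> real \<Rightarrow> (int \<Rightarrow> real) \<Rightarrow> int \<Rightarrow> int \<Rightarrow> nat \<Rightarrow> real set" where
  "visit_window K d \<theta> \<rho> j U k = {1 - \<theta> - (real K - 1 - real k + \<rho> (U + j)) * d ..< 1 - (real k + \<rho> U) * d}"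

text \<open>Split the K q steps into K blocks of length q. Block k begins k d / q further along, so
  one more point crosses an integer in it exactly if y + k d + \<rho> d reaches 1. For u + \<beta>
  the position is y + \<theta> instead of y, and the number of visits becomes a difference of
  indicators of half-lines in y.\<close>

lemma sum_floor_difference:
  fixes p j :: int and q K :: nat and \<alpha> \<beta> d \<theta> :: real
  assumes pq: "coprime p (int q)" "0 < q" and d: "d = real q * (real q * \<alpha> - of_int p)" "0 \<le> d" "real K * d \<le> 1/4" "0 < K"
    and \<theta>: "\<theta> = real q * \<beta> - of_int j" "1/4 \<le> \<theta>" "\<theta> \<le> 3/4"
  shows "\<exists>\<rho>. (\<forall>U. 0 \<le> \<rho> U \<and> \<rho> U < 1) \<and>
    (\<forall>u. (\<Sum>i<K * q. \<lfloor>u + \<beta> + real i * \<alpha>\<rfloor> - \<lfloor>u + real i * \<alpha>\<rfloor>)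
       = int K * j + (\<Sum>k<K. of_bool (frac (real q * u) \<in> visit_window K d \<theta> \<rho> j \<lfloor>real q * u\<rfloor> k)))"
proof -
  have "1 * d \<le> real K * d" using d by (intro mult_right_mono) auto
  then have d1: "d \<le> 1/4" using d by linarith
  obtain c :: int and \<rho> where \<rho>: "\<And>U. 0 \<le> \<rho> U" "\<And>U. \<rho> U < 1"
    and S: "\<And>u. (\<Sum>i<q. \<lfloor>u + real i * \<alpha>\<rfloor>) = c + \<lfloor>real q * u + \<rho> \<lfloor>real q * u\<rfloor> * d\<rfloor>"
    using sum_floor_rotation[OF pq d(1,2)] d1 by auto
  \<comment> \<open>For x \<ge> 1 the offset is read in the next cell, but x + d < 2 makes the value
    U + 1 with either offset. Thus \<rho> U serves in both cases.\<close>
  have two: "\<lfloor>of_int U + x + \<rho> \<lfloor>of_int U + x\<rfloor> * d\<rfloor> = U + of_bool (1 \<le> x + \<rho> U * d)" if x: "0 \<le> x" "x + d < 2" for U x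
  proof -
    have r: "0 \<le> \<rho> V * d" "\<rho> V * d \<le> d" for V
      using \<rho>[of V] d(2) mult_right_mono[of "\<rho> V" 1 d] by auto
    show ?thesis
    proof (cases "x < 1")
      case True
      then have "\<lfloor>of_int U + x\<rfloor> = U" using x by (intro floor_unique) auto
      then show ?thesis using r[of U] x True d1 by (intro floor_unique) (auto simp: )
    next
      case False
      then have "\<lfloor>of_int U + x\<rfloor> = U + 1" using x d(2) by (intro floor_unique) auto
      then show ?thesis using r[of U] r[of "U + 1"] x False d1 by (intro floor_unique) (auto simp: )
    qed
  qed
  have "(\<Sum>i<K * q. \<lfloor>u + \<beta> + real i * \<alpha>\<rfloor> - \<lfloor>u + real i * \<alpha>\<rfloor>)
       = int K * j + (\<Sum>k<K. of_bool (frac (real q * u) \<in> visit_window K d \<theta> \<rho> j \<lfloor>real q * u\<rfloor> k))" for u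
  proof -
    define U y where "U = \<lfloor>real q * u\<rfloor>" and "y = frac (real q * u)"
    have y: "0 \<le> y" "y < 1" "real q * u = of_int U + y" by (simp_all add: y_def U_def frac_def frac_lt_1) linarith
    \<comment> \<open>The bound 7/4 comes from y + \<theta> < 1 + 3/4; with (k + 1) d \<le> 1/4 the
      position stays below 2, as \<open>two\<close> demands.\<close>
    have block: "(\<Sum>i = k * q..<k * q + q. \<lfloor>v + real i * \<alpha>\<rfloor>) = int q * int k * p + c + V + of_bool (1 \<le> x + real k * d + \<rho> V * d)"
      if k: "k < K" and v: "real q * v = of_int V + x" "0 \<le> x" "x < 7/4" for v V x k
    proof -
      have kd: "real k * d + d \<le> 1/4"
      proof -
        have "(real k + 1) * d \<le> real K * d" using k d(2) by (intro mult_right_mono) auto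
        then show ?thesis using d(3) by (simp add: distrib_right)
      qed
      have kd0: "0 \<le> real k * d" using d(2) by simp
      have qa: "real q * \<alpha> = of_int p + d / real q" using pq(2) by (simp add: d(1) field_simps)
      have "(\<Sum>i = k * q..<k * q + q. \<lfloor>v + real i * \<alpha>\<rfloor>) = (\<Sum>i<q. \<lfloor>v + real (i + k * q) * \<alpha>\<rfloor>)"
        using sum.shift_bounds_nat_ivl[of "\<lambda>i. \<lfloor>v + real i * \<alpha>\<rfloor>" 0 "k * q" q] by (simp add: add.commute atLeast0LessThan)
      also have "\<dots> = (\<Sum>i<q. int k * p + \<lfloor>(v + real k * d / real q) + real i * \<alpha>\<rfloor>)"
      proof (intro sum.cong refl)
        fix i
        have "real (k * q) * \<alpha> = real k * (real q * \<alpha>)" by simp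
        also have "\<dots> = of_int (int k * p) + real k * d / real q" unfolding qa by (simp add: algebra_simps)
        finally have "v + real (i + k * q) * \<alpha> = of_int (int k * p) + ((v + real k * d / real q) + real i * \<alpha>)" by (simp add: algebra_simps)
        then show "\<lfloor>v + real (i + k * q) * \<alpha>\<rfloor> = int k * p + \<lfloor>(v + real k * d / real q) + real i * \<alpha>\<rfloor>"
          by (simp only: floor_add_int[symmetric] add.commute[of "of_int _"])
      qed
      also have "\<dots> = int q * int k * p + (c + \<lfloor>real q * (v + real k * d / real q) + \<rho> \<lfloor>real q * (v + real k * d / real q)\<rfloor> * d\<rfloor>)"
        by (simp add: sum.distrib S)
      also have "real q * (v + real k * d / real q) = of_int V + (x + real k * d)"
        using v pq(2) by (simp add: algebra_simps)
      also have "\<lfloor>of_int V + (x + real k * d) + \<rho> \<lfloor>of_int V + (x + real k * d)\<rfloor> * d\<rfloor> = V + of_bool (1 \<le> x + real k * d + \<rho> V * d)"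
        using v kd kd0 by (intro two) auto
      finally show ?thesis by simp
    qed
    have qb: "real q * (u + \<beta>) = of_int (U + j) + (y + \<theta>)" using y \<theta> by (simp add: algebra_simps)
    have "(\<Sum>i<K * q. \<lfloor>u + \<beta> + real i * \<alpha>\<rfloor> - \<lfloor>u + real i * \<alpha>\<rfloor>)
       = (\<Sum>k<K. (\<Sum>i = k * q..<k * q + q. \<lfloor>u + \<beta> + real i * \<alpha>\<rfloor>) - (\<Sum>i = k * q..<k * q + q. \<lfloor>u + real i * \<alpha>\<rfloor>))"
      by (subst sum.nat_group[symmetric]) (simp add: sum_subtractf)
    also have "\<dots> = (\<Sum>k<K. j + (of_bool (1 \<le> y + \<theta> + real k * d + \<rho> (U + j) * d) - of_bool (1 \<le> y + real k * d + \<rho> U * d)))"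
      using y \<theta> by (intro sum.cong refl) (simp add: block[OF _ qb] block[OF _ y(3)])
    also have "\<dots> = int K * j + ((\<Sum>k<K. of_bool (1 \<le> y + \<theta> + real k * d + \<rho> (U + j) * d)) - (\<Sum>k<K. of_bool (1 \<le> y + real k * d + \<rho> U * d)))"
      by (simp add: sum.distrib sum_subtractf)
    \<comment> \<open>The reversal pairs the largest half-line of one family with the smallest of
      the other, so that the resulting windows shrink as k grows.\<close>
    also have "(\<Sum>k<K. of_bool (1 \<le> y + \<theta> + real k * d + \<rho> (U + j) * d)) = (\<Sum>k<K. of_bool (1 \<le> y + \<theta> + real (K - Suc k) * d + \<rho> (U + j) * d) :: int)"
      by (rule sum.nat_diff_reindex[symmetric])
    also have "(\<Sum>k<K. of_bool (1 \<le> y + \<theta> + real (K - Suc k) * d + \<rho> (U + j) * d)) - (\<Sum>k<K. of_bool (1 \<le> y + real k * d + \<rho> U * d))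
       = (\<Sum>k<K. of_bool (y \<in> visit_window K d \<theta> \<rho> j U k) :: int)"
      unfolding sum_subtractf[symmetric]
    proof (intro sum.cong refl)
      fix k assume "k \<in> {..<K}"
      then have k: "k < K" by simp
      have e: "real (K - Suc k) = real K - 1 - real k" using k by (simp add: of_nat_diff)
      have "(real k + 1) * d \<le> real K * d" using k d(2) by (intro mult_right_mono) auto
      moreover have "\<rho> U * d \<le> 1 * d" using \<rho>[of U] d(2) by (intro mult_right_mono) auto
      ultimately have "real k * d + \<rho> U * d \<le> 1/4" using d(3) by (simp add: distrib_right)
      moreover have "0 \<le> real (K - Suc k) * d" "0 \<le> \<rho> (U + j) * d" using \<rho> d(2) by auto
      ultimately show "of_bool (1 \<le> y + \<theta> + real (K - Suc k) * d + \<rho> (U + j) * d) - of_bool (1 \<le> y + real k * d + \<rho> U * d)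
        = (of_bool (y \<in> visit_window K d \<theta> \<rho> j U k) :: int)"
        using \<theta> unfolding visit_window_def e by (auto simp: distrib_right)
    qed
    finally show ?thesis by (simp add: U_def y_def)
  qed
  then show ?thesis using \<rho> by (intro exI[of _ \<rho>]) auto
qed

section \<open>Three intervals as an induced rotation\<close>

locale three_interval =
  fixes a b c :: real
  assumes pos: "0 < a" "0 < b" "0 < c"
begin

definition "D = a + b + c"
definition "C = b + c"
definition "L = a + 2 * b + c"
definition "\<alpha> = C / L"
definition "\<beta> = b / L"

definition T :: "real \<Rightarrow> real" where
  "T x = (if x < a then x + C else if x < a + b then x + c - a else x - (a + b))"

text \<open>The inverse of \<open>T\<close> on [0, D): the exchange with lengths c, b, a.\<close>

definition T' :: "real \<Rightarrow> real" where
  "T' y = (if y < c then y + (a + b) else if y < C then y + a - c else y - C)"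

definition rot :: "real \<Rightarrow> real" where
  "rot z = (if z + C < L then z + C else z + C - L)"

definition orb :: "nat \<Rightarrow> real \<Rightarrow> real" where
  "orb t x = L * frac ((x + real t * C) / L)"

definition visits :: "nat \<Rightarrow> real \<Rightarrow> nat" where
  "visits t x = (\<Sum>i<t. of_bool (D \<le> orb i x))"

lemmas lengths = D_def C_def L_def

lemma D_pos: "0 < D" and L_pos: "0 < L" and C_pos: "0 < C" and C_less: "C < L" and L_eq: "L = D + b"
  using pos by (simp_all add: lengths)

lemma T_mem: "x \<in> {0..<D} \<Longrightarrow> T x \<in> {0..<D}"
  using pos by (auto simp: T_def lengths)

lemma T'_T: "x \<in> {0..<D} \<Longrightarrow> T' (T x) = x"
  using pos by (auto simp: T_def T'_def lengths)

lemma T_funpow_mem: "x \<in> {0..<D} \<Longrightarrow> (T ^^ n) x \<in> {0..<D}"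
  by (induction n) (simp_all only: funpow.simps id_apply comp_apply T_mem)

lemma T'_T_funpow: "x \<in> {0..<D} \<Longrightarrow> (T' ^^ n) ((T ^^ n) x) = x"
proof (induction n)
  case (Suc n)
  have "(T' ^^ Suc n) ((T ^^ Suc n) x) = (T' ^^ n) (T' (T ((T ^^ n) x)))"
    by (simp only: funpow_Suc_right[of n T'] comp_apply funpow.simps(2)[of n T])
  then show ?case using Suc T_funpow_mem[OF Suc.prems, of n] by (simp only: T'_T)
qed simp

lemma measurable_T [measurable]: "T \<in> borel_measurable borel"
  unfolding T_def by measurable

lemma measurable_T' [measurable]: "T' \<in> borel_measurable borel"
  unfolding T'_def by measurable

lemma measurable_T_funpow [measurable]: "T ^^ n \<in> borel_measurable borel"
  by (induction n) (auto simp: comp_def)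

lemma measurable_T'_funpow [measurable]: "T' ^^ n \<in> borel_measurable borel"
  by (induction n) (auto simp: comp_def)

text \<open>The circle [0, L) is [0, D) with an arc of length b appended. Adding C sends exactly the
  middle interval onto this arc, from which one further step leads back.\<close>

lemma T_rot:
  assumes "z \<in> {0..<D}"
  shows "T z = (if rot z < D then rot z else rot (rot z))"
  using assms pos by (auto simp: T_def rot_def lengths)

lemma rot_outside:
  assumes "D \<le> z" "z < L"
  shows "0 \<le> rot z" "rot z < D"
  using assms pos by (auto simp: rot_def lengths)

lemma orb_bounds: "0 \<le> orb t x" "orb t x < L"
  using L_pos by (simp_all add: orb_def frac_lt_1)

lemma orb_0: "x \<in> {0..<D} \<Longrightarrow> orb 0 x = x"
  using L_pos L_eq pos by (simp add: orb_def frac_eq_id)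

lemma orb_Suc: "orb (Suc t) x = rot (orb t x)"
proof -
  have \<alpha>: "frac \<alpha> = \<alpha>" using C_pos C_less L_pos by (simp add: \<alpha>_def frac_eq_id)
  define v where "v = (x + real t * C) / L"
  have "(x + real (Suc t) * C) / L = v + \<alpha>" by (simp add: v_def \<alpha>_def add_divide_distrib distrib_right)
  then have "orb (Suc t) x = L * frac (v + \<alpha>)" by (simp add: orb_def)
  also have "\<dots> = rot (L * frac v)"
    using L_pos by (simp add: frac_add \<alpha> rot_def) (simp add: \<alpha>_def field_simps)
  finally show ?thesis by (simp add: orb_def v_def)
qed

text \<open>Every visit to [D, L) is a rotation step that \<open>T\<close> skips. If the orbit sits
  in the arc at time t, then \<open>T\<close> has already moved past it, whence the additional
  \<open>rot\<close>.\<close>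

lemma T_funpow_orb:
  assumes x: "x \<in> {0..<D}"
  shows "visits t x \<le> t \<and> (T ^^ (t - visits t x)) x = (if orb t x < D then orb t x else rot (orb t x))"
proof (induction t)
  case 0
  then show ?case using orb_0[OF x] x by (simp add: visits_def)
next
  case (Suc t)
  show ?case
  proof (cases "orb t x < D")
    case True
    then have "visits (Suc t) x = visits t x" by (simp add: visits_def)
    moreover from this have "(T ^^ (Suc t - visits (Suc t) x)) x = T (orb t x)"
      using Suc True by (simp add: Suc_diff_le)
    ultimately show ?thesis using Suc T_rot[of "orb t x"] orb_bounds[of t x] True by (simp add: orb_Suc)
  next
    case False
    then have "visits (Suc t) x = Suc (visits t x)" by (simp add: visits_def)
    then show ?thesis using Suc False rot_outside[of "orb t x"] orb_bounds[of t x] by (simp add: orb_Suc)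
  qed
qed

text \<open>A point lies in the arc [D, L) exactly if adding \<beta> to its normalized position
  crosses an integer.\<close>

lemma visits_floor: "int (visits t x) = (\<Sum>i<t. \<lfloor>x / L + \<beta> + real i * \<alpha>\<rfloor> - \<lfloor>x / L + real i * \<alpha>\<rfloor>)"
  unfolding visits_def of_nat_sum
proof (intro sum.cong refl)
  fix i
  define v where "v = x / L + real i * \<alpha>"
  have \<beta>: "0 < \<beta>" "\<beta> < 1" "L * (1 - \<beta>) = D" using pos L_pos by (simp_all add: \<beta>_def lengths field_simps)
  have "orb i x = L * frac v" by (simp add: orb_def v_def \<alpha>_def add_divide_distrib)
  then have "D \<le> orb i x \<longleftrightarrow> 1 - \<beta> \<le> frac v" using \<beta>(3) L_pos by (metis mult_le_cancel_left_pos)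
  moreover have "\<lfloor>v + \<beta>\<rfloor> = \<lfloor>v\<rfloor> + of_bool (1 - \<beta> \<le> frac v)"
    using \<beta> frac_lt_1[of v] frac_ge_0[of v] by (intro floor_unique) (auto simp: frac_def intro: order_trans[OF of_int_floor_le])
  ultimately show "int (of_bool (D \<le> orb i x)) = \<lfloor>x / L + \<beta> + real i * \<alpha>\<rfloor> - \<lfloor>x / L + real i * \<alpha>\<rfloor>"
    by (simp add: v_def ac_simps)
qed

section \<open>Integration over the domain\<close>

definition integ :: "(real \<Rightarrow> real) \<Rightarrow> real" where
  "integ f = (LBINT x. indicator {0..<D} x * f x)"

lemma integrable_bounded_on_domain:
  fixes f :: "real \<Rightarrow> real"
  assumes [measurable]: "f \<in> borel_measurable borel" and f: "\<And>x. x \<in> {0..<D} \<Longrightarrow> \<bar>f x\<bar> \<le> B"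
  shows "integrable lborel (\<lambda>x. indicator {0..<D} x * f x)"
proof (rule Bochner_Integration.integrable_bound[where f="\<lambda>x. B * indicator {0..<D} x"])
  show "integrable lborel (\<lambda>x. B * indicator {0..<D} x :: real)" using D_pos by simp
qed (use f in \<open>fastforce split: split_indicator\<close>)+

lemma abs_integ_le:
  assumes [measurable]: "f \<in> borel_measurable borel" and f: "\<And>x. x \<in> {0..<D} \<Longrightarrow> \<bar>f x\<bar> \<le> B"
  shows "\<bar>integ f\<bar> \<le> B * D"
proof -
  have "\<bar>integ f\<bar> \<le> (LBINT x. \<bar>indicator {0..<D} x * f x\<bar>)" unfolding integ_def by (rule integral_abs_bound)
  also have "\<dots> \<le> (LBINT x. B * indicator {0..<D} x)"
    using integrable_bounded_on_domain[OF assms] D_pos f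
    by (intro integral_mono integrable_abs) (auto split: split_indicator)
  finally show ?thesis using D_pos by simp
qed

lemma integral_indicator_shift:
  fixes f :: "real \<Rightarrow> real"
  shows "(LBINT x. indicator {u..<v} x * f (x + s)) = (LBINT x. indicator {u + s..<v + s} x * f x)"
proof -
  have "(LBINT x. indicator {u + s..<v + s} x * f x) = (LBINT x. indicator {u + s..<v + s} (s + 1 * x) * f (s + 1 * x))"
    using lborel_integral_real_affine[of 1 "\<lambda>x. indicator {u + s..<v + s} x * f x" s] by simp
  also have "\<dots> = (LBINT x. indicator {u..<v} x * f (x + s))"
    by (intro Bochner_Integration.integral_cong) (auto simp: add.commute split: split_indicator)
  finally show ?thesis by simp
qed

lemma integ_T:
  assumes [measurable]: "f \<in> borel_measurable borel" and f: "\<And>x. x \<in> {0..<D} \<Longrightarrow> \<bar>f x\<bar> \<le> B"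
  shows "integ (\<lambda>x. f (T x)) = integ f"
proof -
  have sub: "integrable lborel (\<lambda>x. indicator {u..<v} x * g x)" 
    if "\<And>x. x \<in> {0..<D} \<Longrightarrow> \<bar>g x\<bar> \<le> B" "0 \<le> u" "v \<le> D" "g \<in> borel_measurable borel" for u v and g :: "real \<Rightarrow> real"
    by (rule Bochner_Integration.integrable_bound[OF integrable_bounded_on_domain[OF that(4,1)]])
      (use that in \<open>auto split: split_indicator\<close>)
  have fT: "\<bar>f (T x)\<bar> \<le> B" if "x \<in> {0..<D}" for x using T_mem[OF that] by (rule f)
  have "integ (\<lambda>x. f (T x)) = (LBINT x. indicator {0..<a} x * f (T x) + (indicator {a..<a + b} x * f (T x) + indicator {a + b..<D} x * f (T x)))"
    unfolding integ_def using pos by (intro Bochner_Integration.integral_cong) (auto simp: lengths split: split_indicator)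
  also have "\<dots> = (LBINT x. indicator {0..<a} x * f (T x)) + ((LBINT x. indicator {a..<a + b} x * f (T x)) + (LBINT x. indicator {a + b..<D} x * f (T x)))"
    using pos fT by (intro Bochner_Integration.integral_add[THEN trans] arg_cong2[where f="(+)"] refl Bochner_Integration.integral_add Bochner_Integration.integrable_add sub) (auto simp: lengths)
  also have "(LBINT x. indicator {0..<a} x * f (T x)) = (LBINT x. indicator {0..<a} x * f (x + C))"
    by (intro Bochner_Integration.integral_cong) (auto simp: T_def split: split_indicator)
  also have "(LBINT x. indicator {a..<a + b} x * f (T x)) = (LBINT x. indicator {a..<a + b} x * f (x + (c - a)))"
    by (intro Bochner_Integration.integral_cong) (auto simp: T_def add_diff_eq split: split_indicator)
  also have "(LBINT x. indicator {a + b..<D} x * f (T x)) = (LBINT x. indicator {a + b..<D} x * f (x + - (a + b)))"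
    using pos by (intro Bochner_Integration.integral_cong) (auto simp: T_def split: split_indicator intro!: arg_cong[where f=f])
  also have "(LBINT x. indicator {0..<a} x * f (x + C)) + ((LBINT x. indicator {a..<a + b} x * f (x + (c - a))) + (LBINT x. indicator {a + b..<D} x * f (x + - (a + b))))
    = (LBINT x. indicator {C..<D} x * f x) + ((LBINT x. indicator {c..<C} x * f x) + (LBINT x. indicator {0..<c} x * f x))"
    unfolding integral_indicator_shift by (simp add: lengths algebra_simps)
  also have "\<dots> = (LBINT x. indicator {C..<D} x * f x + (indicator {c..<C} x * f x + indicator {0..<c} x * f x))"
    using pos f by (intro Bochner_Integration.integral_add[THEN trans, symmetric] arg_cong2[where f="(+)"] refl Bochner_Integration.integral_add Bochner_Integration.integrable_add sub) (auto simp: lengths)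
  also have "\<dots> = integ f"
    unfolding integ_def using pos by (intro Bochner_Integration.integral_cong) (auto simp: lengths split: split_indicator)
  finally show ?thesis .
qed

lemma integ_T_funpow:
  assumes [measurable]: "f \<in> borel_measurable borel" and f: "\<And>x. x \<in> {0..<D} \<Longrightarrow> \<bar>f x\<bar> \<le> B"
  shows "integ (\<lambda>x. f ((T ^^ n) x)) = integ f"
proof (induction n)
  case (Suc n)
  have "integ (\<lambda>x. f ((T ^^ n) (T x))) = integ (\<lambda>x. f ((T ^^ n) x))"
    using f T_funpow_mem by (intro integ_T[where B=B]) auto
  then show ?case using Suc by (simp add: funpow_swap1)
qed simp

end

text \<open>\<open>P\<close> holds on an initial segment, so the sum telescopes. In this way f (T^n
  x), with n depending on x, becomes a combination of the increments f (T^(k+1) x) - f (T^k x) with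
  nested indicators as coefficients.\<close>

lemma sum_nested_increments:
  fixes g :: "nat \<Rightarrow> real"
  assumes "\<And>k. P (Suc k) \<Longrightarrow> P k"
  shows "(\<Sum>k<K. of_bool (P k) * (g (Suc k) - g k)) = g (\<Sum>k<K. of_bool (P k)) - g 0"
proof -
  have "(\<Sum>k<K. of_bool (P k) :: nat) = K \<and> (\<Sum>k<K. of_bool (P k) * (g (Suc k) - g k)) = g K - g 0 \<or>
    \<not> P K \<and> (\<Sum>k<K. of_bool (P k) * (g (Suc k) - g k)) = g (\<Sum>k<K. of_bool (P k)) - g 0"
  proof (induction K)
    case (Suc K)
    then show ?case using assms[of K] by (cases "P K") auto
  qed simp
  then show ?thesis by auto
qed

context three_interval
begin

section \<open>Expansion of correlations along near returns\<close>

text \<open>On the circle of length 1, q steps displace a point by \<open>d\<close> cells of length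
  1 / q, and \<theta> is the excess over \<open>j\<close> of the expected number q \<beta> of
  visits.\<close>

definition near_return :: "nat \<Rightarrow> int \<Rightarrow> int \<Rightarrow> real \<Rightarrow> real \<Rightarrow> bool" where
  "near_return q p j d \<theta> \<longleftrightarrow> 0 < q \<and> coprime p (int q) \<and> d = real q * (real q * \<alpha> - of_int p) \<and> 0 \<le> d \<and>
     \<theta> = real q * \<beta> - of_int j \<and> 1/4 \<le> \<theta> \<and> \<theta> \<le> 3/4"

text \<open>Ensures that \<open>nat (int q - j)\<close> is the true difference, without
  truncation.\<close>

lemma near_return_count:
  assumes "near_return q p j d \<theta>"
  shows "0 \<le> j" "j \<le> int q"
proof -
  have \<beta>: "0 < \<beta>" "\<beta> < 1" using pos L_pos by (simp_all add: \<beta>_def lengths)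
  have q: "0 < real q" using assms by (simp add: near_return_def)
  have "0 < real q * \<beta>" "real q * \<beta> < real q" using \<beta> q by simp_all
  then have "- 1 < real_of_int j" "real_of_int j < real q" using assms unfolding near_return_def by linarith+
  then show "0 \<le> j" "j \<le> int q" by linarith+
qed

abbreviation extra_visits :: "nat \<Rightarrow> real \<Rightarrow> real \<Rightarrow> (int \<Rightarrow> real) \<Rightarrow> int \<Rightarrow> nat \<Rightarrow> real \<Rightarrow> nat" where
  "extra_visits K d \<theta> \<rho> j q x \<equiv> (\<Sum>k<K. of_bool (frac (real q * x / L) \<in> visit_window K d \<theta> \<rho> j \<lfloor>real q * x / L\<rfloor> k))"

text \<open>K q rotation steps are a translation by K d L / q with K j + n visits, hence K (q - j) -
  n steps of \<open>T\<close>. Applying \<open>T\<close> another n times makes the exponent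
  independent of x. The upper bound on x keeps the translated point out of the arc.\<close>

lemma T_near_return:
  assumes nr: "near_return q p j d \<theta>" and K: "real K * d \<le> 1/4" "0 < K"
  obtains \<rho> where "\<And>U. 0 \<le> \<rho> U \<and> \<rho> U < 1"
    "\<And>x. 0 \<le> x \<Longrightarrow> x + real K * d * L / real q < D \<Longrightarrow>
       (T ^^ (K * nat (int q - j))) x = (T ^^ (extra_visits K d \<theta> \<rho> j q x))
           (x + real K * d * L / real q)"
proof -
  have pq: "coprime p (int q)" "0 < q" and d: "d = real q * (real q * \<alpha> - of_int p)" "0 \<le> d"
    and \<theta>: "\<theta> = real q * \<beta> - of_int j" "1/4 \<le> \<theta>" "\<theta> \<le> 3/4"
    using nr by (auto simp: near_return_def)
  obtain \<rho> where \<rho>: "\<And>U. 0 \<le> \<rho> U \<and> \<rho> U < 1"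
    and cnt: "\<And>u. (\<Sum>i<K * q. \<lfloor>u + \<beta> + real i * \<alpha>\<rfloor> - \<lfloor>u + real i * \<alpha>\<rfloor>)
       = int K * j + (\<Sum>k<K. of_bool (frac (real q * u) \<in> visit_window K d \<theta> \<rho> j \<lfloor>real q * u\<rfloor> k))"
    using sum_floor_difference[OF pq d K \<theta>] by blast
  have "(T ^^ (K * nat (int q - j))) x = (T ^^ (extra_visits K d \<theta> \<rho> j q x))
           (x + real K * d * L / real q)"
    if x: "0 \<le> x" "x + real K * d * L / real q < D" for x
  proof -
    define n where "n = extra_visits K d \<theta> \<rho> j q x"
    have s0: "0 \<le> real K * d * L / real q" using d(2) L_pos by simp
    have xD: "x \<in> {0..<D}" using x s0 by auto
    have vis: "int (visits (K * q) x) = int K * j + int n"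
      unfolding visits_floor cnt n_def by simp
    have "real (K * q) * C / L = of_int (int K * p) + real K * d / real q"
      using pq(2) L_pos by (simp add: d(1) \<alpha>_def field_simps)
    then have e: "(x + real (K * q) * C) / L = (x + real K * d * L / real q) / L + of_int (int K * p)"
      using L_pos by (simp add: add_divide_distrib)
    have f: "frac ((x + real K * d * L / real q) / L) = (x + real K * d * L / real q) / L"
      using x s0 L_pos L_eq pos by (simp add: frac_eq)
    have orb: "orb (K * q) x = x + real K * d * L / real q"
      unfolding orb_def e using L_pos by (simp add: frac_def) (use f in \<open>simp add: frac_def field_simps\<close>)
    have "visits (K * q) x \<le> K * q" "(T ^^ (K * q - visits (K * q) x)) x = orb (K * q) x"
      using T_funpow_orb[OF xD, of "K * q"] orb x by auto
    moreover have "int (K * nat (int q - j)) = int K * int q - int K * j"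
      using near_return_count[OF nr] by (simp add: right_diff_distrib)
    ultimately have "K * nat (int q - j) = n + (K * q - visits (K * q) x)"
      using vis by (simp add: of_nat_diff flip: of_nat_mult)
    then show ?thesis
      using \<open>(T ^^ (K * q - visits (K * q) x)) x = orb (K * q) x\<close> orb by (simp add: funpow_add n_def)
  qed
  then show ?thesis using that \<rho> by blast
qed

lemma visit_window_decreasing:
  assumes "0 \<le> d" "y \<in> visit_window K d \<theta> \<rho> j U (Suc k)"
  shows "y \<in> visit_window K d \<theta> \<rho> j U k"
proof -
  have "(real K - 1 - real (Suc k) + \<rho> (U + j)) * d \<le> (real K - 1 - real k + \<rho> (U + j)) * d"
    "(real k + \<rho> U) * d \<le> (real (Suc k) + \<rho> U) * d"
    using assms(1) by (intro mult_right_mono; simp)+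
  then show ?thesis using assms(2) unfolding visit_window_def by auto
qed

text \<open>The subtracted term is the length of the window in units of a cell. It is constant on
  each cell, since both offsets \<rho> are.\<close>

lemma window_mean_zero:
  fixes Y j :: int and x :: real
  assumes q: "0 < q" and d: "0 \<le> d" "real K * d \<le> 1/4" and k: "k < K" and \<theta>: "1/4 \<le> \<theta>" "\<theta> \<le> 3/4"
    and \<rho>: "\<And>U. 0 \<le> \<rho> U \<and> \<rho> U < 1"
  defines "\<psi> \<equiv> \<lambda>x. of_bool (frac (real q * x / L) \<in> visit_window K d \<theta> \<rho> j \<lfloor>real q * x / L\<rfloor> k)
     - (\<theta> + (real K - 1 - 2 * real k + \<rho> (\<lfloor>real q * x / L\<rfloor> + j) - \<rho> \<lfloor>real q * x / L\<rfloor>) * d)"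
  shows "\<psi> \<in> borel_measurable borel" "\<bar>\<psi> x\<bar> \<le> 1"
    "(LBINT x:{of_int Y * (L / real q)..<of_int (Y + 1) * (L / real q)}. \<psi> x) = 0"
proof -
  have window: "0 \<le> l \<and> l \<le> r \<and> r \<le> 1" 
    if "l = 1 - \<theta> - (real K - 1 - real k + \<rho> (U + j)) * d" "r = 1 - (real k + \<rho> U) * d" for U l r
  proof -
    have r: "0 \<le> \<rho> V * d" "\<rho> V * d \<le> d" for V
      using \<rho>[of V] d(1) mult_right_mono[of "\<rho> V" 1 d] by auto
    have "(real k + 1) * d \<le> real K * d" "0 \<le> real k * d" "0 \<le> (real K - 1 - real k) * d"
      using k d(1) by (intro mult_right_mono mult_nonneg_nonneg; simp)+
    moreover have "l = 1 - \<theta> - ((real K - 1 - real k) * d + \<rho> (U + j) * d)" "r = 1 - (real k * d + \<rho> U * d)"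
      "(real K - 1 - real k) * d = real K * d - d - real k * d" "(real k + 1) * d = real k * d + d"
      unfolding that by (simp_all add: distrib_right left_diff_distrib)
    ultimately show ?thesis using r[of U] r[of "U + j"] \<theta> d(2) by (intro conjI) linarith+
  qed
  define l r where "l = (\<lambda>U. 1 - \<theta> - (real K - 1 - real k + \<rho> (U + j)) * d)" and "r = (\<lambda>U. 1 - (real k + \<rho> U) * d)"
  have W: "visit_window K d \<theta> \<rho> j U k = {l U..<r U}" for U by (simp add: visit_window_def l_def r_def)
  have lr: "0 \<le> l U" "l U \<le> r U" "r U \<le> 1" for U using window[of "l U" U "r U"] by (auto simp: l_def r_def)
  have len: "\<theta> + (real K - 1 - 2 * real k + \<rho> (U + j) - \<rho> U) * d = r U - l U" for U
    by (simp add: l_def r_def algebra_simps)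
  have \<psi>: "\<psi> x = of_bool (l \<lfloor>real q * x / L\<rfloor> \<le> frac (real q * x / L) \<and> frac (real q * x / L) < r \<lfloor>real q * x / L\<rfloor>) - (r \<lfloor>real q * x / L\<rfloor> - l \<lfloor>real q * x / L\<rfloor>)" for x
    unfolding \<psi>_def W len by simp
  have [measurable]: "(\<lambda>x::real. g \<lfloor>real q * x / L\<rfloor>) \<in> borel_measurable borel" for g :: "int \<Rightarrow> real"
    by (rule measurable_compose[where N="count_space UNIV"]) auto
  have [measurable]: "(\<lambda>x::real. frac (real q * x / L)) \<in> borel_measurable borel"
    unfolding frac_def by measurable
  have "\<psi> = (\<lambda>x. (if l \<lfloor>real q * x / L\<rfloor> \<le> frac (real q * x / L) \<and> frac (real q * x / L) < r \<lfloor>real q * x / L\<rfloor> then 1 else 0)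
      - (r \<lfloor>real q * x / L\<rfloor> - l \<lfloor>real q * x / L\<rfloor>))"
    by (simp add: \<psi> fun_eq_iff)
  also have "\<dots> \<in> borel_measurable borel" by measurable
  finally show "\<psi> \<in> borel_measurable borel" .
  show "\<bar>\<psi> x\<bar> \<le> 1" using lr[of "\<lfloor>real q * x / L\<rfloor>"] unfolding \<psi> by (auto simp: abs_if)
  define w where "w = L / real q"
  have w: "0 < w" using q L_pos by (simp add: w_def)
  have qx: "real q * x / L = x / w" for x using q by (simp add: w_def)
  have cell: "indicator {of_int Y * w..<of_int (Y + 1) * w} x *\<^sub>R \<psi> x
      = indicator {(of_int Y + l Y) * w..<(of_int Y + r Y) * w} x - (r Y - l Y) * indicator {of_int Y * w..<of_int (Y + 1) * w} x" for x
  proof (cases "x \<in> {of_int Y * w..<of_int (Y + 1) * w}")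
    case True
    then have "\<lfloor>x / w\<rfloor> = Y" using w by (intro floor_unique) (auto simp: field_simps)
    then show ?thesis using True w unfolding \<psi> qx
      by (auto simp: frac_def field_simps split: split_indicator)
  next
    case False
    have "of_int Y * w \<le> (of_int Y + l Y) * w" "(of_int Y + r Y) * w \<le> of_int (Y + 1) * w"
      using lr[of Y] w by (intro mult_right_mono; simp)+
    then have "x \<notin> {(of_int Y + l Y) * w..<(of_int Y + r Y) * w}" using False by auto
    then show ?thesis using False by simp
  qed
  have "(LBINT x:{of_int Y * w..<of_int (Y + 1) * w}. \<psi> x)
     = (LBINT x. indicator {(of_int Y + l Y) * w..<(of_int Y + r Y) * w} x - (r Y - l Y) * indicator {of_int Y * w..<of_int (Y + 1) * w} x)"
    unfolding set_lebesgue_integral_def cell ..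
  also have "\<dots> = ((of_int Y + r Y) * w - (of_int Y + l Y) * w) - (r Y - l Y) * (of_int (Y + 1) * w - of_int Y * w)"
    using lr[of Y] w by (subst Bochner_Integration.integral_diff) (auto simp: mult_right_mono)
  also have "\<dots> = 0" by (simp add: algebra_simps)
  finally show "(LBINT x:{of_int Y * (L / real q)..<of_int (Y + 1) * (L / real q)}. \<psi> x) = 0" by (simp add: w_def)
qed

text \<open>Up to a small translation f (T^(K N) x) is f (T^n x), where n counts the windows
  containing the position of x. After expansion in increments each window indicator splits into a
  part centred on cells, which tends weakly to 0, the number \<theta> + (K - 1 - 2 k) d, and the
  term \<open>d i * R i x\<close>, which does not involve k.\<close>

lemma corr_near_return:
  fixes f h :: "real \<Rightarrow> real" and q :: "nat \<Rightarrow> nat" and p j :: "nat \<Rightarrow> int" and d \<theta> :: "nat \<Rightarrow> real"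
  assumes f[measurable]: "f \<in> borel_measurable borel" and f1: "\<And>x. x \<in> {0..<D} \<Longrightarrow> \<bar>f x\<bar> \<le> 1"
    and h[measurable]: "h \<in> borel_measurable borel" and h1: "\<And>x. x \<in> {0..<D} \<Longrightarrow> \<bar>h x\<bar> \<le> 1"
    and K: "0 < K" "\<And>i. real K * d i \<le> 1/4"
    and nr: "\<And>i. near_return (q i) (p i) (j i) (d i) (\<theta> i)"
    and q: "filterlim q at_top sequentially"
  defines "A \<equiv> \<lambda>k. integ (\<lambda>x. f ((T ^^ k) x) * h x)"
  obtains e where "e \<longlonglongrightarrow> 0" 
    "\<And>i. \<bar>A (K * nat (int (q i) - j i)) - (A 0 + (\<Sum>k<K. (\<theta> i + (real K - 1 - 2 * real k) * d i) * (A (Suc k) - A k)))\<bar> \<le> 2 * D * d i + e i"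
proof -
  have qpos: "0 < q i" and d0: "0 \<le> d i" and \<theta>: "1/4 \<le> \<theta> i" "\<theta> i \<le> 3/4" for i
    using nr[of i] by (auto simp: near_return_def)
  have "\<forall>i. \<exists>\<rho>. (\<forall>U. 0 \<le> \<rho> U \<and> \<rho> U < 1) \<and> (\<forall>x. 0 \<le> x \<longrightarrow> x + real K * d i * L / real (q i) < D \<longrightarrow>
       (T ^^ (K * nat (int (q i) - j i))) x = (T ^^ (extra_visits K (d i) (\<theta> i) \<rho> (j i) (q i) x))
           (x + real K * d i * L / real (q i)))"
  proof
    fix i
    obtain \<rho> where "\<And>U. 0 \<le> \<rho> U \<and> \<rho> U < 1"
    "\<And>x. 0 \<le> x \<Longrightarrow> x + real K * d i * L / real (q i) < D \<Longrightarrow>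
       (T ^^ (K * nat (int (q i) - j i))) x = (T ^^ (extra_visits K (d i) (\<theta> i) \<rho> (j i) (q i) x))
           (x + real K * d i * L / real (q i))"
      by (rule T_near_return[OF nr K(2,1)]) (rule that; assumption)
    then show "\<exists>\<rho>. (\<forall>U. 0 \<le> \<rho> U \<and> \<rho> U < 1) \<and> (\<forall>x. 0 \<le> x \<longrightarrow> x + real K * d i * L / real (q i) < D \<longrightarrow>
       (T ^^ (K * nat (int (q i) - j i))) x = (T ^^ (extra_visits K (d i) (\<theta> i) \<rho> (j i) (q i) x))
           (x + real K * d i * L / real (q i)))"
      by (intro exI[of _ \<rho>]) blast
  qed
  from choice[OF this] obtain \<rho> where \<rho>: "\<And>i U. 0 \<le> \<rho> i U \<and> \<rho> i U < 1"
    and ret: "\<And>i x. 0 \<le> x \<Longrightarrow> x + real K * d i * L / real (q i) < D \<Longrightarrow>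
       (T ^^ (K * nat (int (q i) - j i))) x = (T ^^ (extra_visits K (d i) (\<theta> i) (\<rho> i) (j i) (q i) x))
           (x + real K * d i * L / real (q i))" by blast
  define s where "s i = real K * d i * L / real (q i)" for i
  define U where "U i x = \<lfloor>real (q i) * x / L\<rfloor>" for i x
  define P where "P i x k \<longleftrightarrow> frac (real (q i) * x / L) \<in> visit_window K (d i) (\<theta> i) (\<rho> i) (j i) (U i x) k" for i x k
  define R where "R i x = \<rho> i (U i x + j i) - \<rho> i (U i x)" for i x
  define \<psi> where "\<psi> i k x = of_bool (P i x k) - (\<theta> i + (real K - 1 - 2 * real k + \<rho> i (U i x + j i) - \<rho> i (U i x)) * d i)" for i k x
  have \<psi>m[measurable]: "\<psi> i k \<in> borel_measurable borel" if "k < K" for i k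
    unfolding \<psi>_def[abs_def] P_def U_def by (rule window_mean_zero(1)[OF qpos[of i] d0[of i] K(2)[of i] that \<theta>[of i] \<rho>[of i], where j="j i"])
  have \<psi>1: "\<bar>\<psi> i k x\<bar> \<le> 1" if "k < K" for i k x
    unfolding \<psi>_def[abs_def] P_def U_def by (rule window_mean_zero(2)[OF qpos[of i] d0[of i] K(2)[of i] that \<theta>[of i] \<rho>[of i], where j="j i"])
  have \<psi>0: "(LBINT x:{of_int Y * (L / real (q i))..<of_int (Y + 1) * (L / real (q i))}. \<psi> i k x) = 0" if "k < K" for i k and Y :: int
    unfolding \<psi>_def[abs_def] P_def U_def by (rule window_mean_zero(3)[OF qpos[of i] d0[of i] K(2)[of i] that \<theta>[of i] \<rho>[of i], where j="j i"])
  have Um: "(\<lambda>x. g (U i x)) \<in> borel_measurable borel" for g :: "int \<Rightarrow> real" and i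
    unfolding U_def by (rule measurable_compose[where N="count_space UNIV"]) auto
  have Rm[measurable]: "R i \<in> borel_measurable borel" for i
    unfolding R_def[abs_def] by (rule Um)
  have R1: "\<bar>R i x\<bar> \<le> 1" for i x using \<rho>[of i "U i x + j i"] \<rho>[of i "U i x"] unfolding R_def by linarith
  have P_eq: "of_bool (P i x k) = \<psi> i k x + (\<theta> i + (real K - 1 - 2 * real k) * d i) + d i * R i x" for i x k
    unfolding \<psi>_def R_def by (simp add: algebra_simps)
  have Pm[measurable]: "(\<lambda>x. of_bool (P i x k) :: real) \<in> borel_measurable borel" if "k < K" for i k
    using \<psi>m[OF that] unfolding P_eq by measurable
  have fT[measurable]: "(\<lambda>x. f ((T ^^ k) x)) \<in> borel_measurable borel" for k
    using measurable_compose[OF measurable_T_funpow f] .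
  have fT1: "\<bar>f ((T ^^ k) x)\<bar> \<le> 1" if "x \<in> {0..<D}" for x k by (rule f1[OF T_funpow_mem[OF that]])
  define F where "F k x = indicator {0..<D} x * f ((T ^^ k) x)" for k x
  have Fint: "integrable lborel (F k)" for k
    unfolding F_def[abs_def] by (rule integrable_bounded_on_domain[OF fT fT1])
  define \<phi> where "\<phi> k x = indicator {0..<D} x * ((f ((T ^^ Suc k) x) - f ((T ^^ k) x)) * h x)" for k x
  have fTh1: "\<bar>f ((T ^^ k) x) * h x\<bar> \<le> 1" if "x \<in> {0..<D}" for x k
    using mult_mono[OF fT1[OF that, of k] h1[OF that]] by (simp add: abs_mult)
  have AI: "integrable lborel (\<lambda>x. indicator {0..<D} x * (f ((T ^^ k) x) * h x))" for k
    by (rule integrable_bounded_on_domain[of _ 1]) (use fTh1 fT in auto)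
  have \<phi>_eq: "\<phi> k x = indicator {0..<D} x * (f ((T ^^ Suc k) x) * h x) - indicator {0..<D} x * (f ((T ^^ k) x) * h x)" for k x
    by (simp add: \<phi>_def algebra_simps)
  have \<phi>int: "integrable lborel (\<phi> k)" for k
    unfolding \<phi>_eq[abs_def] using AI[of k] AI[of "Suc k"] by (intro Bochner_Integration.integrable_diff) auto
  have \<phi>A: "(LBINT x. \<phi> k x) = A (Suc k) - A k" for k
    unfolding \<phi>_eq[abs_def] A_def integ_def by (rule Bochner_Integration.integral_diff[OF AI AI])
  have \<phi>b: "integrable lborel (\<lambda>x. \<phi> k x * g x)" if "g \<in> borel_measurable borel" "\<And>x. \<bar>g x\<bar> \<le> 1" for g k
    by (rule Bochner_Integration.integrable_bound[OF \<phi>int[of k]]) (use that in \<open>auto simp: abs_mult \<phi>_def[abs_def] intro!: mult_left_le\<close>)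
  \<comment> \<open>The first term bounds the strip below D from which the translation leaves the
    domain. The sum runs over all k \<le> K because the exponent n varies with x.\<close>
  define G where "G i x = 2 * indicator {D - s i..<D} x + (\<Sum>k\<le>K. \<bar>F k (x + s i) - F k x\<bar>)" for i x
  have s0: "0 \<le> s i" for i using d0[of i] L_pos by (simp add: s_def)
  have invq: "(\<lambda>i. 1 / real (q i)) \<longlonglongrightarrow> 0"
    using tendsto_inverse_0_at_top[OF filterlim_compose[OF filterlim_real_sequentially q]] by (simp add: inverse_eq_divide)
  have s_lim: "s \<longlonglongrightarrow> 0"
  proof (rule tendsto_sandwich[OF _ _ tendsto_const])
    show "\<forall>\<^sub>F i in sequentially. s i \<le> L / 4 * (1 / real (q i))"
    proof (intro always_eventually allI)
      fix i
      have "(real K * d i) * (L / real (q i)) \<le> 1/4 * (L / real (q i))"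
        using K(2)[of i] L_pos by (intro mult_right_mono) auto
      then show "s i \<le> L / 4 * (1 / real (q i))" by (simp add: s_def)
    qed
    show "(\<lambda>i. L / 4 * (1 / real (q i))) \<longlonglongrightarrow> 0" by (rule tendsto_mult_right_zero[OF invq])
  qed (use s0 in simp)
  have Fsh: "integrable lborel (\<lambda>x. \<bar>F k (x + s i) - F k x\<bar>)" for k i
    using Fint[of k] lborel_integrable_real_affine[of "F k" 1 "s i"]
    by (intro integrable_abs Bochner_Integration.integrable_diff) (simp_all add: add.commute)
  have Gint: "integrable lborel (G i)" for i
    unfolding G_def[abs_def] using Fsh s0[of i] by (intro Bochner_Integration.integrable_add Bochner_Integration.integrable_sum) auto
  define g where "g i = (LBINT x. G i x)" for i
  have g_eq: "g i = 2 * s i + (\<Sum>k\<le>K. LBINT x. \<bar>F k (x + s i) - F k x\<bar>)" for i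
    unfolding g_def G_def using Fsh s0[of i]
    by (subst Bochner_Integration.integral_add) (auto simp: Bochner_Integration.integral_sum)
  have g_lim: "g \<longlonglongrightarrow> 0"
  proof -
    have "(\<lambda>i. 2 * s i + (\<Sum>k\<le>K. LBINT x. \<bar>F k (x + s i) - F k x\<bar>)) \<longlonglongrightarrow> 2 * 0 + (\<Sum>k\<le>K. 0)"
      by (intro tendsto_add tendsto_mult tendsto_const tendsto_sum s_lim L1_translation_tendsto_zero Fint)
    then show ?thesis unfolding g_eq[abs_def] by simp
  qed
  define S where "S i x = f x + (\<Sum>k<K. of_bool (P i x k) * (f ((T ^^ Suc k) x) - f ((T ^^ k) x)))" for i x
  have close: "\<bar>f ((T ^^ (K * nat (int (q i) - j i))) x) - S i x\<bar> \<le> G i x" if x: "x \<in> {0..<D}" for i x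
  proof -
    define n where "n = (\<Sum>k<K. of_bool (P i x k) :: nat)"
    have nK: "n \<le> K" using sum_bounded_above[of "{..<K}" "\<lambda>k. of_bool (P i x k)" "1::nat"] by (simp add: n_def)
    have "P i x (Suc k) \<Longrightarrow> P i x k" for k
      unfolding P_def by (rule visit_window_decreasing[OF d0])
    then have S: "S i x = f ((T ^^ n) x)"
      unfolding S_def n_def using sum_nested_increments[of "P i x" "\<lambda>k. f ((T ^^ k) x)" K] by simp
    have term0: "0 \<le> \<bar>F k (x + s i) - F k x\<bar>" for k by simp
    show ?thesis
    proof (cases "x + s i < D")
      case True
      have "f ((T ^^ (K * nat (int (q i) - j i))) x) = F n (x + s i)"
        using ret[of x i] True x s0[of i] by (simp add: F_def s_def n_def P_def U_def)
      moreover have "S i x = F n x" using S x by (simp add: F_def)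
      moreover have "\<bar>F n (x + s i) - F n x\<bar> \<le> (\<Sum>k\<le>K. \<bar>F k (x + s i) - F k x\<bar>)"
        using nK by (intro member_le_sum) auto
      ultimately show ?thesis unfolding G_def by (simp add: add_increasing)
    next
      case False
      have "\<bar>f ((T ^^ (K * nat (int (q i) - j i))) x) - S i x\<bar> \<le> 2"
        using fT1[OF x, of "K * nat (int (q i) - j i)"] fT1[OF x, of n] S by linarith
      moreover have "2 \<le> G i x" unfolding G_def using False x by (simp add: sum_nonneg)
      ultimately show ?thesis by linarith
    qed
  qed
  have Sm[measurable]: "S i \<in> borel_measurable borel" for i
    unfolding S_def[abs_def] by (intro borel_measurable_add f borel_measurable_sum borel_measurable_times borel_measurable_diff fT Pm) auto
  have Sh: "indicator {0..<D} x * (S i x * h x) = indicator {0..<D} x * (f ((T ^^ 0) x) * h x) + (\<Sum>k<K. \<phi> k x * of_bool (P i x k))" for i x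
    unfolding S_def \<phi>_def
    by (simp add: distrib_right distrib_left sum_distrib_left sum_distrib_right mult_ac del: sum_mult_of_bool_eq sum_of_bool_mult_eq)
  have ShI: "integrable lborel (\<lambda>x. indicator {0..<D} x * (S i x * h x))" for i
    unfolding Sh by (intro Bochner_Integration.integrable_add AI Bochner_Integration.integrable_sum \<phi>b Pm) auto
  have part1: "\<bar>A (K * nat (int (q i) - j i)) - (LBINT x. indicator {0..<D} x * (S i x * h x))\<bar> \<le> g i" for i
  proof -
    let ?M = "K * nat (int (q i) - j i)"
    have eq: "A ?M - (LBINT x. indicator {0..<D} x * (S i x * h x))
      = (LBINT x. indicator {0..<D} x * (f ((T ^^ ?M) x) * h x) - indicator {0..<D} x * (S i x * h x))"
      unfolding A_def integ_def by (rule Bochner_Integration.integral_diff[OF AI ShI, symmetric])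
    have "\<bar>LBINT x. indicator {0..<D} x * (f ((T ^^ ?M) x) * h x) - indicator {0..<D} x * (S i x * h x)\<bar> \<le> (LBINT x. \<bar>indicator {0..<D} x * (f ((T ^^ ?M) x) * h x) - indicator {0..<D} x * (S i x * h x)\<bar>)"
      by (rule integral_abs_bound)
    also have "\<dots> \<le> (LBINT x. G i x)"
    proof (rule integral_mono)
      show "integrable lborel (\<lambda>x. \<bar>indicator {0..<D} x * (f ((T ^^ ?M) x) * h x) - indicator {0..<D} x * (S i x * h x)\<bar>)"
        by (rule integrable_abs[OF Bochner_Integration.integrable_diff[OF AI[of ?M] ShI[of i]]])
      show "integrable lborel (\<lambda>x. G i x)" by (rule Gint)
      fix x
      show "\<bar>indicator {0..<D} x * (f ((T ^^ ?M) x) * h x) - indicator {0..<D} x * (S i x * h x)\<bar> \<le> G i x"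
      proof (cases "x \<in> {0..<D}")
        case True
        have "\<bar>f ((T ^^ ?M) x) * h x - S i x * h x\<bar> = \<bar>f ((T ^^ ?M) x) - S i x\<bar> * \<bar>h x\<bar>"
          by (simp flip: abs_mult left_diff_distrib)
        also have "\<dots> \<le> G i x * 1" using close[OF True, of i] h1[OF True] by (intro mult_mono) auto
        finally show ?thesis using True by simp
      next
        case False
        then show ?thesis by (simp add: G_def sum_nonneg)
      qed
    qed
    finally show ?thesis unfolding g_def eq .
  qed
  have part2: "(LBINT x. indicator {0..<D} x * (S i x * h x))
      = A 0 + (\<Sum>k<K. (\<theta> i + (real K - 1 - 2 * real k) * d i) * (A (Suc k) - A k)) + (\<Sum>k<K. LBINT x. \<phi> k x * \<psi> i k x)
        + d i * (LBINT x. (\<Sum>k<K. \<phi> k x) * R i x)" for i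
  proof -
    have I: "integrable lborel (\<lambda>x. \<phi> k x * of_bool (P i x k))" if "k \<in> {..<K}" for k
      using that by (intro \<phi>b Pm) auto
    have e1: "(LBINT x. indicator {0..<D} x * (f ((T ^^ 0) x) * h x) + (\<Sum>k<K. \<phi> k x * of_bool (P i x k)))
       = (LBINT x. indicator {0..<D} x * (f ((T ^^ 0) x) * h x)) + (LBINT x. (\<Sum>k<K. \<phi> k x * of_bool (P i x k)))"
      by (rule Bochner_Integration.integral_add[OF AI], rule Bochner_Integration.integrable_sum, rule I)
    have e2: "(LBINT x. (\<Sum>k<K. \<phi> k x * of_bool (P i x k))) = (\<Sum>k<K. LBINT x. \<phi> k x * of_bool (P i x k))"
      by (rule Bochner_Integration.integral_sum, rule I)
    have "(LBINT x. indicator {0..<D} x * (S i x * h x)) = A 0 + (\<Sum>k<K. LBINT x. \<phi> k x * of_bool (P i x k))"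
      unfolding Sh e1 e2 A_def integ_def ..
    also have "(\<Sum>k<K. LBINT x. \<phi> k x * of_bool (P i x k))
      = (\<Sum>k<K. (LBINT x. \<phi> k x * \<psi> i k x) + (\<theta> i + (real K - 1 - 2 * real k) * d i) * (A (Suc k) - A k) + d i * (LBINT x. \<phi> k x * R i x))"
    proof (intro sum.cong refl)
      fix k assume "k \<in> {..<K}"
      then have k: "k < K" by simp
      have "(LBINT x. \<phi> k x * of_bool (P i x k)) = (LBINT x. \<phi> k x * \<psi> i k x + (\<theta> i + (real K - 1 - 2 * real k) * d i) * \<phi> k x + d i * (\<phi> k x * R i x))"
        by (intro Bochner_Integration.integral_cong refl) (simp only: P_eq distrib_left mult_ac)
      also have "\<dots> = (LBINT x. \<phi> k x * \<psi> i k x) + (\<theta> i + (real K - 1 - 2 * real k) * d i) * (LBINT x. \<phi> k x) + d i * (LBINT x. \<phi> k x * R i x)"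
        using \<phi>b[OF \<psi>m[OF k] \<psi>1[OF k]] \<phi>b[OF Rm R1] \<phi>int[of k] by simp
      finally show "(LBINT x. \<phi> k x * of_bool (P i x k)) = (LBINT x. \<phi> k x * \<psi> i k x) + (\<theta> i + (real K - 1 - 2 * real k) * d i) * (A (Suc k) - A k) + d i * (LBINT x. \<phi> k x * R i x)"
        unfolding \<phi>A .
    qed
    finally have main: "(LBINT x. indicator {0..<D} x * (S i x * h x)) = A 0 + (\<Sum>k<K. (LBINT x. \<phi> k x * \<psi> i k x) + (\<theta> i + (real K - 1 - 2 * real k) * d i) * (A (Suc k) - A k) + d i * (LBINT x. \<phi> k x * R i x))" .
    have "(LBINT x. (\<Sum>k<K. \<phi> k x) * R i x) = (\<Sum>k<K. LBINT x. \<phi> k x * R i x)"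
      unfolding sum_distrib_right using \<phi>b[OF Rm R1] by (intro Bochner_Integration.integral_sum) auto
    then show ?thesis unfolding main by (simp add: sum.distrib sum_distrib_left)
  qed
  \<comment> \<open>Since \<open>R\<close> does not involve k, the increments telescope to f (T^K x)
    - f x. The bound is therefore the same for every K, on which the later limit of large exponents
    relies.\<close>
  have part3: "\<bar>LBINT x. (\<Sum>k<K. \<phi> k x) * R i x\<bar> \<le> 2 * D" for i
  proof -
    have "(\<Sum>k<K. \<phi> k x) = indicator {0..<D} x * ((f ((T ^^ K) x) - f x) * h x)" for x
      unfolding \<phi>_def sum_distrib_left[symmetric] sum_distrib_right[symmetric]
      using sum_lessThan_telescope[of "\<lambda>k. f ((T ^^ k) x)" K] by simp
    then have eq: "(LBINT x. (\<Sum>k<K. \<phi> k x) * R i x) = integ (\<lambda>x. (f ((T ^^ K) x) - f x) * h x * R i x)"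
      unfolding integ_def by (simp add: mult.assoc)
    have "\<bar>integ (\<lambda>x. (f ((T ^^ K) x) - f x) * h x * R i x)\<bar> \<le> 2 * D"
    proof (rule abs_integ_le)
      show "(\<lambda>x. (f ((T ^^ K) x) - f x) * h x * R i x) \<in> borel_measurable borel"
        by (intro borel_measurable_times borel_measurable_diff fT f h Rm)
      fix x assume x: "x \<in> {0..<D}"
      have "\<bar>f ((T ^^ K) x) - f x\<bar> \<le> 2" using fT1[OF x, of K] f1[OF x] by linarith
      then have "\<bar>f ((T ^^ K) x) - f x\<bar> * \<bar>h x\<bar> * \<bar>R i x\<bar> \<le> 2 * 1 * 1"
        using h1[OF x] R1[of i x] by (intro mult_mono) auto
      then show "\<bar>(f ((T ^^ K) x) - f x) * h x * R i x\<bar> \<le> 2" by (simp add: abs_mult)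
    qed
    then show ?thesis unfolding eq .
  qed
  define e where "e i = g i + (\<Sum>k<K. \<bar>LBINT x. \<phi> k x * \<psi> i k x\<bar>)" for i
  have wlim: "(\<lambda>i. L / real (q i)) \<longlonglongrightarrow> 0" using tendsto_mult_right_zero[OF invq, of L] by simp
  have "e \<longlonglongrightarrow> 0 + (\<Sum>k<K. 0)"
    unfolding e_def[abs_def]
  proof (intro tendsto_add g_lim tendsto_sum tendsto_rabs_zero)
    fix k assume "k \<in> {..<K}"
    then have k: "k < K" by simp
    show "(\<lambda>i. LBINT x. \<phi> k x * \<psi> i k x) \<longlonglongrightarrow> 0"
      using L_pos qpos by (intro integral_mean_zero_cells_tendsto_zero[where w="\<lambda>i. L / real (q i)"] \<phi>int wlim \<psi>m[OF k] \<psi>1[OF k] \<psi>0[OF k]) simp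
  qed
  then have e: "e \<longlonglongrightarrow> 0" by simp
  have "\<bar>A (K * nat (int (q i) - j i)) - (A 0 + (\<Sum>k<K. (\<theta> i + (real K - 1 - 2 * real k) * d i) * (A (Suc k) - A k)))\<bar> \<le> 2 * D * d i + e i" for i
  proof -
    have "\<bar>\<Sum>k<K. LBINT x. \<phi> k x * \<psi> i k x\<bar> \<le> (\<Sum>k<K. \<bar>LBINT x. \<phi> k x * \<psi> i k x\<bar>)" by (rule sum_abs)
    moreover have "\<bar>d i * (LBINT x. (\<Sum>k<K. \<phi> k x) * R i x)\<bar> \<le> 2 * D * d i"
      using mult_left_mono[OF part3[of i] d0[of i]] d0[of i] by (simp add: abs_mult mult_ac)
    ultimately show ?thesis using part1[of i] part2[of i] unfolding e_def by linarith
  qed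
  then show thesis using that e by blast
qed

end

section \<open>Comparison of second order terms\<close>

text \<open>Twice the difference between the trapezoidal rule on 0, ..., K with unit steps and the
  one with a single step. It vanishes for affine \<open>A\<close>.\<close>

definition boundary_sum :: "nat \<Rightarrow> (nat \<Rightarrow> real) \<Rightarrow> real" where
  "boundary_sum K A = 2 * (\<Sum>l\<le>K. A l) - (real K + 1) * (A 0 + A K)"

lemma sum_increments_boundary_sum:
  "A 0 + (\<Sum>k<K. (\<theta> + (real K - 1 - 2 * real k) * d) * (A (Suc k) - A k)) = (1 - \<theta>) * A 0 + \<theta> * A K + d * boundary_sum K A"
proof -
  \<comment> \<open>Summation by parts. The weight M is decoupled from the range J, for otherwise
    all summands would change in the induction step.\<close>
  have "(\<Sum>k<J. (M - 2 * real k) * (A (Suc k) - A k)) = 2 * (\<Sum>l\<le>J. A l) - (M + 2) * A 0 - (2 * real J - M) * A J" for M J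
    by (induction J) (simp_all add: algebra_simps)
  from this[of "real K - 1" K] have "(\<Sum>k<K. (real K - 1 - 2 * real k) * (A (Suc k) - A k)) = boundary_sum K A"
    by (simp add: boundary_sum_def algebra_simps)
  moreover have "(\<Sum>k<K. (\<theta> + (real K - 1 - 2 * real k) * d) * (A (Suc k) - A k))
     = (\<Sum>k<K. \<theta> * (A (Suc k) - A k) + d * ((real K - 1 - 2 * real k) * (A (Suc k) - A k)))"
    by (intro sum.cong refl) (simp add: algebra_simps)
  moreover have "\<dots> = \<theta> * (\<Sum>k<K. A (Suc k) - A k) + d * (\<Sum>k<K. (real K - 1 - 2 * real k) * (A (Suc k) - A k))"
    by (simp only: sum.distrib sum_distrib_left)
  ultimately show ?thesis
    using sum_lessThan_telescope[of A K] by (simp add: algebra_simps)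
qed

text \<open>2 B_i = (B_i + B_{i+s}) - (B_{i+s} + B_{i+2s}) + (B_i + B_{i+2s}) is O(1/s) for every s.
  The third pair rules out alternating signs.\<close>

lemma eq_zero_if_pair_sums_small:
  fixes B :: "nat \<Rightarrow> real"
  assumes "\<And>i s. 0 < s \<Longrightarrow> real s * \<bar>B i + B (i + s)\<bar> \<le> C"
  shows "B i = 0"
proof -
  have "real s * \<bar>B i\<bar> \<le> 2 * C" if "0 < s" for s
  proof -
    have "real s * \<bar>B i + B (i + s)\<bar> \<le> C" "real s * \<bar>B (i + s) + B (i + s + s)\<bar> \<le> C" "real (2 * s) * \<bar>B i + B (i + 2 * s)\<bar> \<le> C"
      using assms[of s i] assms[of s "i + s"] assms[of "2 * s" i] that by auto
    moreover have "real s * \<bar>2 * B i\<bar> \<le> real s * (\<bar>B i + B (i + s)\<bar> + \<bar>B (i + s) + B (i + s + s)\<bar> + \<bar>B i + B (i + 2 * s)\<bar>)"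
    proof (rule mult_left_mono)
      have "i + s + s = i + 2 * s" by simp
      then show "\<bar>2 * B i\<bar> \<le> \<bar>B i + B (i + s)\<bar> + \<bar>B (i + s) + B (i + s + s)\<bar> + \<bar>B i + B (i + 2 * s)\<bar>"
        by (simp only:)
    qed simp
    moreover have "real (2 * s) * \<bar>B i + B (i + 2 * s)\<bar> = 2 * (real s * \<bar>B i + B (i + 2 * s)\<bar>)" by simp
    moreover have "0 \<le> real s * \<bar>B i + B (i + 2 * s)\<bar>" by simp
    moreover have "real s * \<bar>2 * B i\<bar> = 2 * (real s * \<bar>B i\<bar>)" by (simp add: abs_mult)
    ultimately show ?thesis unfolding distrib_left by linarith
  qed
  then have le: "real s * \<bar>B i\<bar> \<le> 2 * C" if "0 < s" for s using that by blast
  show ?thesis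
  proof (rule ccontr)
    assume "B i \<noteq> 0"
    then obtain s :: nat where "2 * C < real s * \<bar>B i\<bar>" using reals_Archimedean3[of "\<bar>B i\<bar>"] by auto
    moreover from this have "2 * C < real (Suc s) * \<bar>B i\<bar>" by (simp add: distrib_right)
    ultimately show False using le[of "Suc s"] by linarith
  qed
qed

text \<open>A unit shift of the range exchanges one term for another, whatever the length K.\<close>

lemma sum_shift_diff_le:
  fixes A :: "nat \<Rightarrow> real"
  assumes "\<And>l. \<bar>A l\<bar> \<le> M"
  shows "\<bar>(\<Sum>l\<le>K. A l) - (\<Sum>l\<le>K. A (l + n))\<bar> \<le> 2 * real n * M"
proof (induction n)
  case (Suc n)
  have "(\<Sum>l\<le>K. A (l + n)) - (\<Sum>l\<le>K. A (l + Suc n)) = A n - A (Suc K + n)"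
    by (induction K) auto
  then have "\<bar>(\<Sum>l\<le>K. A (l + n)) - (\<Sum>l\<le>K. A (l + Suc n))\<bar> \<le> 2 * M"
    using assms[of n] assms[of "Suc K + n"] by linarith
  then show ?case using Suc by (simp add: algebra_simps) 
qed simp

context three_interval
begin

lemma good_pair_near_returns:
  assumes "good_pair \<alpha> \<beta>" "0 < K"
  obtains q p j d \<theta> \<delta> where "\<And>i. near_return (q i) (p i) (j i) (d i) (\<theta> i)" "filterlim q at_top sequentially"
    "\<And>i::nat. real K * d i \<le> 1/4" "0 < \<delta>" "\<And>i. \<delta> \<le> d i"
proof -
  \<comment> \<open>At least 100, as \<open>good_pair\<close> demands, and at least 4 K, so that K d
    \<le> K / k \<le> 1/4. The lower end of the band serves as \<delta>.\<close>
  define k where "k = 100 + 4 * K"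
  have k: "100 \<le> k" "0 < real k" "real K * (1 / real k) \<le> 1/4" by (simp_all add: k_def field_simps)
  have "\<forall>i::nat. \<exists>q p j. i \<le> q \<and> 0 < q \<and> coprime p (int q) \<and>
     real q * (real q * \<alpha> - of_int p) \<in> {1 / (2 * real k)..1 / real k} \<and> real q * \<beta> - of_int j \<in> {1/4..3/4}"
    using assms(1) k(1) unfolding good_pair_def by meson
  then obtain q p j where qpj: "\<And>i. i \<le> q i" "\<And>i. 0 < q i" "\<And>i. coprime (p i) (int (q i))"
     "\<And>i. real (q i) * (real (q i) * \<alpha> - of_int (p i)) \<in> {1 / (2 * real k)..1 / real k}" "\<And>i. real (q i) * \<beta> - of_int (j i) \<in> {1/4..3/4}"
    by metis
  define d where "d i = real (q i) * (real (q i) * \<alpha> - of_int (p i))" for i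
  have d: "1 / (2 * real k) \<le> d i" "d i \<le> 1 / real k" for i using qpj(4)[of i] by (auto simp: d_def)
  have d0: "0 \<le> d i" for i using d(1)[of i] by (rule order_trans[rotated]) simp
  show thesis
  proof
    show "near_return (q i) (p i) (j i) (d i) (real (q i) * \<beta> - of_int (j i))" for i
      using qpj[of i] d0[of i] unfolding near_return_def by (auto simp: d_def)
    show "filterlim q at_top sequentially" using qpj(1) by (rule filterlim_at_top_mono[OF filterlim_ident always_eventually[OF allI]])
    show "real K * d i \<le> 1/4" for i using mult_left_mono[OF d(2)[of i], of "real K"] k(3) by linarith
    show "0 < 1 / (2 * real k)" using k by simp
    show "1 / (2 * real k) \<le> d i" for i by (rule d)
  qed
qed

definition corr :: "(real \<Rightarrow> real) \<Rightarrow> (real \<Rightarrow> real) \<Rightarrow> nat \<Rightarrow> real" where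
  "corr f h k = integ (\<lambda>x. f ((T ^^ k) x) * h x)"

text \<open>Values outside [0, D) do not enter \<open>integ\<close>, and the bound 1 turns all
  constants into multiples of D.\<close>

definition test_fun :: "(real \<Rightarrow> real) \<Rightarrow> bool" where
  "test_fun f \<longleftrightarrow> f \<in> borel_measurable borel \<and> (\<forall>x\<in>{0..<D}. \<bar>f x\<bar> \<le> 1)"

lemma test_fun_T_funpow: "test_fun f \<Longrightarrow> test_fun (\<lambda>x. f ((T ^^ k) x))"
  unfolding test_fun_def by (intro conjI ballI measurable_compose[OF measurable_T_funpow]) (simp, blast dest: T_funpow_mem)

lemma corr_shift: "corr (\<lambda>x. f ((T ^^ i) x)) h k = corr f h (k + i)"
  unfolding corr_def add.commute[of k i] funpow_add comp_apply ..

lemma abs_corr_le: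
  assumes "test_fun f" "test_fun h"
  shows "\<bar>corr f h k\<bar> \<le> D"
proof -
  have f: "test_fun (\<lambda>x. f ((T ^^ k) x))" by (rule test_fun_T_funpow[OF assms(1)])
  have "\<bar>corr f h k\<bar> \<le> 1 * D"
    unfolding corr_def
  proof (rule abs_integ_le)
    show "(\<lambda>x. f ((T ^^ k) x) * h x) \<in> borel_measurable borel"
      using f assms(2) by (auto simp: test_fun_def)
    show "\<bar>f ((T ^^ k) x) * h x\<bar> \<le> 1" if "x \<in> {0..<D}" for x
      using f assms(2) that unfolding test_fun_def abs_mult by (metis abs_ge_zero mult_le_one)
  qed
  then show ?thesis by simp
qed

lemma corr_near_return':
  assumes f: "test_fun f" and h: "test_fun h" and K: "0 < K" "\<And>i. real K * d i \<le> 1/4"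
    and nr: "\<And>i. near_return (q i) (p i) (j i) (d i) (\<theta> i)" and q: "filterlim q at_top sequentially"
  obtains e where "e \<longlonglongrightarrow> 0" 
    "\<And>i. \<bar>corr f h (K * nat (int (q i) - j i)) - ((1 - \<theta> i) * corr f h 0 + \<theta> i * corr f h K + d i * boundary_sum K (corr f h))\<bar> \<le> 2 * D * d i + e i"
proof -
  have bounds: "f \<in> borel_measurable borel" "\<And>x. x \<in> {0..<D} \<Longrightarrow> \<bar>f x\<bar> \<le> 1" "h \<in> borel_measurable borel" "\<And>x. x \<in> {0..<D} \<Longrightarrow> \<bar>h x\<bar> \<le> 1"
    using f h by (auto simp: test_fun_def)
  obtain e where e: "e \<longlonglongrightarrow> 0"
    "\<And>i. \<bar>corr f h (K * nat (int (q i) - j i)) - (corr f h 0 + (\<Sum>k<K. (\<theta> i + (real K - 1 - 2 * real k) * d i) * (corr f h (Suc k) - corr f h k)))\<bar> \<le> 2 * D * d i + e i"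
    by (rule corr_near_return[where f=f and h=h and q=q and p=p and j=j and d=d and \<theta>=\<theta> and K=K, folded corr_def])
      (erule bounds | rule bounds K nr q | rule that; assumption)+
  show thesis using that[OF e(1)] e(2) unfolding sum_increments_boundary_sum by blast
qed

text \<open>Division by \<open>d\<close>, which stays above \<delta>, leaves an error that still
  tends to 0. This extracts the coefficient of \<open>d\<close> from an expansion.\<close>

lemma le_if_approx:
  fixes e :: "nat \<Rightarrow> real"
  assumes "e \<longlonglongrightarrow> 0" "0 < \<delta>" "\<And>i. \<delta> \<le> d i" "\<And>i. d i * x \<le> M * d i + e i"
  shows "x \<le> M"
proof -
  have "x - M \<le> \<bar>e i\<bar> / \<delta>" for i
  proof -
    have "d i * (x - M) \<le> e i" using assms(4)[of i] by (simp add: algebra_simps)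
    then have "x - M \<le> e i / d i" using assms(2) assms(3)[of i] by (simp add: pos_le_divide_eq mult.commute)
    also have "\<dots> \<le> \<bar>e i\<bar> / d i" using assms(2) assms(3)[of i] by (intro divide_right_mono) auto
    also have "\<dots> \<le> \<bar>e i\<bar> / \<delta>" using assms(2) assms(3)[of i] by (intro divide_left_mono) auto
    finally show ?thesis .
  qed
  moreover have "(\<lambda>i. \<bar>e i\<bar> / \<delta>) \<longlonglongrightarrow> 0 / \<delta>"
    using assms(1,2) by (intro tendsto_divide tendsto_rabs_zero tendsto_const) auto
  ultimately have "x - M \<le> 0 / \<delta>" by (intro LIMSEQ_le_const) auto
  then show ?thesis by simp
qed

text \<open>Comparing the same correlation through \<open>T ^ (s n N)\<close> and through \<open>T ^ (s m N)\<close>, where the main terms cancel.\<close>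

lemma boundary_sums_close:
  assumes good: "good_pair \<alpha> \<beta>" and nm: "0 < n" "n < m" and s: "0 < s"
    and tf: "test_fun f" "test_fun h" "test_fun g" "test_fun k"
    and coupled: "\<And>j. corr f h (n * j) = corr k g (m * j)"
  shows "\<bar>boundary_sum (s * n) (corr f h) - boundary_sum (s * m) (corr k g)\<bar> \<le> 4 * D"
proof -
  have sm: "0 < s * m" "0 < s * n" using s nm by auto
  \<comment> \<open>Times chosen for the larger exponent s m also serve s n, so both expansions
    share q, j, d and \<theta>, and their main terms cancel.\<close>
  obtain q p j d \<theta> \<delta> where nr: "\<And>i. near_return (q i) (p i) (j i) (d i) (\<theta> i)" "filterlim q at_top sequentially"
    and K: "\<And>i::nat. real (s * m) * d i \<le> 1/4" and \<delta>: "0 < \<delta>" "\<And>i. \<delta> \<le> d i"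
    by (rule good_pair_near_returns[OF good sm(1)]) (rule that; assumption)
  have d0: "0 < d i" for i using \<delta>(1) \<delta>(2)[of i] by linarith
  have K': "real (s * n) * d i \<le> 1/4" for i
  proof -
    have "s * n \<le> s * m" using nm by simp
    then have "real (s * n) * d i \<le> real (s * m) * d i" using d0[of i] by (intro mult_right_mono) (auto simp del: of_nat_mult)
    then show ?thesis using K[of i] by linarith
  qed
  obtain e1 where e1: "e1 \<longlonglongrightarrow> 0"
    "\<And>i. \<bar>corr f h (s * n * nat (int (q i) - j i)) - ((1 - \<theta> i) * corr f h 0 + \<theta> i * corr f h (s * n) + d i * boundary_sum (s * n) (corr f h))\<bar> \<le> 2 * D * d i + e1 i"
    using corr_near_return'[OF tf(1,2) sm(2) K' nr] by metis
  obtain e2 where e2: "e2 \<longlonglongrightarrow> 0"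
    "\<And>i. \<bar>corr k g (s * m * nat (int (q i) - j i)) - ((1 - \<theta> i) * corr k g 0 + \<theta> i * corr k g (s * m) + d i * boundary_sum (s * m) (corr k g))\<bar> \<le> 2 * D * d i + e2 i"
    using corr_near_return'[OF tf(4,3) sm(1) K nr] by metis
  have c: "corr f h (s * n * N) = corr k g (s * m * N)" for N
    using coupled[of "s * N"] by (simp add: mult_ac)
  have c0: "corr f h 0 = corr k g 0" and cs: "corr f h (s * n) = corr k g (s * m)"
    using c[of 0] c[of 1] by simp_all
  have le: "d i * \<bar>boundary_sum (s * n) (corr f h) - boundary_sum (s * m) (corr k g)\<bar> \<le> 4 * D * d i + (e1 i + e2 i)" for i
  proof -
    have "d i * \<bar>boundary_sum (s * n) (corr f h) - boundary_sum (s * m) (corr k g)\<bar>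
      = \<bar>d i * boundary_sum (s * n) (corr f h) - d i * boundary_sum (s * m) (corr k g)\<bar>"
      using d0[of i] by (simp add: abs_mult flip: right_diff_distrib)
    then show ?thesis using e1(2)[of i] e2(2)[of i] unfolding c c0 cs by linarith
  qed
  have "(\<lambda>i. e1 i + e2 i) \<longlonglongrightarrow> 0" using tendsto_add[OF e1(1) e2(1)] by simp
  from le_if_approx[OF this \<delta> le] show ?thesis .
qed

text \<open>Compare boundary sums for base point i and for i + 1. The long sums are shifted by n or
  m places and change boundedly, whereas the end terms carry the factors s n + 1 and s m + 1, whose
  difference s (m - n) grows. So the differences \<open>B\<close> have pair sums O(1/s).\<close>

lemma corr_coupled_invariant:
  assumes good: "good_pair \<alpha> \<beta>" and nm: "0 < n" "n < m"
    and tf: "test_fun f" "test_fun h" "test_fun g" "test_fun k"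
    and coupled: "\<And>j. corr f h (n * j) = corr k g (m * j)"
  shows "corr f h n = corr f h 0"
proof -
  define B where "B i = corr f h (n * i) - corr f h (n * Suc i)" for i
  \<comment> \<open>Two comparisons at 4 D each, and twice the shift errors 2 n D and 2 m D of the
    long sums.\<close>
  define M where "M = 8 * D + 4 * real n * D + 4 * real m * D"
  have "real s * \<bar>B i + B (i + s)\<bar> \<le> M" if s: "0 < s" for i s
  proof -
    define f' k' where "f' i = (\<lambda>x. f ((T ^^ (n * i)) x))" and "k' i = (\<lambda>x. k ((T ^^ (m * i)) x))" for i
    have tf': "test_fun (f' i)" "test_fun (k' i)" for i unfolding f'_def k'_def using tf by (intro test_fun_T_funpow; simp)+
    have coupled': "corr (f' i) h (n * j) = corr (k' i) g (m * j)" for i j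
      unfolding f'_def k'_def corr_shift using coupled[of "j + i"] by (simp add: distrib_left)
    have close: "\<bar>boundary_sum (s * n) (corr (f' i) h) - boundary_sum (s * m) (corr (k' i) g)\<bar> \<le> 4 * D" for i
      by (rule boundary_sums_close[OF good nm s tf'(1) tf(2,3) tf'(2) coupled'])
    have bs: "boundary_sum (s * n) (corr (f' i) h) - boundary_sum (s * m) (corr (k' i) g)
        = 2 * (\<Sum>l\<le>s * n. corr f h (l + n * i)) - 2 * (\<Sum>l\<le>s * m. corr k g (l + m * i)) + real s * (real m - real n) * (corr f h (n * i) + corr f h (n * (i + s)))" for i
    proof -
      have e: "corr k g (m * i) = corr f h (n * i)" "corr k g (s * m + m * i) = corr f h (n * (i + s))" "s * n + n * i = n * (i + s)"
        using coupled[of i] coupled[of "i + s"] by (simp_all add: distrib_left mult.commute add.commute)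
      show ?thesis unfolding boundary_sum_def f'_def k'_def corr_shift add_0 e by (simp add: algebra_simps)
    qed
    have sh: "\<bar>(\<Sum>l\<le>K. corr u v (l + r * i)) - (\<Sum>l\<le>K. corr u v (l + r * Suc i))\<bar> \<le> 2 * real r * D" if "test_fun u" "test_fun v" for u v K r
      using sum_shift_diff_le[of "\<lambda>l. corr u v (l + r * i)" D K r] abs_corr_le[OF that] by (simp add: algebra_simps)
    have eq: "real s * (real m - real n) * (B i + B (i + s))
      = real s * (real m - real n) * (corr f h (n * i) + corr f h (n * (i + s))) - real s * (real m - real n) * (corr f h (n * Suc i) + corr f h (n * (Suc i + s)))"
      by (simp add: B_def algebra_simps)
    have abs4: "\<bar>X - Y\<bar> \<le> M" if "\<bar>2 * a1 - 2 * b1 + X\<bar> \<le> 4 * D" "\<bar>2 * a2 - 2 * b2 + Y\<bar> \<le> 4 * D"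
      "\<bar>a1 - a2\<bar> \<le> 2 * real n * D" "\<bar>b1 - b2\<bar> \<le> 2 * real m * D" for X Y a1 a2 b1 b2 :: real
      using that unfolding M_def by linarith
    have "\<bar>real s * (real m - real n) * (B i + B (i + s))\<bar> \<le> M"
      unfolding eq by (rule abs4[OF close[of i, unfolded bs] close[of "Suc i", unfolded bs] sh[OF tf(1,2)] sh[OF tf(4,3)]])
    then have "real s * ((real m - real n) * \<bar>B i + B (i + s)\<bar>) \<le> M" using nm by (simp add: abs_mult mult.assoc)
    moreover have "real s * (1 * \<bar>B i + B (i + s)\<bar>) \<le> real s * ((real m - real n) * \<bar>B i + B (i + s)\<bar>)"
      using nm by (intro mult_left_mono mult_right_mono) auto
    ultimately show ?thesis by simp
  qed
  then have "B 0 = 0" by (rule eq_zero_if_pair_sums_small)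
  then show ?thesis by (simp add: B_def)
qed

section \<open>Periodic correlations\<close>

lemma sum_periodic:
  fixes A :: "nat \<Rightarrow> real"
  assumes per: "\<And>i. A (i + n) = A i"
  shows "(\<Sum>l<r * n. A l) = real r * (\<Sum>l<n. A l)" "A (r * n) = A 0"
proof -
  have per2: "A (r * n + l) = A l" for r l
  proof (induction r)
    case (Suc r)
    have "Suc r * n + l = (r * n + l) + n" by simp
    then show ?case using per[of "r * n + l"] Suc by (simp only:)
  qed simp
  from per2[of r 0] show "A (r * n) = A 0" by simp
  have "(\<Sum>l<r * n. A l) = (\<Sum>i<r. \<Sum>l = i * n..<i * n + n. A l)" by (rule sum.nat_group[symmetric])
  also have "\<dots> = (\<Sum>i<r. \<Sum>l<n. A (i * n + l))"
  proof (rule sum.cong[OF refl])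
    show "(\<Sum>l = i * n..<i * n + n. A l) = (\<Sum>l<n. A (i * n + l))" for i
      using sum.shift_bounds_nat_ivl[of A 0 "i * n" n] by (simp add: add.commute atLeast0LessThan)
  qed
  finally show "(\<Sum>l<r * n. A l) = real r * (\<Sum>l<n. A l)" by (simp add: per2)
qed

text \<open>For an n-periodic correlation the main terms reduce to A_0 and cancel, and the boundary
  sum over s periods is 2 s times the difference in question, while the error bound does not grow
  with s.\<close>

lemma corr_periodic_mean_bound:
  assumes good: "good_pair \<alpha> \<beta>" and n: "0 < n" and s: "0 < s"
    and tf: "test_fun f" "test_fun h" and per: "\<And>i. corr f h (i + n) = corr f h i"
  shows "real s * \<bar>(\<Sum>l<n. corr f h l) - real n * corr f h 0\<bar> \<le> D"
proof -
  define x where "x = (\<Sum>l<n. corr f h l) - real n * corr f h 0"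
  have sn: "0 < s * n" using s n by simp
  note sum = sum_periodic(1)[where A="corr f h", OF per] and mult = sum_periodic(2)[where A="corr f h", OF per]
  have last: "(\<Sum>l\<le>s * n. corr f h l) = (\<Sum>l<s * n. corr f h l) + corr f h (s * n)"
    using sum.lessThan_Suc[of "corr f h" "s * n"] lessThan_Suc_atMost[of "s * n"] by metis
  have bs: "boundary_sum (s * n) (corr f h) = 2 * real s * x"
    unfolding boundary_sum_def last sum[of s] mult[of s] x_def by (simp add: algebra_simps)
  obtain q p j d \<theta> \<delta> where nr: "\<And>i. near_return (q i) (p i) (j i) (d i) (\<theta> i)" "filterlim q at_top sequentially"
    and K: "\<And>i::nat. real (s * n) * d i \<le> 1/4" and \<delta>: "0 < \<delta>" "\<And>i. \<delta> \<le> d i"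
    by (rule good_pair_near_returns[OF good sn]) (rule that; assumption)
  obtain e where e: "e \<longlonglongrightarrow> 0"
    "\<And>i. \<bar>corr f h (s * n * nat (int (q i) - j i)) - ((1 - \<theta> i) * corr f h 0 + \<theta> i * corr f h (s * n) + d i * boundary_sum (s * n) (corr f h))\<bar> \<le> 2 * D * d i + e i"
    by (rule corr_near_return'[OF tf sn K nr]) (rule that; assumption)
  have c: "corr f h (s * n * N) = corr f h 0" for N using mult[of "s * N"] by (simp add: mult_ac)
  have le: "d i * \<bar>2 * real s * x\<bar> \<le> 2 * D * d i + e i" for i
  proof -
    have d0: "0 < d i" using \<delta>(1) \<delta>(2)[of i] by linarith
    have eq: "corr f h 0 - ((1 - \<theta> i) * corr f h 0 + \<theta> i * corr f h 0 + d i * (2 * real s * x)) = - (d i * (2 * real s * x))"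
      by (simp add: algebra_simps)
    have "\<bar>corr f h 0 - ((1 - \<theta> i) * corr f h 0 + \<theta> i * corr f h 0 + d i * (2 * real s * x))\<bar> \<le> 2 * D * d i + e i"
      using e(2)[of i] by (simp only: bs c mult)
    then have "\<bar>d i * (2 * real s * x)\<bar> \<le> 2 * D * d i + e i" unfolding eq abs_minus_cancel .
    then show ?thesis using d0 by (simp only: abs_mult abs_of_pos)
  qed
  have "\<bar>2 * real s * x\<bar> \<le> 2 * D" by (rule le_if_approx[OF e(1) \<delta> le])
  then show ?thesis by (simp add: abs_mult x_def)
qed

lemma corr_periodic_mean:
  assumes good: "good_pair \<alpha> \<beta>" and n: "0 < n"
    and tf: "test_fun f" "test_fun h" and per: "\<And>i. corr f h (i + n) = corr f h i"
  shows "(\<Sum>l<n. corr f h l) = real n * corr f h 0"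
proof (rule ccontr)
  assume "(\<Sum>l<n. corr f h l) \<noteq> real n * corr f h 0"
  then have pos: "0 < \<bar>(\<Sum>l<n. corr f h l) - real n * corr f h 0\<bar>" by simp
  from reals_Archimedean3[OF pos] obtain s :: nat where s: "D < real s * \<bar>(\<Sum>l<n. corr f h l) - real n * corr f h 0\<bar>" by blast
  have "0 < s" using s D_pos by (cases s) auto
  from corr_periodic_mean_bound[OF good n this tf per] s show False by linarith
qed

text \<open>The mean over a period equals A_0, and for the observable f o T it equals A_1; by
  periodicity the two sums coincide.\<close>

lemma corr_periodic_invariant:
  assumes good: "good_pair \<alpha> \<beta>" and n: "0 < n"
    and tf: "test_fun f" "test_fun h" and per: "\<And>i. corr f h (i + n) = corr f h i"
  shows "corr f h 1 = corr f h 0"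
proof -
  have tf1: "test_fun (\<lambda>x. f ((T ^^ 1) x))" by (rule test_fun_T_funpow[OF tf(1)])
  have per1: "corr (\<lambda>x. f ((T ^^ 1) x)) h (i + n) = corr (\<lambda>x. f ((T ^^ 1) x)) h i" for i
    unfolding corr_shift using per[of "i + 1"] by (simp add: ac_simps)
  have "real n * corr f h 1 = (\<Sum>l<n. corr f h (l + 1))"
    using corr_periodic_mean[OF good n tf1 tf(2) per1] unfolding corr_shift add_0 by (rule sym)
  also have "\<dots> = (\<Sum>l<n. corr f h l)"
    using sum.lessThan_Suc_shift[of "corr f h" n] sum.lessThan_Suc[of "corr f h" n] per[of 0] by simp
  also have "\<dots> = real n * corr f h 0" by (rule corr_periodic_mean[OF good n tf per])
  finally show ?thesis using n by simp
qed

end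

section \<open>Invariant densities are constant\<close>

text \<open>For a small admissible step t one has e (i t) = i e t, and comparing r with the multiple
  of t below it gives |t e r - r e t| \<le> 2 t^2. Eliminating e t between r and s leaves an error
  O(t).\<close>

lemma linear_if_small_steps:
  fixes e :: "real \<Rightarrow> real"
  assumes e0: "e 0 = 0" and lip: "\<And>x y. 0 \<le> x \<Longrightarrow> x \<le> y \<Longrightarrow> \<bar>e y - e x\<bar> \<le> y - x"
    and step: "\<And>\<epsilon>. 0 < \<epsilon> \<Longrightarrow> \<exists>t. 0 < t \<and> t < \<epsilon> \<and> (\<forall>x\<ge>0. e (x + t) = e x + e t)"
    and rs: "0 \<le> r" "0 \<le> s"
  shows "s * e r = r * e s"
proof -
  have near: "\<bar>t * e r - r * e t\<bar> \<le> 2 * t * t" if t: "0 < t" "\<And>x. 0 \<le> x \<Longrightarrow> e (x + t) = e x + e t" and r: "0 \<le> r" for t r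
  proof -
    define i where "i = nat \<lfloor>r / t\<rfloor>"
    have i: "real i = of_int \<lfloor>r / t\<rfloor>" using t r by (simp add: i_def)
    have it: "real i * t \<le> r" "r - real i * t \<le> t"
      using floor_divide_lower[OF t(1), of r] floor_divide_upper[OF t(1), of r] unfolding i by (auto simp: algebra_simps)
    have mult: "e (real n * t) = real n * e t" for n
    proof (induction n)
      case (Suc n)
      have "e (real n * t + t) = e (real n * t) + e t" using t by simp
      then show ?case using Suc by (simp add: algebra_simps)
    qed (simp add: e0)
    have "\<bar>e r - real i * e t\<bar> \<le> t" using lip[of "real i * t" r] it t unfolding mult by simp
    then have 1: "\<bar>t * (e r - real i * e t)\<bar> \<le> t * t" using t by (simp add: abs_mult)
    have "\<bar>e t\<bar> \<le> t" using lip[of 0 t] t by (simp add: e0)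
    moreover have "\<bar>real i * t - r\<bar> \<le> t" using it by simp
    ultimately have 2: "\<bar>(real i * t - r) * e t\<bar> \<le> t * t" unfolding abs_mult using t by (intro mult_mono) auto
    have "t * e r - r * e t = t * (e r - real i * e t) + (real i * t - r) * e t" by (simp add: algebra_simps)
    then show ?thesis using 1 2 by linarith
  qed
  have le: "\<bar>s * e r - r * e s\<bar> \<le> 2 * (r + s) * t" if t: "0 < t" "\<And>x. 0 \<le> x \<Longrightarrow> e (x + t) = e x + e t" for t
  proof -
    have "t * (s * e r - r * e s) = s * (t * e r - r * e t) - r * (t * e s - s * e t)" by (simp add: algebra_simps)
    moreover have "\<bar>s * (t * e r - r * e t)\<bar> \<le> s * (2 * t * t)" "\<bar>r * (t * e s - s * e t)\<bar> \<le> r * (2 * t * t)"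
      using near[OF t rs(1)] near[OF t rs(2)] rs by (simp_all add: abs_mult mult_left_mono)
    ultimately have "\<bar>t * (s * e r - r * e s)\<bar> \<le> t * (2 * (r + s) * t)" by (simp add: algebra_simps)
    then show ?thesis using t(1) by (simp add: abs_mult)
  qed
  show ?thesis
  proof (rule ccontr)
    assume "s * e r \<noteq> r * e s"
    then have pos: "0 < \<bar>s * e r - r * e s\<bar>" by simp
    define \<epsilon> where "\<epsilon> = \<bar>s * e r - r * e s\<bar> / (2 * (r + s) + 1)"
    have "0 < \<epsilon>" using pos rs by (simp add: \<epsilon>_def)
    from step[OF this] obtain t where t: "0 < t" "t < \<epsilon>" "\<And>x. 0 \<le> x \<Longrightarrow> e (x + t) = e x + e t" by blast
    have "\<bar>s * e r - r * e s\<bar> \<le> 2 * (r + s) * t" by (rule le[OF t(1,3)])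
    also have "\<dots> \<le> (2 * (r + s) + 1) * t" using t by (simp add: algebra_simps)
    also have "\<dots> < (2 * (r + s) + 1) * \<epsilon>" using t rs by (intro mult_strict_left_mono) auto
    also have "\<dots> = \<bar>s * e r - r * e s\<bar>" using rs by (simp add: \<epsilon>_def)
    finally show False by simp
  qed
qed

context three_interval
begin

lemma test_fun_mult: "test_fun f \<Longrightarrow> test_fun g \<Longrightarrow> test_fun (\<lambda>x. f x * g x)"
  unfolding test_fun_def abs_mult by (intro conjI ballI borel_measurable_times) (auto intro!: mult_le_one)

lemma test_fun_indicator: "F \<in> sets borel \<Longrightarrow> test_fun (indicator F)"
  by (simp add: test_fun_def indicator_def)

lemma AE_le_if_corr_invariant:
  assumes h: "test_fun h" and h': "test_fun h'"
    and inv: "\<And>F. F \<in> sets borel \<Longrightarrow> integ (\<lambda>x. indicator F x * h x) = integ (\<lambda>x. indicator F x * h' x)"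
  shows "AE x in lborel. x \<in> {0..<D} \<longrightarrow> h x \<le> h' x"
proof -
  \<comment> \<open>The set on which the claimed inequality fails is itself the test set.\<close>
  define F where "F = {x \<in> {0..<D}. h' x < h x}"
  have [measurable]: "h \<in> borel_measurable borel" "h' \<in> borel_measurable borel" using h h' by (auto simp: test_fun_def)
  have F[measurable]: "F \<in> sets borel" unfolding F_def by measurable
  note int = integrable_bounded_on_domain[where B=1]
  have i: "integrable lborel (\<lambda>x. indicator {0..<D} x * (indicator F x * h x))" "integrable lborel (\<lambda>x. indicator {0..<D} x * (indicator F x * h' x))"
    using test_fun_mult[OF test_fun_indicator[OF F] h] test_fun_mult[OF test_fun_indicator[OF F] h']
    by (auto intro!: int simp: test_fun_def)
  have eq: "indicator {0..<D} x * (indicator F x * h x) - indicator {0..<D} x * (indicator F x * h' x) = indicator F x * (h x - h' x)" for x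
    by (auto simp: F_def split: split_indicator)
  have "(LBINT x. indicator F x * (h x - h' x)) = 0"
    using inv[OF F] unfolding eq[symmetric] Bochner_Integration.integral_diff[OF i] integ_def by simp
  moreover have "integrable lborel (\<lambda>x. indicator F x * (h x - h' x))"
    using Bochner_Integration.integrable_diff[OF i] unfolding eq .
  moreover have "AE x in lborel. 0 \<le> indicator F x * (h x - h' x)"
    by (intro AE_I2) (auto simp: F_def split: split_indicator)
  ultimately have "AE x in lborel. indicator F x * (h x - h' x) = 0"
    using integral_nonneg_eq_0_iff_AE by blast
  then show ?thesis
    by (rule AE_mp) (intro AE_I2, auto simp: F_def split: split_indicator)
qed

lemma AE_invariant:
  assumes h: "test_fun h" and inv: "\<And>F. F \<in> sets borel \<Longrightarrow> corr (indicator F) h 1 = corr (indicator F) h 0"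
  shows "AE x in lborel. x \<in> {0..<D} \<longrightarrow> h (T x) = h x"
proof -
  have hT: "test_fun (\<lambda>x. h (T x))" using test_fun_T_funpow[OF h, of 1] by simp
  have eq: "integ (\<lambda>x. indicator F x * h x) = integ (\<lambda>x. indicator F x * h (T x))" if F: "F \<in> sets borel" for F
  proof -
    \<comment> \<open>On the domain the indicator of F' composed with \<open>T\<close> is that of F.
      The hypothesis, which moves the observable, thereby becomes a statement that moves
      \<open>h\<close>.\<close>
    define F' where "F' = T' -` F"
    have F': "F' \<in> sets borel" using measurable_sets_borel[OF measurable_T' F] by (simp add: F'_def)
    have ind: "indicator F' (T x) = (indicator F x :: real)" if "x \<in> {0..<D}" for x
      using T'_T[OF that] by (simp add: F'_def indicator_def)
    have "integ (\<lambda>x. indicator F x * h x) = corr (indicator F') h 1"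
      unfolding corr_def integ_def using ind by (intro Bochner_Integration.integral_cong) (auto split: split_indicator)
    also have "\<dots> = integ (\<lambda>x. indicator F' x * h x)" using inv[OF F'] by (simp add: corr_def)
    also have "\<dots> = integ (\<lambda>x. indicator F' (T x) * h (T x))"
      using test_fun_mult[OF test_fun_indicator[OF F'] h]
      by (intro integ_T[where B=1, symmetric]) (auto simp: test_fun_def)
    also have "\<dots> = integ (\<lambda>x. indicator F x * h (T x))"
      unfolding integ_def using ind by (intro Bochner_Integration.integral_cong) (auto split: split_indicator)
    finally show ?thesis .
  qed
  have "AE x in lborel. x \<in> {0..<D} \<longrightarrow> h x \<le> h (T x)" by (rule AE_le_if_corr_invariant[OF h hT eq])
  moreover have "AE x in lborel. x \<in> {0..<D} \<longrightarrow> h (T x) \<le> h x" by (rule AE_le_if_corr_invariant[OF hT h eq[symmetric]])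
  ultimately show ?thesis by eventually_elim auto
qed

section \<open>Transfer to the rotation and its small periods\<close>

text \<open>Here \<open>orb 0 x\<close> is x reduced modulo L, and on the arc [D, L) the value is
  taken one rotation step earlier. The lift turns invariance under \<open>T\<close> into invariance
  under the rotation.\<close>

definition periodic_ext :: "(real \<Rightarrow> real) \<Rightarrow> real \<Rightarrow> real" where
  "periodic_ext h x = (let z = orb 0 x in if z < D then h z else h (z - C))"

lemma orb_add: "orb t (x + real r * C) = orb (t + r) x"
  by (simp add: orb_def distrib_right add_ac)

lemma orb_diff_int: "orb t (x - of_int p * L) = orb t x"
proof -
  have "(x - of_int p * L + real t * C) / L = (x + real t * C) / L - of_int p" using L_pos by (simp add: field_simps)
  then show ?thesis by (simp add: orb_def frac_def)
qed

lemma measurable_periodic_ext [measurable]: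
  assumes [measurable]: "h \<in> borel_measurable borel"
  shows "periodic_ext h \<in> borel_measurable borel"
  unfolding periodic_ext_def[abs_def] orb_def Let_def frac_def by measurable

lemma periodic_ext_C:
  assumes h: "test_fun h" and inv: "AE x in lborel. x \<in> {0..<D} \<longrightarrow> h (T x) = h x"
  shows "AE x in lborel. periodic_ext h (x + C) = periodic_ext h x"
proof -
  have [measurable]: "h \<in> borel_measurable borel" using h by (auto simp: test_fun_def)
  have shift: "AE x in lborel. s + 1 * x \<in> {0..<D} \<longrightarrow> h (T (s + 1 * x)) = h (s + 1 * x)" for s
    by (rule AE_borel_affine[OF _ _ inv]) (simp, measurable)
  \<comment> \<open>All translates of the exceptional null set by multiples of L, with and without
    C, are collected, since x is reduced modulo L by a multiple that varies.\<close>
  have "AE x in lborel. \<forall>n::int. (x - of_int n * L \<in> {0..<D} \<longrightarrow> h (T (x - of_int n * L)) = h (x - of_int n * L)) \<and>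
     (x - of_int n * L - C \<in> {0..<D} \<longrightarrow> h (T (x - of_int n * L - C)) = h (x - of_int n * L - C))" (is "AE x in lborel. \<forall>n. ?P x n")
    unfolding AE_all_countable AE_conj_iff
    using shift[of "- (of_int _ * L)"] shift[of "- (of_int _ * L) - C"] by (auto simp: algebra_simps)
  then show ?thesis
  proof (rule AE_mp, intro AE_I2 impI)
    fix x
    assume a: "\<forall>n. ?P x n"
    define z where "z = orb 0 x"
    have z: "z = x - of_int \<lfloor>x / L\<rfloor> * L" using L_pos by (simp add: z_def orb_def frac_def field_simps)
    have hz: "z \<in> {0..<D} \<Longrightarrow> h (T z) = h z" "z - C \<in> {0..<D} \<Longrightarrow> h (T (z - C)) = h (z - C)"
      using a[rule_format, of "\<lfloor>x / L\<rfloor>"] unfolding z by auto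
    have zL: "0 \<le> z" "z < L" using orb_bounds[of 0 x] by (simp_all add: z_def)
    have "orb 0 (x + C) = rot z" using orb_add[of 0 x 1] orb_Suc[of 0 x] by (simp add: z_def)
    then have e: "periodic_ext h (x + C) = (if rot z < D then h (rot z) else h (rot z - C))"
      "periodic_ext h x = (if z < D then h z else h (z - C))"
      by (simp_all add: periodic_ext_def Let_def z_def)
    show "periodic_ext h (x + C) = periodic_ext h x"
    proof (cases "z < D")
      case True
      show ?thesis
      proof (cases "rot z < D")
        case r: True
        then show ?thesis using True e hz(1) zL T_rot[of z] by simp
      next
        case False
        then have "rot z - C = z" using zL pos by (auto simp: rot_def lengths split: if_splits)
        then show ?thesis using True False e by simp
      qed
    next
      case False
      then have zC: "z - C \<in> {0..<D}" "rot (z - C) = z" using zL pos by (auto simp: rot_def lengths)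
      then have "T (z - C) = rot z" using T_rot[of "z - C"] False by simp
      then show ?thesis using rot_outside[of z] False zL e hz(2) zC by simp
    qed
  qed
qed

text \<open>q rotation steps less p full turns are the translation by d L / q. An invariant function
  thus has arbitrarily small periods, up to null sets.\<close>

lemma periodic_ext_near_return:
  assumes h: "test_fun h" and inv: "AE x in lborel. x \<in> {0..<D} \<longrightarrow> h (T x) = h x"
    and nr: "near_return q p j d \<theta>"
  shows "AE x in lborel. periodic_ext h (x + d * L / real q) = periodic_ext h x"
proof -
  have [measurable]: "h \<in> borel_measurable borel" using h by (auto simp: test_fun_def)
  have iter: "AE x in lborel. periodic_ext h (x + real r * C) = periodic_ext h x" for r
  proof (induction r)
    case (Suc r)
    have "AE x in lborel. periodic_ext h (real r * C + 1 * x + C) = periodic_ext h (real r * C + 1 * x)"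
      by (rule AE_borel_affine[OF _ _ periodic_ext_C[OF h inv]]) (simp, measurable)
    then show ?case using Suc
    proof eventually_elim
      case (elim x)
      then show ?case by (simp add: distrib_right add_ac)
    qed
  qed simp
  have q: "0 < real q" "d = real q * (real q * \<alpha> - of_int p)" using nr by (auto simp: near_return_def)
  have t: "x + d * L / real q = x + real q * C - of_int p * L" for x
    using q(1) L_pos unfolding q(2) \<alpha>_def by (simp add: field_simps)
  have "periodic_ext h (x + d * L / real q) = periodic_ext h (x + real q * C)" for x
    unfolding t periodic_ext_def orb_diff_int ..
  then show ?thesis using iter[of q] by simp
qed

text \<open>Ergodicity through primitives: the primitive \<open>e\<close> of the extension is
  1-Lipschitz, and the small periods make it additive for arbitrarily small steps, hence
  linear.\<close>

lemma integ_indicator_if_invariant: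
  assumes good: "good_pair \<alpha> \<beta>" and h: "test_fun h" and inv: "AE x in lborel. x \<in> {0..<D} \<longrightarrow> h (T x) = h x"
    and r: "0 \<le> r" "r \<le> D"
  shows "D * integ (\<lambda>x. indicator {0..<r} x * h x) = r * integ h"
proof -
  have hm[measurable]: "h \<in> borel_measurable borel" using h by (auto simp: test_fun_def)
  define H where "H = periodic_ext h"
  have Hm[measurable]: "H \<in> borel_measurable borel" unfolding H_def by measurable
  have H1: "\<bar>H x\<bar> \<le> 1" for x
  proof -
    have "orb 0 x < D \<Longrightarrow> orb 0 x \<in> {0..<D}" "\<not> orb 0 x < D \<Longrightarrow> orb 0 x - C \<in> {0..<D}"
      using orb_bounds[of 0 x] pos by (auto simp: lengths)
    then show ?thesis using h unfolding H_def periodic_ext_def Let_def test_fun_def by auto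
  qed
  have Hint: "integrable lborel (\<lambda>x. indicator {u..<v} x * H x)" for u v :: real
  proof (rule Bochner_Integration.integrable_bound[where f="indicator {u..<v} :: real \<Rightarrow> real"])
    show "integrable lborel (indicator {u..<v} :: real \<Rightarrow> real)" by (cases "u \<le> v") auto
  qed (use H1 in \<open>auto split: split_indicator\<close>)
  define e where "e r = (LBINT x. indicator {0..<r} x * H x)" for r
  have e_diff: "e y = e x + (LBINT z. indicator {x..<y} z * H z)" if "0 \<le> x" "x \<le> y" for x y
  proof -
    have "e y = (LBINT z. indicator {0..<x} z * H z + indicator {x..<y} z * H z)"
      unfolding e_def using that by (intro Bochner_Integration.integral_cong) (auto split: split_indicator)
    then show ?thesis unfolding e_def using Hint by simp
  qed
  have lip: "\<bar>e y - e x\<bar> \<le> y - x" if "0 \<le> x" "x \<le> y" for x y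
  proof -
    have "\<bar>LBINT z. indicator {x..<y} z * H z\<bar> \<le> (LBINT z. \<bar>indicator {x..<y} z * H z\<bar>)" by (rule integral_abs_bound)
    also have "\<dots> \<le> (LBINT z. indicator {x..<y} z)"
      using Hint[of x y] H1 that by (intro integral_mono integrable_abs) (auto split: split_indicator)
    finally show ?thesis using e_diff[OF that] that by simp
  qed
  have step: "\<exists>t. 0 < t \<and> t < \<epsilon> \<and> (\<forall>x\<ge>0. e (x + t) = e x + e t)" if \<epsilon>: "0 < \<epsilon>" for \<epsilon>
  proof -
    obtain q p j d \<theta> \<delta> where nr: "\<And>i. near_return (q i) (p i) (j i) (d i) (\<theta> i)" "filterlim q at_top sequentially"
      and K: "\<And>i::nat. real 1 * d i \<le> 1/4" and \<delta>: "0 < \<delta>" "\<And>i. \<delta> \<le> d i"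
      by (rule good_pair_near_returns[OF good zero_less_one]) (rule that; assumption)
    have "eventually (\<lambda>i. nat \<lceil>L / \<epsilon>\<rceil> + 1 \<le> q i) sequentially" using nr(2) by (simp add: filterlim_at_top)
    then obtain i where i: "nat \<lceil>L / \<epsilon>\<rceil> + 1 \<le> q i" using eventually_happens trivial_limit_sequentially by blast
    define t where "t = d i * L / real (q i)"
    have "L / \<epsilon> \<le> real (nat \<lceil>L / \<epsilon>\<rceil>)" by (rule real_nat_ceiling_ge)
    then have Lq: "L / \<epsilon> < real (q i)" using i by linarith
    have q0: "0 < real (q i)" using i by simp
    have d: "0 < d i" "d i < 1" using \<delta>(1) \<delta>(2)[of i] K[of i] by auto
    have "0 < t" using d q0 L_pos by (simp add: t_def)
    moreover have "t < \<epsilon>"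
    proof -
      have "d i * L < L" using d L_pos by simp
      also have "L < real (q i) * \<epsilon>" using Lq \<epsilon> by (simp add: pos_divide_less_eq)
      finally show ?thesis using q0 by (simp add: t_def pos_divide_less_eq mult.commute)
    qed
    moreover have "e (x + t) = e x + e t" if x: "0 \<le> x" for x
    proof -
      have "e (t + x) = e t + (LBINT z. indicator {0 + t..<x + t} z * H z)"
        using e_diff[of t "t + x"] x \<open>0 < t\<close> by (simp add: add.commute)
      also have "(LBINT z. indicator {0 + t..<x + t} z * H z) = (LBINT z. indicator {0..<x} z * H (z + t))"
        by (rule integral_indicator_shift[symmetric])
      also have "\<dots> = e x"
        unfolding e_def
      proof (rule integral_cong_AE)
        show "AE z in lborel. indicator {0..<x} z * H (z + t) = indicator {0..<x} z * H z"
          using periodic_ext_near_return[OF h inv nr(1)[of i]] unfolding H_def t_def by eventually_elim simp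
      qed measurable
      finally show ?thesis by (simp add: add.commute)
    qed
    ultimately show ?thesis by blast
  qed
  have e0: "e 0 = 0" by (simp add: e_def)
  have "D * e r = r * e D"
    by (rule linear_if_small_steps[OF e0 lip step]) (use r D_pos in auto)
  moreover have "H x = h x" if "x \<in> {0..<D}" for x
    using orb_0[OF that] that by (simp add: H_def periodic_ext_def)
  then have "e u = integ (\<lambda>x. indicator {0..<u} x * h x)" if "u \<le> D" for u
    unfolding e_def integ_def using that by (intro Bochner_Integration.integral_cong) (auto split: split_indicator)
  moreover have "integ (\<lambda>x. indicator {0..<D} x * h x) = integ h"
    unfolding integ_def by (intro Bochner_Integration.integral_cong) (auto split: split_indicator)
  ultimately show ?thesis using r by simp
qed

end

section \<open>Joinings of powers\<close>

text \<open>The set where the Radon-Nikodym density exceeds 1 must be null; truncation then gives a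
  real function with values in [0, 1] everywhere.\<close>

lemma dominated_measure_density:
  fixes A N :: "'a measure"
  assumes "finite_measure A" and sets: "sets N = sets A" and le: "\<And>B. B \<in> sets A \<Longrightarrow> emeasure N B \<le> emeasure A B"
  obtains h :: "'a \<Rightarrow> real" where "h \<in> borel_measurable A" "\<And>x. 0 \<le> h x" "\<And>x. h x \<le> 1" "N = density A (\<lambda>x. ennreal (h x))"
proof -
  interpret finite_measure A by fact
  have "absolutely_continuous A N"
    unfolding absolutely_continuous_def
  proof
    fix B assume "B \<in> null_sets A"
    then show "B \<in> null_sets N" using le[of B] sets by (auto simp: null_sets_def)
  qed
  from Radon_Nikodym[OF this sets] obtain g where g[measurable]: "g \<in> borel_measurable A" and N: "density A g = N" by blast
  define B where "B = {x \<in> space A. 1 < g x}"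
  have B[measurable]: "B \<in> sets A" unfolding B_def by measurable
  have "(\<integral>\<^sup>+x. g x * indicator B x - indicator B x \<partial>A) = (\<integral>\<^sup>+x. g x * indicator B x \<partial>A) - (\<integral>\<^sup>+x. indicator B x \<partial>A)"
    by (rule nn_integral_diff) (auto simp: B_def emeasure_eq_measure intro!: AE_I2 split: split_indicator)
  also have "(\<integral>\<^sup>+x. g x * indicator B x \<partial>A) = emeasure N B" unfolding N[symmetric] by (rule emeasure_density[symmetric]) measurable
  also have "emeasure N B - (\<integral>\<^sup>+x. indicator B x \<partial>A) = 0" using le[OF B] le_less_trans[OF le[OF B], of top] by (simp add: diff_eq_0_iff_ennreal emeasure_eq_measure)
  finally have "AE x in A. g x * indicator B x - indicator B x = 0" by (subst (asm) nn_integral_0_iff_AE) auto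
  then have le1: "AE x in A. g x \<le> 1"
  proof (rule AE_mp, intro AE_I2 impI)
    fix x assume x: "x \<in> space A" "g x * indicator B x - indicator B x = 0"
    show "g x \<le> 1"
    proof (rule ccontr)
      assume "\<not> g x \<le> 1"
      then have "x \<in> B" using x(1) by (simp add: B_def)
      then have "g x - 1 = 0" using x(2) by simp
      then show False using \<open>\<not> g x \<le> 1\<close> by (simp add: diff_eq_0_iff_ennreal)
    qed
  qed
  define h where "h x = enn2real (min 1 (g x))" for x
  have fin: "min 1 (g x) < \<top>" for x by (simp add: min_less_iff_disj)
  show thesis
  proof
    show "h \<in> borel_measurable A" unfolding h_def by measurable
    show "0 \<le> h x" for x by (simp add: h_def)
    show "h x \<le> 1" for x unfolding h_def using enn2real_mono[of "min 1 (g x)" 1] by simp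
    have "density A g = density A (\<lambda>x. ennreal (h x))"
      using le1 fin by (intro density_cong) (auto simp: h_def min_def elim!: eventually_mono)
    then show "N = density A (\<lambda>x. ennreal (h x))" using N by simp
  qed
qed

context three_interval
begin

text \<open>Lives on the whole Borel line, so that observables remain functions of a real variable
  without restricted measurability.\<close>

definition norm_leb :: "real measure" where
  "norm_leb = density lborel (\<lambda>x. ennreal (indicator {0..<D} x / D))"

lemma sets_norm_leb [simp, measurable_cong]: "sets norm_leb = sets borel"
  by (simp add: norm_leb_def)

lemma integral_norm_leb:
  assumes [measurable]: "f \<in> borel_measurable borel"
  shows "(\<integral>x. f x \<partial>norm_leb) = integ f / D"
proof -
  have "(\<integral>x. f x \<partial>norm_leb) = (LBINT x. (indicator {0..<D} x / D) *\<^sub>R f x)"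
    unfolding norm_leb_def using D_pos by (intro integral_density) auto
  also have "\<dots> = (LBINT x. indicator {0..<D} x * f x / D)" by simp
  finally show ?thesis by (simp add: integ_def)
qed

lemma emeasure_density_domain:
  assumes g: "test_fun g" "\<And>x. 0 \<le> g x" and F[measurable]: "F \<in> sets borel"
  shows "emeasure (density lborel (\<lambda>x. ennreal (indicator {0..<D} x * g x))) F = ennreal (integ (\<lambda>x. indicator F x * g x))"
proof -
  have [measurable]: "g \<in> borel_measurable borel" using g by (simp add: test_fun_def)
  have int: "integrable lborel (\<lambda>x. indicator {0..<D} x * (indicator F x * g x))"
    using test_fun_mult[OF test_fun_indicator[OF F] g(1)] by (intro integrable_bounded_on_domain[where B=1]) (auto simp: test_fun_def)
  have "emeasure (density lborel (\<lambda>x. ennreal (indicator {0..<D} x * g x))) F = (\<integral>\<^sup>+x. ennreal (indicator {0..<D} x * g x) * indicator F x \<partial>lborel)"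
    by (rule emeasure_density) auto
  also have "\<dots> = (\<integral>\<^sup>+x. ennreal (indicator {0..<D} x * (indicator F x * g x)) \<partial>lborel)"
    by (intro nn_integral_cong) (auto split: split_indicator)
  also have "\<dots> = ennreal (integ (\<lambda>x. indicator F x * g x))"
    unfolding integ_def using int g(2) by (intro nn_integral_eq_integral) auto
  finally show ?thesis .
qed

lemma integ_nonneg: "(\<And>x. 0 \<le> f x) \<Longrightarrow> 0 \<le> integ f"
  unfolding integ_def by (intro Bochner_Integration.integral_nonneg) simp

lemma integ_const: "integ (\<lambda>x. r) = r * D"
  unfolding integ_def using D_pos by simp

text \<open>The measures on [0, D) with density \<open>h\<close> and with its constant mean u agree
  on half-lines, hence on Borel sets. The half-line beyond x is the complement of [0, x) up to the
  null set {x}.\<close>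

lemma integ_indicator_borel:
  assumes h: "test_fun h" "\<And>x. 0 \<le> h x" and lin: "\<And>r. 0 \<le> r \<Longrightarrow> r \<le> D \<Longrightarrow> D * integ (\<lambda>x. indicator {0..<r} x * h x) = r * integ h"
    and F: "F \<in> sets borel"
  shows "D * integ (\<lambda>x. indicator F x * h x) = integ (indicator F) * integ h"
proof -
  define u where "u = integ h / D"
  have u: "0 \<le> u" "u \<le> 1" "integ h = u * D"
    using integ_nonneg[OF h(2)] D_pos abs_integ_le[of h 1] h by (auto simp: u_def test_fun_def)
  have tc: "test_fun (\<lambda>x. u)" using u by (simp add: test_fun_def)
  have tail: "integ (\<lambda>y. indicator {x<..} y * g y) = integ g - integ (\<lambda>y. indicator {0..<x} y * g y)" if g: "test_fun g" and x: "0 \<le> x" "x < D" for x g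
  proof -
    have [measurable]: "g \<in> borel_measurable borel" using g by (simp add: test_fun_def)
    have i: "integrable lborel (\<lambda>y. indicator {0..<D} y * g y)" "integrable lborel (\<lambda>y. indicator {0..<D} y * (indicator {0..<x} y * g y))"
      using g test_fun_mult[OF test_fun_indicator[of "{0..<x}"] g]
      by (auto intro!: integrable_bounded_on_domain[where B=1] simp: test_fun_def)
    have "integ (\<lambda>y. indicator {x<..} y * g y) = (LBINT y. indicator {0..<D} y * g y - indicator {0..<D} y * (indicator {0..<x} y * g y))"
      unfolding integ_def
    proof (rule integral_cong_AE)
      show "AE y in lborel. indicator {0..<D} y * (indicator {x<..} y * g y) = indicator {0..<D} y * g y - indicator {0..<D} y * (indicator {0..<x} y * g y)"
        using AE_lborel_singleton[of x] by eventually_elim (auto split: split_indicator)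
    qed measurable
    then show ?thesis unfolding integ_def Bochner_Integration.integral_diff[OF i] .
  qed
  have cut: "integ (\<lambda>y. indicator {0..<x} y * u) = u * x" if "0 \<le> x" "x \<le> D" for x
  proof -
    have "integ (\<lambda>y. indicator {0..<x} y * u) = (LBINT y. u * indicator {0..<x} y)"
      unfolding integ_def using that by (intro Bochner_Integration.integral_cong) (auto split: split_indicator)
    then show ?thesis using that by simp
  qed
  have tails: "integ (\<lambda>y. indicator {x<..} y * h y) = integ (\<lambda>y. indicator {x<..} y * u)" for x
  proof -
    consider "x < 0" | "D \<le> x" | "0 \<le> x" "x < D" by linarith
    then show ?thesis
    proof cases
      case 1
      have "integ (\<lambda>y. indicator {x<..} y * g y) = integ g" for g :: "real \<Rightarrow> real"
        unfolding integ_def using 1 by (intro Bochner_Integration.integral_cong) (auto split: split_indicator)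
      then show ?thesis using u(3) integ_const[of u] by simp
    next
      case 2
      have "integ (\<lambda>y. indicator {x<..} y * g y) = integ (\<lambda>y. 0)" for g :: "real \<Rightarrow> real"
        unfolding integ_def using 2 by (intro Bochner_Integration.integral_cong) (auto split: split_indicator)
      then show ?thesis by simp
    next
      case 3
      have "D * integ (\<lambda>y. indicator {0..<x} y * h y) = D * (u * x)" using lin[of x] 3 u(3) by simp
      then have "integ (\<lambda>y. indicator {0..<x} y * h y) = u * x" using D_pos by simp
      then show ?thesis using tail[OF h(1) 3] tail[OF tc 3] cut[of x] 3 u(3) integ_const[of u] by simp
    qed
  qed
  have "density lborel (\<lambda>x. ennreal (indicator {0..<D} x * h x)) = density lborel (\<lambda>x. ennreal (indicator {0..<D} x * u))"
  proof (rule measure_eqI_lessThan)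
    fix x :: real
    show "emeasure (density lborel (\<lambda>x. ennreal (indicator {0..<D} x * h x))) {x<..} < \<infinity>"
      by (subst emeasure_density_domain[OF h]) auto
    show "emeasure (density lborel (\<lambda>x. ennreal (indicator {0..<D} x * h x))) {x<..} = emeasure (density lborel (\<lambda>x. ennreal (indicator {0..<D} x * u))) {x<..}"
      by (subst emeasure_density_domain[OF h], simp, subst emeasure_density_domain[OF tc u(1)], simp, simp only: tails)
  qed auto
  then have "ennreal (integ (\<lambda>x. indicator F x * h x)) = ennreal (integ (\<lambda>x. indicator F x * u))"
    using emeasure_density_domain[OF h F] emeasure_density_domain[OF tc u(1) F] by simp
  moreover have "0 \<le> integ (\<lambda>x. indicator F x * h x)" "0 \<le> integ (\<lambda>x. indicator F x * u)"
    using h(2) u(1) by (intro integ_nonneg; simp)+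
  ultimately have "integ (\<lambda>x. indicator F x * h x) = integ (\<lambda>x. indicator F x * u)" by simp
  also have "\<dots> = u * integ (indicator F)" unfolding integ_def by (simp add: mult_ac flip: integral_mult_right_zero)
  finally show ?thesis using u(3) by simp
qed

text \<open>\<open>h\<close> is the conditional expectation of the indicator of \<open>E\<close>
  given \<xi>, obtained as the density of the law of \<xi> restricted to \<open>E\<close>.\<close>

lemma weight_density:
  assumes J: "finite_measure J" and \<xi>[measurable]: "\<xi> \<in> J \<rightarrow>\<^sub>M borel" and dist: "distr J borel \<xi> = norm_leb" and E[measurable]: "E \<in> sets J"
  obtains h where "test_fun h" "\<And>x. 0 \<le> h x" "\<And>f. f \<in> borel_measurable borel \<Longrightarrow> (\<integral>\<omega>. f (\<xi> \<omega>) * indicator E \<omega> \<partial>J) = integ (\<lambda>x. f x * h x) / D"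
proof -
  interpret J: finite_measure J by fact
  define N where "N = distr (density J (indicator E)) borel \<xi>"
  have fin: "finite_measure norm_leb" unfolding dist[symmetric] by (rule J.finite_measure_distr) measurable
  have le: "emeasure N B \<le> emeasure norm_leb B" if B[measurable]: "B \<in> sets norm_leb" for B
  proof -
    have [measurable]: "B \<in> sets borel" using B by simp
    have "emeasure N B = emeasure (density J (indicator E)) (\<xi> -` B \<inter> space J)" unfolding N_def by (subst emeasure_distr) auto
    also have "\<dots> = (\<integral>\<^sup>+\<omega>. indicator E \<omega> * indicator (\<xi> -` B \<inter> space J) \<omega> \<partial>J)" by (rule emeasure_density) measurable
    also have "\<dots> \<le> (\<integral>\<^sup>+\<omega>. indicator (\<xi> -` B \<inter> space J) \<omega> \<partial>J)" by (intro nn_integral_mono) (auto split: split_indicator)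
    also have "\<dots> = emeasure (distr J borel \<xi>) B" by (simp add: emeasure_distr)
    finally show ?thesis unfolding dist .
  qed
  obtain h where h: "h \<in> borel_measurable norm_leb" "\<And>x. 0 \<le> h x" "\<And>x. h x \<le> 1" "N = density norm_leb (\<lambda>x. ennreal (h x))"
    by (rule dominated_measure_density[OF fin, of N]) (simp add: N_def, erule le, (rule that; assumption))
  have hm[measurable]: "h \<in> borel_measurable borel" using h(1) by (simp cong: measurable_cong_sets)
  show thesis
  proof (rule that)
    show "test_fun h" using hm h(2,3) by (simp add: test_fun_def)
    show "0 \<le> h x" for x by (rule h)
    fix f :: "real \<Rightarrow> real" assume f[measurable]: "f \<in> borel_measurable borel"
    have "(\<integral>\<omega>. f (\<xi> \<omega>) * indicator E \<omega> \<partial>J) = (\<integral>\<omega>. indicator E \<omega> *\<^sub>R f (\<xi> \<omega>) \<partial>J)" by (simp add: mult.commute)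
    also have "\<dots> = (\<integral>\<omega>. f (\<xi> \<omega>) \<partial>density J (\<lambda>\<omega>. ennreal (indicator E \<omega>)))" by (rule integral_density[symmetric]) auto
    also have "(\<lambda>\<omega>. ennreal (indicator E \<omega>)) = indicator E" by (auto simp: fun_eq_iff split: split_indicator)
    also have "(\<integral>\<omega>. f (\<xi> \<omega>) \<partial>density J (indicator E)) = (\<integral>x. f x \<partial>N)" unfolding N_def by (rule integral_distr[symmetric]) auto
    also have "\<dots> = (\<integral>x. h x *\<^sub>R f x \<partial>norm_leb)" unfolding h(4) using h(1,2) by (intro integral_density) auto
    also have "\<dots> = integ (\<lambda>x. h x * f x) / D" by (simp add: integral_norm_leb)
    finally show "(\<integral>\<omega>. f (\<xi> \<omega>) * indicator E \<omega> \<partial>J) = integ (\<lambda>x. f x * h x) / D" by (simp add: mult.commute)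
  qed
qed

text \<open>Let h be the density of \<eta> \<in> G given \<xi>, and k that of \<xi> \<in> F given
  \<eta>. Moving both coordinates by the joint dynamics expresses one integral as a correlation of h
  at n j and as a correlation of k at m j. As h does not depend on F, all its correlations are
  invariant, which forces h to be constant almost everywhere.\<close>

lemma joining_independent:
  assumes good: "good_pair \<alpha> \<beta>" and nm: "0 < n" "n < m"
    and J: "finite_measure J" and \<xi>[measurable]: "\<xi> \<in> J \<rightarrow>\<^sub>M borel" and \<eta>[measurable]: "\<eta> \<in> J \<rightarrow>\<^sub>M borel"
    and dist: "distr J borel \<xi> = norm_leb" "distr J borel \<eta> = norm_leb"
    and mem: "\<And>\<omega>. \<omega> \<in> space J \<Longrightarrow> \<xi> \<omega> \<in> {0..<D} \<and> \<eta> \<omega> \<in> {0..<D}"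
    and inv: "\<And>f g. test_fun f \<Longrightarrow> test_fun g \<Longrightarrow> (\<integral>\<omega>. f ((T ^^ n) (\<xi> \<omega>)) * g ((T ^^ m) (\<eta> \<omega>)) \<partial>J) = (\<integral>\<omega>. f (\<xi> \<omega>) * g (\<eta> \<omega>) \<partial>J)"
    and FG[measurable]: "F \<in> sets borel" "G \<in> sets borel"
  shows "(\<integral>\<omega>. indicator F (\<xi> \<omega>) * indicator G (\<eta> \<omega>) \<partial>J) = (integ (indicator F) / D) * (integ (indicator G) / D)"
proof -
  have inv_funpow: "(\<integral>\<omega>. f ((T ^^ (n * j)) (\<xi> \<omega>)) * g ((T ^^ (m * j)) (\<eta> \<omega>)) \<partial>J) = (\<integral>\<omega>. f (\<xi> \<omega>) * g (\<eta> \<omega>) \<partial>J)"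
    if "test_fun f" "test_fun g" for f g j
  proof (induction j)
    case (Suc j)
    have e: "n * Suc j = n * j + n" "m * Suc j = m * j + m" by simp_all
    show ?case unfolding e funpow_add comp_apply
      using inv[OF test_fun_T_funpow[OF that(1), of "n * j"] test_fun_T_funpow[OF that(2), of "m * j"]] Suc by simp
  qed simp
  define E where "E = \<eta> -` G \<inter> space J"
  have E: "E \<in> sets J" unfolding E_def by measurable
  obtain h where h: "test_fun h" "\<And>x. 0 \<le> h x" "\<And>f. f \<in> borel_measurable borel \<Longrightarrow> (\<integral>\<omega>. f (\<xi> \<omega>) * indicator E \<omega> \<partial>J) = integ (\<lambda>x. f x * h x) / D"
    by (rule weight_density[OF J \<xi> dist(1) E]) (rule that; assumption)
  have hE: "(\<integral>\<omega>. f (\<xi> \<omega>) * indicator G (\<eta> \<omega>) \<partial>J) = integ (\<lambda>x. f x * h x) / D" if "f \<in> borel_measurable borel" for f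
    unfolding h(3)[OF that, symmetric] by (intro Bochner_Integration.integral_cong) (auto simp: E_def split: split_indicator)
  have corr_n: "corr (indicator F) h n = corr (indicator F) h 0" if F[measurable]: "F \<in> sets borel" for F
  proof -
    define E' where "E' = \<xi> -` F \<inter> space J"
    have E': "E' \<in> sets J" unfolding E'_def by measurable
    obtain k where k: "test_fun k" "\<And>x. 0 \<le> k x" "\<And>f. f \<in> borel_measurable borel \<Longrightarrow> (\<integral>\<omega>. f (\<eta> \<omega>) * indicator E' \<omega> \<partial>J) = integ (\<lambda>x. f x * k x) / D"
      by (rule weight_density[OF J \<eta> dist(2) E']) (rule that; assumption)
    have kE: "(\<integral>\<omega>. indicator F (\<xi> \<omega>) * f (\<eta> \<omega>) \<partial>J) = integ (\<lambda>x. f x * k x) / D" if "f \<in> borel_measurable borel" for f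
      unfolding k(3)[OF that, symmetric] by (intro Bochner_Integration.integral_cong) (auto simp: E'_def split: split_indicator)
    have "corr (indicator F) h (n * j) = corr k (indicator G) (m * j)" for j
    proof -
      \<comment> \<open>G moved back by m j steps supplies the power of \<open>T\<close> that is
        missing in the second coordinate.\<close>
      define g' where "g' = (\<lambda>x. indicator G ((T' ^^ (m * j)) x) :: real)"
      have g'm[measurable]: "g' \<in> borel_measurable borel"
        unfolding g'_def by (rule measurable_compose[OF measurable_T'_funpow]) measurable
      have g': "test_fun g'" using g'm by (simp add: test_fun_def g'_def)
      have g'T: "g' ((T ^^ (m * j)) x) = indicator G x" if "x \<in> {0..<D}" for x
        unfolding g'_def T'_T_funpow[OF that] ..
      have "corr (indicator F) h (n * j) / D = (\<integral>\<omega>. indicator F ((T ^^ (n * j)) (\<xi> \<omega>)) * indicator G (\<eta> \<omega>) \<partial>J)"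
        unfolding corr_def
        by (rule hE[symmetric]) (rule measurable_compose[OF measurable_T_funpow], measurable)
      also have "\<dots> = (\<integral>\<omega>. indicator F ((T ^^ (n * j)) (\<xi> \<omega>)) * g' ((T ^^ (m * j)) (\<eta> \<omega>)) \<partial>J)"
        using g'T mem by (intro Bochner_Integration.integral_cong) auto
      also have "\<dots> = (\<integral>\<omega>. indicator F (\<xi> \<omega>) * g' (\<eta> \<omega>) \<partial>J)" by (rule inv_funpow[OF test_fun_indicator[OF F] g'])
      also have "\<dots> = integ (\<lambda>x. g' x * k x) / D" by (rule kE[OF g'm])
      also have "integ (\<lambda>x. g' x * k x) = integ (\<lambda>x. g' ((T ^^ (m * j)) x) * k ((T ^^ (m * j)) x))"
        using test_fun_mult[OF g' k(1)] by (intro integ_T_funpow[where B=1, symmetric]) (auto simp: test_fun_def)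
      also have "\<dots> = corr k (indicator G) (m * j)"
        unfolding corr_def integ_def using g'T by (intro Bochner_Integration.integral_cong) (auto split: split_indicator)
      finally show ?thesis using D_pos by simp
    qed
    from corr_coupled_invariant[OF good nm test_fun_indicator[OF F] h(1) test_fun_indicator[OF FG(2)] k(1) this] show ?thesis .
  qed
  \<comment> \<open>Applied to the preimages of F under T^i, \<open>corr_n\<close> makes the whole
    correlation sequence n-periodic.\<close>
  have "corr (indicator F) h 1 = corr (indicator F) h 0" if F: "F \<in> sets borel" for F
  proof (rule corr_periodic_invariant[OF good nm(1) test_fun_indicator[OF F] h(1)])
    fix i
    define F' where "F' = (T ^^ i) -` F"
    have F': "F' \<in> sets borel" using measurable_sets_borel[OF measurable_T_funpow F] by (simp add: F'_def)
    have e: "indicator F' = (\<lambda>x. indicator F ((T ^^ i) x) :: real)" by (simp add: F'_def fun_eq_iff indicator_def)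
    show "corr (indicator F) h (i + n) = corr (indicator F) h i"
      using corr_n[OF F'] unfolding e corr_shift by (simp add: add.commute)
  qed
  then have "AE x in lborel. x \<in> {0..<D} \<longrightarrow> h (T x) = h x" by (intro AE_invariant[OF h(1)])
  from integ_indicator_borel[OF h(1,2) integ_indicator_if_invariant[OF good h(1) this] FG(1)]
  have main: "D * integ (\<lambda>x. indicator F x * h x) = integ (indicator F) * integ h" .
  have "integ h / D = (\<integral>\<omega>. 1 * indicator G (\<eta> \<omega>) \<partial>J)" using hE[of "\<lambda>x. 1"] by simp
  also have "\<dots> = (\<integral>x. indicator G x \<partial>distr J borel \<eta>)" by (subst integral_distr) auto
  also have "\<dots> = integ (indicator G) / D" unfolding dist by (rule integral_norm_leb) auto
  finally have hG: "integ h / D = integ (indicator G) / D" .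
  have "(\<integral>\<omega>. indicator F (\<xi> \<omega>) * indicator G (\<eta> \<omega>) \<partial>J) = integ (\<lambda>x. indicator F x * h x) / D" by (rule hE) auto
  also have "\<dots> = (integ (indicator F) / D) * (integ h / D)" using main D_pos by (simp add: field_simps)
  finally show ?thesis unfolding hG .
qed

section \<open>Normalized measure on the restricted space and its joinings\<close>

abbreviation (input) M :: "real measure" where
  "M \<equiv> uniform_measure (restrict_space lborel {0..<D}) {0..<D}"

lemma space_M: "space M = {0..<D}" and sets_M: "sets M = sets (restrict_space borel {0..<D})"
  by (simp_all add: space_restrict_space sets_restrict_space)

lemma sets_M_iff: "A \<in> sets M \<longleftrightarrow> A \<in> sets borel \<and> A \<subseteq> {0..<D}"
  unfolding sets_M by (subst sets_restrict_space_iff) auto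

lemma integ_indicator_nonneg: "0 \<le> integ (indicator A) / D"
  using D_pos by (simp add: integ_nonneg)

lemma emeasure_M:
  assumes A: "A \<in> sets M"
  shows "emeasure M A = ennreal (integ (indicator A) / D)"
proof -
  have A': "A \<in> sets borel" "A \<subseteq> {0..<D}" using A by (simp_all only: sets_M_iff)
  have X: "{0..<D} \<in> sets (restrict_space lborel {0..<D})" "A \<in> sets (restrict_space lborel {0..<D})"
    using A' by (simp_all add: sets_restrict_space_iff)
  have eD: "emeasure (restrict_space lborel {0..<D}) {0..<D} = ennreal D"
    using D_pos by (simp add: emeasure_restrict_space)
  have "emeasure M A = emeasure (restrict_space lborel {0..<D}) ({0..<D} \<inter> A) / emeasure (restrict_space lborel {0..<D}) {0..<D}"
    by (rule emeasure_uniform_measure[OF X])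
  also have "{0..<D} \<inter> A = A" using A' by auto
  also have "emeasure (restrict_space lborel {0..<D}) A = emeasure lborel A" using A' by (simp add: emeasure_restrict_space)
  also have "emeasure lborel A = ennreal (integ (indicator A))"
  proof -
    have "emeasure lborel A \<le> emeasure lborel {0..<D}" using A' by (intro emeasure_mono) auto
    then have "emeasure lborel A \<noteq> \<infinity>" using D_pos by (auto simp: top_unique)
    moreover have "integ (indicator A) = (LBINT x. indicator A x)"
      unfolding integ_def using A' by (intro Bochner_Integration.integral_cong) (auto split: split_indicator)
    ultimately show ?thesis using A' by (simp add: emeasure_eq_ennreal_measure)
  qed
  finally show ?thesis unfolding eD using D_pos by (simp add: divide_ennreal integ_nonneg)
qed

lemma measurable_M_borel: "(\<lambda>x. x) \<in> M \<rightarrow>\<^sub>M borel"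
proof -
  have "(\<lambda>x. x) \<in> restrict_space borel {0..<D} \<rightarrow>\<^sub>M (borel :: real measure)" by (rule measurable_restrict_space1) simp
  then show ?thesis using measurable_cong_sets[OF sets_M refl] by blast
qed

lemma distr_M_borel: "distr M borel (\<lambda>x. x) = norm_leb"
proof (rule measure_eqI)
  fix B :: "real set" assume "B \<in> sets (distr M borel (\<lambda>x. x))"
  then have B[measurable]: "B \<in> sets borel" by simp
  have int: "integrable lborel (\<lambda>x. indicator {0..<D} x * (indicator B x / D))"
    using D_pos by (intro integrable_bounded_on_domain[where B="1 / D"]) (auto split: split_indicator)
  have BX: "B \<inter> {0..<D} \<in> sets M" using B by (subst sets_M_iff) auto
  have "emeasure (distr M borel (\<lambda>x. x)) B = emeasure M (B \<inter> {0..<D})"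
    using emeasure_distr[OF measurable_M_borel B] unfolding space_M by (simp add: vimage_def Int_def)
  also have "\<dots> = ennreal (integ (indicator (B \<inter> {0..<D})) / D)" by (rule emeasure_M[OF BX])
  also have "integ (indicator (B \<inter> {0..<D})) = integ (indicator B)"
    unfolding integ_def by (intro Bochner_Integration.integral_cong) (auto split: split_indicator)
  also have "ennreal (integ (indicator B) / D) = (\<integral>\<^sup>+x. ennreal (indicator {0..<D} x * (indicator B x / D)) \<partial>lborel)"
    using D_pos by (subst nn_integral_eq_integral[OF int]) (simp_all add: integ_def)
  also have "\<dots> = (\<integral>\<^sup>+x. ennreal (indicator {0..<D} x / D) * indicator B x \<partial>lborel)"
    by (intro nn_integral_cong) (auto split: split_indicator)
  also have "\<dots> = emeasure norm_leb B" unfolding norm_leb_def by (rule emeasure_density[symmetric]) auto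
  finally show "emeasure (distr M borel (\<lambda>x. x)) B = emeasure norm_leb B" .
qed simp

lemma prob_space_M: "prob_space M"
  using D_pos by (intro prob_space_uniform_measure) (simp_all add: emeasure_restrict_space)

lemma measurable_M_T_funpow: "T ^^ n \<in> M \<rightarrow>\<^sub>M M"
proof -
  have "T ^^ n \<in> restrict_space borel {0..<D} \<rightarrow>\<^sub>M restrict_space borel {0..<D}"
    by (intro measurable_restrict_space3 measurable_T_funpow) (use T_funpow_mem[of _ n] in \<open>auto simp: Pi_def\<close>)
  then show ?thesis using measurable_cong_sets[OF sets_M sets_M] by blast
qed

lemma distr_M_T_funpow: "distr M M (T ^^ n) = M"
proof (rule measure_eqI)
  fix A assume "A \<in> sets (distr M M (T ^^ n))"
  then have A: "A \<in> sets M" by simp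
  have A': "A \<in> sets borel" using A by (simp only: sets_M_iff)
  have "emeasure (distr M M (T ^^ n)) A = emeasure M ((T ^^ n) -` A \<inter> space M)"
    by (rule emeasure_distr[OF measurable_M_T_funpow A])
  also have "\<dots> = ennreal (integ (indicator ((T ^^ n) -` A \<inter> space M)) / D)"
    by (rule emeasure_M) (rule measurable_sets[OF measurable_M_T_funpow A])
  also have "integ (indicator ((T ^^ n) -` A \<inter> space M)) = integ (\<lambda>x. indicator A ((T ^^ n) x))"
    unfolding integ_def space_M by (intro Bochner_Integration.integral_cong) (auto split: split_indicator)
  also have "\<dots> = integ (indicator A)" using A' by (intro integ_T_funpow[where B=1]) (auto split: split_indicator)
  finally show "emeasure (distr M M (T ^^ n)) A = emeasure M A" using emeasure_M[OF A] by simp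
qed simp

text \<open>Disjointness is stated as an equivalence, so the product must itself be a joining; this
  rests on the invariance of the measure under powers of \<open>T\<close>.\<close>

lemma joining_product: "joining M (T ^^ n) M (T ^^ m) (M \<Otimes>\<^sub>M M)"
proof -
  interpret M: prob_space M by (rule prob_space_M)
  have [measurable]: "T ^^ k \<in> M \<rightarrow>\<^sub>M M" for k by (rule measurable_M_T_funpow)
  have mp: "map_prod (T ^^ n) (T ^^ m) = (\<lambda>(x, y). ((T ^^ n) x, (T ^^ m) y))" by (simp add: fun_eq_iff)
  have "distr (M \<Otimes>\<^sub>M M) M snd = M"
  proof (rule measure_eqI)
    fix A assume "A \<in> sets (distr (M \<Otimes>\<^sub>M M) M snd)"
    then have A: "A \<in> sets M" by simp
    have "snd -` A \<inter> space (M \<Otimes>\<^sub>M M) = space M \<times> A"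
      using sets.sets_into_space[OF A] by (auto simp: space_pair_measure)
    then have "emeasure (distr (M \<Otimes>\<^sub>M M) M snd) A = emeasure (M \<Otimes>\<^sub>M M) (space M \<times> A)"
      using A by (subst emeasure_distr) (auto simp del: space_uniform_measure sets_uniform_measure)
    also have "\<dots> = emeasure M (space M) * emeasure M A" by (rule M.emeasure_pair_measure_Times[OF sets.top A])
    finally show "emeasure (distr (M \<Otimes>\<^sub>M M) M snd) A = emeasure M A" by (simp add: M.emeasure_space_1 del: space_uniform_measure)
  qed simp
  moreover have "distr (M \<Otimes>\<^sub>M M) M fst = M" by (rule M.distr_pair_fst)
  moreover have "map_prod (T ^^ n) (T ^^ m) \<in> M \<Otimes>\<^sub>M M \<rightarrow>\<^sub>M M \<Otimes>\<^sub>M M" unfolding mp by measurable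
  moreover have "distr (M \<Otimes>\<^sub>M M) (M \<Otimes>\<^sub>M M) (map_prod (T ^^ n) (T ^^ m)) = M \<Otimes>\<^sub>M M"
  proof -
    have "sigma_finite_measure (distr M M (T ^^ m))" unfolding distr_M_T_funpow by unfold_locales
    from pair_measure_distr[OF measurable_M_T_funpow measurable_M_T_funpow this, of n] show ?thesis
      unfolding distr_M_T_funpow mp by simp
  qed
  ultimately show ?thesis unfolding joining_def by simp
qed

lemma joining_unique:
  assumes good: "good_pair \<alpha> \<beta>" and nm: "0 < n" "n < m" and J: "joining M (T ^^ n) M (T ^^ m) J"
  shows "J = M \<Otimes>\<^sub>M M"
proof -
  interpret M: prob_space M by (rule prob_space_M)
  have sJ: "sets J = sets (M \<Otimes>\<^sub>M M)" and d: "distr J M fst = M" "distr J M snd = M"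
    and mp: "map_prod (T ^^ n) (T ^^ m) \<in> J \<rightarrow>\<^sub>M J" "distr J J (map_prod (T ^^ n) (T ^^ m)) = J"
    using J by (auto simp: joining_def)
  have fs: "fst \<in> J \<rightarrow>\<^sub>M M" "snd \<in> J \<rightarrow>\<^sub>M M"
    unfolding measurable_cong_sets[OF sJ refl] by (rule measurable_fst measurable_snd)+
  have spJ: "space J = {0..<D} \<times> {0..<D}" unfolding sets_eq_imp_space_eq[OF sJ] space_pair_measure space_M ..
  interpret J: prob_space J by (rule prob_space_distrD[OF fs(1)]) (simp only: d, rule prob_space_M)
  have fb[measurable]: "fst \<in> J \<rightarrow>\<^sub>M borel" "snd \<in> J \<rightarrow>\<^sub>M borel"
    using measurable_compose[OF fs(1) measurable_M_borel] measurable_compose[OF fs(2) measurable_M_borel] .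
  have dist: "distr J borel fst = norm_leb" "distr J borel snd = norm_leb"
    using distr_distr[OF measurable_M_borel fs(1)] distr_distr[OF measurable_M_borel fs(2)]
    unfolding d distr_M_borel by (simp_all add: comp_def)
  have inv: "(\<integral>\<omega>. f ((T ^^ n) (fst \<omega>)) * g ((T ^^ m) (snd \<omega>)) \<partial>J) = (\<integral>\<omega>. f (fst \<omega>) * g (snd \<omega>) \<partial>J)"
    if "test_fun f" "test_fun g" for f g
  proof -
    have [measurable]: "f \<in> borel_measurable borel" "g \<in> borel_measurable borel" using that by (auto simp: test_fun_def)
    have "(\<integral>\<omega>. f (fst \<omega>) * g (snd \<omega>) \<partial>distr J J (map_prod (T ^^ n) (T ^^ m))) = (\<integral>\<omega>. f (fst (map_prod (T ^^ n) (T ^^ m) \<omega>)) * g (snd (map_prod (T ^^ n) (T ^^ m) \<omega>)) \<partial>J)"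
      by (rule integral_distr[OF mp(1)]) measurable
    then show ?thesis unfolding mp(2) by simp
  qed
  have "M \<Otimes>\<^sub>M M = J"
  proof (rule pair_measure_eqI)
    fix A B assume A: "A \<in> sets M" and B: "B \<in> sets M"
    have AB: "A \<in> sets borel" "B \<in> sets borel" using A B by (simp_all only: sets_M_iff)
    have P: "A \<times> B \<in> sets J" unfolding sJ using A B by (rule pair_measureI)
    have "measure J (A \<times> B) = (\<integral>\<omega>. indicator (A \<times> B) \<omega> \<partial>J)" using P sets.sets_into_space[OF P] by (simp add: Int_absorb2)
    also have "\<dots> = (\<integral>\<omega>. indicator A (fst \<omega>) * indicator B (snd \<omega>) \<partial>J)"
      by (intro Bochner_Integration.integral_cong) (auto simp: indicator_def)
    also have "\<dots> = (integ (indicator A) / D) * (integ (indicator B) / D)"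
      by (rule joining_independent[OF good nm J.finite_measure_axioms fb dist _ inv AB]) (auto simp: spJ)
    finally have "emeasure J (A \<times> B) = ennreal ((integ (indicator A) / D) * (integ (indicator B) / D))"
      by (simp only: J.emeasure_eq_measure)
    then show "emeasure M A * emeasure M B = emeasure J (A \<times> B)"
      unfolding emeasure_M[OF A] emeasure_M[OF B] by (simp add: ennreal_mult integ_indicator_nonneg del: times_divide_eq_left times_divide_eq_right)
  qed (simp_all only: sJ, unfold_locales)
  then show ?thesis by simp
qed

text \<open>Powers of both maps agree on the space of the measures, and measurability and image
  measures see nothing else.\<close>

lemma joining_cong:
  assumes "\<And>x. x \<in> {0..<D} \<Longrightarrow> S x = T x"
  shows "joining M (S ^^ n) M (S ^^ m) J \<longleftrightarrow> joining M (T ^^ n) M (T ^^ m) J"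
proof (cases "sets J = sets (M \<Otimes>\<^sub>M M)")
  case True
  have ST: "(S ^^ k) x = (T ^^ k) x" if "x \<in> {0..<D}" for k x
    by (induction k) (use assms T_funpow_mem[OF that] in simp_all)
  have sp: "space J = {0..<D} \<times> {0..<D}" unfolding sets_eq_imp_space_eq[OF True] space_pair_measure space_M ..
  have e: "map_prod (S ^^ n) (S ^^ m) \<omega> = map_prod (T ^^ n) (T ^^ m) \<omega>" if "\<omega> \<in> space J" for \<omega>
    using that ST unfolding sp by auto
  have "map_prod (S ^^ n) (S ^^ m) \<in> J \<rightarrow>\<^sub>M J \<longleftrightarrow> map_prod (T ^^ n) (T ^^ m) \<in> J \<rightarrow>\<^sub>M J"
    by (rule measurable_cong[OF e])
  moreover have "distr J J (map_prod (S ^^ n) (S ^^ m)) = distr J J (map_prod (T ^^ n) (T ^^ m))"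
    by (rule distr_cong[OF refl refl e])
  ultimately show ?thesis by (simp add: joining_def)
qed (simp add: joining_def)

lemma disjoint_powers:
  assumes "good_pair \<alpha> \<beta>" "0 < n" "n < m" "\<And>x. x \<in> {0..<D} \<Longrightarrow> S x = T x"
  shows "disjoint_maps M (S ^^ n) M (S ^^ m)"
proof -
  have "joining M (S ^^ n) M (S ^^ m) J \<longleftrightarrow> J = M \<Otimes>\<^sub>M M" for J
  proof -
    have "joining M (S ^^ n) M (S ^^ m) J \<longleftrightarrow> joining M (T ^^ n) M (T ^^ m) J" by (rule joining_cong[OF assms(4)])
    also have "\<dots> \<longleftrightarrow> J = M \<Otimes>\<^sub>M M"
    proof
      assume "joining M (T ^^ n) M (T ^^ m) J"
      then show "J = M \<Otimes>\<^sub>M M" by (rule joining_unique[OF assms(1-3)])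
    qed (simp only: joining_product)
    finally show ?thesis .
  qed
  then show ?thesis unfolding disjoint_maps_def by (intro allI)
qed

section \<open>Identification with the interval exchange\<close>

lemma iet_eq_T:
  assumes l: "l 1 = a" "l 2 = b" "l 3 = c" and x: "x \<in> {0..<D}"
  shows "iet 3 l perm321 x = T x"
proof -
  have s: "{1..<1::nat} = {}" "{1..<2::nat} = {1}" "{1..<3::nat} = {1, 2}" "{1..1::nat} = {1}" "{1..2::nat} = {1, 2}" "{1..3::nat} = {1, 2, 3}" by auto
  have I: "iet_interval l 1 = {0..<a}" "iet_interval l 2 = {a..<a + b}" "iet_interval l 3 = {a + b..<D}"
    unfolding iet_interval_def s using l by (simp_all add: lengths add.assoc)
  have perm: "{k. k \<in> {1..3} \<and> perm321 k < perm321 1} = {2, 3}" "{k. k \<in> {1..3} \<and> perm321 k < perm321 2} = {3}" "{k. k \<in> {1..3} \<and> perm321 k < perm321 3} = {}"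
    unfolding s by (auto simp: perm321_def)
  have j: "(THE j. j \<in> {1..3} \<and> x \<in> iet_interval l j) = j" if "j \<in> {1, 2, 3}" "x \<in> iet_interval l j" for j
  proof (rule the_equality)
    show "j \<in> {1..3} \<and> x \<in> iet_interval l j" using that unfolding s by simp
    fix i assume "i \<in> {1..3} \<and> x \<in> iet_interval l i"
    then have "i \<in> {1, 2, 3}" "x \<in> iet_interval l i" unfolding s by simp_all
    then show "i = j" using that pos by (elim insertE emptyE; simp only: I; simp)
  qed
  consider "x < a" | "a \<le> x" "x < a + b" | "a + b \<le> x" by linarith
  then show ?thesis
  proof cases
    case 1
    then have t: "(THE j. j \<in> {1..3} \<and> x \<in> iet_interval l j) = 1" using x by (intro j) (simp_all only: I, auto)
    show ?thesis unfolding iet_def Let_def unfolding t unfolding perm unfolding s by (use 1 l in \<open>simp add: T_def lengths\<close>)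
  next
    case 2
    then have t: "(THE j. j \<in> {1..3} \<and> x \<in> iet_interval l j) = 2" using x by (intro j) (simp_all only: I, auto)
    show ?thesis unfolding iet_def Let_def unfolding t unfolding perm unfolding s by (use 2 l in \<open>simp add: T_def lengths\<close>)
  next
    case 3
    then have t: "(THE j. j \<in> {1..3} \<and> x \<in> iet_interval l j) = 3" using x by (intro j) (simp_all only: I, auto)
    show ?thesis unfolding iet_def Let_def unfolding t unfolding perm unfolding s by (use 3 l pos in \<open>simp add: T_def lengths\<close>)
  qed
qed

end

theorem theoremB1:
  "AE v in (lebesgue :: (real ^ 3) measure). (\<forall>i. 0 < v $ i) \<longrightarrow>
     (let l = lengths3 v; T = iet 3 l perm321; \<mu> = iet_measure 3 l in
      \<forall>n m :: nat. 0 < n \<and> n < m \<longrightarrow> disjoint_maps \<mu> (T ^^ n) \<mu> (T ^^ m))"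
proof (rule AE_mp[OF AE_lengths_good_pair], intro AE_I2 impI)
  fix v :: "real ^ 3"
  assume good: "(\<forall>i. 0 < v $ i) \<longrightarrow> good_pair ((v $ 2 + v $ 3) / rotation_circumference v) (v $ 2 / rotation_circumference v)"
    and vpos: "\<forall>i. 0 < v $ i"
  interpret three_interval "v $ 1" "v $ 2" "v $ 3" by unfold_locales (use vpos in auto)
  have good': "good_pair \<alpha> \<beta>" using good vpos unfolding \<alpha>_def \<beta>_def C_def L_def rotation_circumference_def by blast
  have l: "lengths3 v 1 = v $ 1" "lengths3 v 2 = v $ 2" "lengths3 v 3 = v $ 3" by (simp_all add: lengths3_def)
  have "{1..3::nat} = {1, 2, 3}" by auto
  then have "iet_domain 3 (lengths3 v) = {0..<D}" unfolding iet_domain_def using l by (simp add: D_def add.assoc)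
  then have \<mu>: "iet_measure 3 (lengths3 v) = uniform_measure (restrict_space lborel {0..<D}) {0..<D}"
    by (simp add: iet_measure_def)
  show "let l = lengths3 v; T = iet 3 l perm321; \<mu> = iet_measure 3 l in
      \<forall>n m :: nat. 0 < n \<and> n < m \<longrightarrow> disjoint_maps \<mu> (T ^^ n) \<mu> (T ^^ m)"
    unfolding Let_def \<mu> using disjoint_powers[OF good'] iet_eq_T[OF l] by blast
qed


end
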